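(* Let $(A,C,\psi)$ be an entwining structure over a field $k$ and let $r\ge1$. The maps $tr^\bullet:\mathscr C^\bullet(A,C,\psi)\to\mathscr C^\bullet(M_r(A),C,\psi)$ and $inc_1^\bullet:\mathscr C^\bullet(M_r(A),C,\psi)\to\mathscr C^\bullet(A,C,\psi)$ are homotopy inverses to each other. In particular, the morphisms $tr^\bullet:HH^\bullet(A,C,\psi)\to HH^\bullet(M_r(A),C,\psi)$ and $inc_1^\bullet:HH^\bullet(M_r(A),C,\psi)\to HH^\bullet(A,C,\psi)$ are mutually inverse isomorphisms of Hochschild cohomologies.
   Context: Let $k$ be a field; $\otimes$ and $Hom$ are over $k$. An entwining structure $(A,C,\psi)$ over $k$ consists of a unital associative $k$-algebra $A$ with product $\theta$, a counital coassociative $k$-coalgebra $C$ (coproduct $\Delta$, counit $\varepsilon$), and a $k$-linear map $\psi:C\otimes A\to A\otimes C$, written $\psi(c\otimes a)=a_\psi\otimes c^\psi$ with summation suppressed, such that: (i) $\psi\circ(id_C\otimes\theta)=(\theta\otimes id_C)\circ(id_A\otimes\psi)\circ(\psi\otimes id_A)$; (ii) $(id_A\otimes\Delta)\circ\psi=(\psi\otimes id_C)\circ(id_C\otimes\psi)\circ(\Delta\otimes id_A)$; (iii) $a_\psi\,\varepsilon(c^\psi)=\varepsilon(c)a$; (iv) $1_\psi\otimes c^\psi=1\otimes c$. The Hochschild complex is $\mathscr C^n(A,C,\psi)=Hom(C\otimes A^{\otimes n+1},k)$, $n\ge0$, with $$\delta^n(g)(c,a_1,\dots,a_{n+2})=g(c^\psi,a_2,\dots,a_{n+1},a_{n+2}a_{1\psi})+\sum_{i=1}^{n+1}(-1)^i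 g(c,a_1,\dots,a_ia_{i+1},\dots,a_{n+2});$$ its cohomology is $HH^\bullet(A,C,\psi)$. $M_r(A)=A\otimes M_r(k)$ is the algebra of $r\times r$ matrices over $A$; $E_{ij}(a)$ is the matrix with $(i,j)$ entry $a$ and all others $0$. The entwining extends to $\psi:C\otimes M_r(A)\to M_r(A)\otimes C$, $\psi(c\otimes(a\otimes u))=(a_\psi\otimes u)\otimes c^\psi$ for $a\in A$, $u\in M_r(k)$, making $(M_r(A),C,\psi)$ an entwining structure. Let $inc_1:A\to M_r(A)$, $a\mapsto E_{11}(a)$, and $inc_1^n(f)=f\circ(id_C\otimes inc_1^{\otimes n+1})$. The generalized trace is $tr:C\otimes M_r(A)^{\otimes n+1}\to C\otimes A^{\otimes n+1}$, $tr(c\otimes a_1u_1\otimes\cdots\otimes a_{n+1}u_{n+1})=tr(u_1\cdots u_{n+1})\,(c\otimes a_1\otimes\cdots\otimes a_{n+1})$ for $a_i\in A$, $u_i\in M_r(k)$, and $tr^n(g)=g\circ tr$. *)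

theory Defs
  imports "HOL-Analysis.Analysis" "HOL-Library.Function_Algebras"
begin

section \<open>Linear and multilinear maps\<close>

text \<open>
  Vector spaces over the field \<open>'k\<close> are types with a scalar multiplication satisfying
  \<^locale>\<open>vector_space\<close>; subspaces occur as sets. Function types carry the pointwise structure
  of \<^theory>\<open>HOL-Library.Function_Algebras\<close> and \<open>fscale\<close>.
\<close>

definition fscale :: "'k::field \<Rightarrow> ('x \<Rightarrow> 'k) \<Rightarrow> 'x \<Rightarrow> 'k" where
  "fscale k f = (\<lambda>x. k * f x)"

definition linear_on ::
  "('k::field \<Rightarrow> 'v::ab_group_add \<Rightarrow> 'v) \<Rightarrow> 'v set \<Rightarrow>
   ('k \<Rightarrow> 'w::ab_group_add \<Rightarrow> 'w) \<Rightarrow> 'w set \<Rightarrow> ('v \<Rightarrow> 'w) \<Rightarrow> bool" where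
  "linear_on sV S sW T f \<longleftrightarrow>
     (\<forall>x\<in>S. f x \<in> T) \<and>
     (\<forall>x\<in>S. \<forall>y\<in>S. f (x + y) = f x + f y) \<and>
     (\<forall>k. \<forall>x\<in>S. f (sV k x) = sW k (f x))"

text \<open>
  \<open>Hom(S, T)\<close> for subspaces \<open>S\<close>, \<open>T\<close>. The value \<open>0\<close> outside \<open>S\<close> is a convention which makes
  a linear map on \<open>S\<close> a unique HOL function.
\<close>

definition linear_maps ::
  "('k::field \<Rightarrow> 'v::ab_group_add \<Rightarrow> 'v) \<Rightarrow> 'v set \<Rightarrow>
   ('k \<Rightarrow> 'w::ab_group_add \<Rightarrow> 'w) \<Rightarrow> 'w set \<Rightarrow> ('v \<Rightarrow> 'w) set" where
  "linear_maps sV S sW T = {f. linear_on sV S sW T f \<and> (\<forall>x. x \<notin> S \<longrightarrow> f x = 0)}"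

definition bilinear_map ::
  "('k::field \<Rightarrow> 'm::ab_group_add \<Rightarrow> 'm) \<Rightarrow> ('k \<Rightarrow> 'n::ab_group_add \<Rightarrow> 'n) \<Rightarrow>
   ('k \<Rightarrow> 'v::ab_group_add \<Rightarrow> 'v) \<Rightarrow> ('m \<Rightarrow> 'n \<Rightarrow> 'v) \<Rightarrow> bool" where
  "bilinear_map sM sN sV f \<longleftrightarrow>
     (\<forall>x. Vector_Spaces.linear sN sV (\<lambda>y. f x y)) \<and>
     (\<forall>y. Vector_Spaces.linear sM sV (\<lambda>x. f x y))"

text \<open>Maps \<open>C \<times> A\<^sup>m \<rightarrow> V\<close> linear in each argument; elements of \<open>A\<^sup>m\<close> are lists of length \<open>m\<close>.\<close>

definition multilinear_map ::
  "('k::field \<Rightarrow> 'c::ab_group_add \<Rightarrow> 'c) \<Rightarrow> ('k \<Rightarrow> 'a::ab_group_add \<Rightarrow> 'a) \<Rightarrow> nat \<Rightarrow>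
   ('k \<Rightarrow> 'v::ab_group_add \<Rightarrow> 'v) \<Rightarrow> ('c \<Rightarrow> 'a list \<Rightarrow> 'v) \<Rightarrow> bool" where
  "multilinear_map sC sA m sV f \<longleftrightarrow>
     (\<forall>as. length as = m \<longrightarrow> Vector_Spaces.linear sC sV (\<lambda>c. f c as)) \<and>
     (\<forall>c as p. length as = m \<and> p < m \<longrightarrow> Vector_Spaces.linear sA sV (\<lambda>x. f c (as[p := x])))"


section \<open>Tensor products\<close>

text \<open>
  Over a field, bilinear forms separate the elements of \<open>M \<otimes> N\<close>. Hence \<open>M \<otimes> N\<close> is realised
  inside the space of functionals on bilinear forms, as the span of the functionals
  \<open>x \<otimes> y : \<beta> \<mapsto> \<beta> (x, y)\<close>. The universal property is proved below.
\<close>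

type_synonym ('m, 'n, 'k) tensor = "('m \<times> 'n \<Rightarrow> 'k) \<Rightarrow> 'k"

definition eval_at :: "('x \<Rightarrow> 'k::field) set \<Rightarrow> 'x \<Rightarrow> ('x \<Rightarrow> 'k) \<Rightarrow> 'k" where
  "eval_at B x = (\<lambda>\<beta>. if \<beta> \<in> B then \<beta> x else 0)"

definition tensor ::
  "('k::field \<Rightarrow> 'm::ab_group_add \<Rightarrow> 'm) \<Rightarrow> ('k \<Rightarrow> 'n::ab_group_add \<Rightarrow> 'n) \<Rightarrow>
   'm \<Rightarrow> 'n \<Rightarrow> ('m, 'n, 'k) tensor" where
  "tensor sM sN x y = eval_at {\<beta>. bilinear_map sM sN (*) (curry \<beta>)} (x, y)"

definition tensor_space ::
  "('k::field \<Rightarrow> 'm::ab_group_add \<Rightarrow> 'm) \<Rightarrow> ('k \<Rightarrow> 'n::ab_group_add \<Rightarrow> 'n) \<Rightarrow>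
   ('m, 'n, 'k) tensor set" where
  "tensor_space sM sN = module.span fscale {tensor sM sN x y | x y. True}"

text \<open>
  The linear map on \<open>M \<otimes> N\<close> induced by a bilinear map \<open>f\<close>. In Sweedler notation, if
  \<open>t = x\<^sub>1 \<otimes> x\<^sub>2\<close> (summation suppressed), then \<open>tensor_lift sM sN sV f t = f x\<^sub>1 x\<^sub>2\<close>.
\<close>

definition tensor_lift ::
  "('k::field \<Rightarrow> 'm::ab_group_add \<Rightarrow> 'm) \<Rightarrow> ('k \<Rightarrow> 'n::ab_group_add \<Rightarrow> 'n) \<Rightarrow>
   ('k \<Rightarrow> 'v::ab_group_add \<Rightarrow> 'v) \<Rightarrow> ('m \<Rightarrow> 'n \<Rightarrow> 'v) \<Rightarrow> ('m, 'n, 'k) tensor \<Rightarrow> 'v" where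
  "tensor_lift sM sN sV f =
     (THE F. F \<in> linear_maps fscale (tensor_space sM sN) sV UNIV \<and>
             (\<forall>x y. F (tensor sM sN x y) = f x y))"

text \<open>
  \<open>(x \<otimes> y) \<otimes> z\<close>, formed with the whole function type as left factor. As \<open>M \<otimes> N\<close> is a subspace
  of that type, the span of these elements is \<open>(M \<otimes> N) \<otimes> P\<close>, vector spaces being flat.
\<close>

definition tensor3 ::
  "('k::field \<Rightarrow> 'm::ab_group_add \<Rightarrow> 'm) \<Rightarrow> ('k \<Rightarrow> 'n::ab_group_add \<Rightarrow> 'n) \<Rightarrow>
   ('k \<Rightarrow> 'p::ab_group_add \<Rightarrow> 'p) \<Rightarrow> 'm \<Rightarrow> 'n \<Rightarrow> 'p \<Rightarrow> (('m, 'n, 'k) tensor, 'p, 'k) tensor" where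
  "tensor3 sM sN sP x y z = tensor fscale sP (tensor sM sN x y) z"

text \<open>The same construction for \<open>C \<otimes> A\<^sup>\<otimes>\<^sup>m\<close>: \<open>mtensor sC sA m c [a\<^sub>1, \<dots>, a\<^sub>m]\<close> is \<open>c \<otimes> a\<^sub>1 \<otimes> \<dots> \<otimes> a\<^sub>m\<close>.\<close>

definition mtensor ::
  "('k::field \<Rightarrow> 'c::ab_group_add \<Rightarrow> 'c) \<Rightarrow> ('k \<Rightarrow> 'a::ab_group_add \<Rightarrow> 'a) \<Rightarrow> nat \<Rightarrow>
   'c \<Rightarrow> 'a list \<Rightarrow> ('c, 'a list, 'k) tensor" where
  "mtensor sC sA m c as = eval_at {\<beta>. multilinear_map sC sA m (*) (curry \<beta>)} (c, as)"

definition mtensor_space ::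
  "('k::field \<Rightarrow> 'c::ab_group_add \<Rightarrow> 'c) \<Rightarrow> ('k \<Rightarrow> 'a::ab_group_add \<Rightarrow> 'a) \<Rightarrow> nat \<Rightarrow>
   ('c, 'a list, 'k) tensor set" where
  "mtensor_space sC sA m = module.span fscale {mtensor sC sA m c as | c as. length as = m}"

definition mtensor_lift ::
  "('k::field \<Rightarrow> 'c::ab_group_add \<Rightarrow> 'c) \<Rightarrow> ('k \<Rightarrow> 'a::ab_group_add \<Rightarrow> 'a) \<Rightarrow> nat \<Rightarrow>
   ('k \<Rightarrow> 'v::ab_group_add \<Rightarrow> 'v) \<Rightarrow> ('c \<Rightarrow> 'a list \<Rightarrow> 'v) \<Rightarrow> ('c, 'a list, 'k) tensor \<Rightarrow> 'v" where
  "mtensor_lift sC sA m sV f =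
     (THE F. F \<in> linear_maps fscale (mtensor_space sC sA m) sV UNIV \<and>
             (\<forall>c as. length as = m \<longrightarrow> F (mtensor sC sA m c as) = f c as))"

lemma vector_space_fscale: "vector_space (fscale :: 'k::field \<Rightarrow> ('x \<Rightarrow> 'k) \<Rightarrow> _)"
  by unfold_locales (auto simp: fscale_def fun_eq_iff algebra_simps)

lemma vector_space_times: "vector_space ((*) :: 'k::field \<Rightarrow> 'k \<Rightarrow> 'k)"
  by unfold_locales (auto simp: algebra_simps)

lemma linear_form_separates:
  fixes sV :: "'k::field \<Rightarrow> 'v::ab_group_add \<Rightarrow> 'v"
  assumes "vector_space sV" and "\<And>\<phi>. Vector_Spaces.linear sV (*) \<phi> \<Longrightarrow> \<phi> v = \<phi> w"
  shows "v = w"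
proof (rule ccontr)
  assume "v \<noteq> w"
  interpret V: vector_space sV by fact
  interpret K: vector_space "(*) :: 'k \<Rightarrow> 'k \<Rightarrow> 'k" by (rule vector_space_times)
  interpret vector_space_pair sV "(*) :: 'k \<Rightarrow> 'k \<Rightarrow> 'k" ..
  have "V.independent {v - w}"
    using \<open>v \<noteq> w\<close> by (simp add: V.dependent_single)
  from linear_independent_extend[OF this, of "\<lambda>_. 1"] obtain \<phi>
    where \<phi>: "Vector_Spaces.linear sV (*) \<phi>" "\<phi> (v - w) = 1" by auto
  have "\<phi> (v - w) = \<phi> v - \<phi> w"
    using \<phi>(1) by (rule linear_diff)
  with \<phi> assms(2)[of \<phi>] show False by simp
qed

lemma linear_on_span_eq:
  assumes V: "vector_space sV" and W: "vector_space sW"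
    and F: "linear_on sV (module.span sV S) sW T F"
    and G: "linear_on sV (module.span sV S) sW T G"
    and eq: "\<And>x. x \<in> S \<Longrightarrow> F x = G x"
    and t: "t \<in> module.span sV S"
  shows "F t = G t"
proof -
  interpret V: vector_space sV by fact
  interpret W: vector_space sW by fact
  have add: "H (x + y) = H x + H y" and scale: "H (sV k x) = sW k (H x)"
    if "linear_on sV (V.span S) sW T H" "x \<in> V.span S" "y \<in> V.span S" for H x y k
    using that by (simp_all add: linear_on_def)
  have zero: "H 0 = 0" if "linear_on sV (V.span S) sW T H" for H
    using scale[OF that V.span_zero V.span_zero, of 0] by simp
  have "t \<in> V.span S \<and> F t = G t"
    using t
  proof (induction rule: V.span_induct_alt)
    case base
    show ?case by (simp add: V.span_zero zero[OF F] zero[OF G])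
  next
    case (step c x y)
    have x: "x \<in> V.span S" "sV c x \<in> V.span S"
      using step.hyps by (auto intro: V.span_base V.span_scale)
    have y: "y \<in> V.span S" "F y = G y"
      using step.IH by auto
    show ?case
      using y(2) eq[OF step.hyps(1)]
      by (simp add: V.span_add x y(1) add[OF F x(2) y(1)] add[OF G x(2) y(1)]
          scale[OF F x(1) x(1)] scale[OF G x(1) x(1)])
  qed
  then show ?thesis ..
qed

lemma eval_lift_unique_existence:
  fixes sV :: "'k::field \<Rightarrow> 'v::ab_group_add \<Rightarrow> 'v" and f :: "'x \<Rightarrow> 'v"
  assumes V: "vector_space sV"
    and f: "\<And>\<phi>. Vector_Spaces.linear sV (*) \<phi> \<Longrightarrow> (\<lambda>x. \<phi> (f x)) \<in> B"
  shows "\<exists>!F. F \<in> linear_maps fscale (module.span fscale (eval_at B ` S)) sV UNIV \<and>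
              (\<forall>x\<in>S. F (eval_at B x) = f x)"
proof -
  interpret V: vector_space sV by (rule V)
  interpret T: vector_space "fscale :: 'k \<Rightarrow> (('x \<Rightarrow> 'k) \<Rightarrow> 'k) \<Rightarrow> _" by (rule vector_space_fscale)
  define U where "U = T.span (eval_at B ` S)"
  define R where "R t v \<longleftrightarrow> (\<forall>\<phi>. Vector_Spaces.linear sV (*) \<phi> \<longrightarrow> t (\<lambda>x. \<phi> (f x)) = \<phi> v)" for t v
  have R_unique: "v = w" if "R t v" "R t w" for t v w
    using V that by (auto simp: R_def intro: linear_form_separates)
  have R_add: "R (t + u) (v + w)" if "R t v" "R u w" for t u v w
    using that unfolding R_def plus_fun_def by (metis Vector_Spaces.linear_iff)
  have R_scale: "R (fscale k t) (sV k v)" if "R t v" for k t v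
    using that unfolding R_def fscale_def by (metis Vector_Spaces.linear_iff)
  have R_eval: "R (eval_at B x) (f x)" for x
    using f by (auto simp: R_def eval_at_def)
  have ex: "\<exists>v. R t v" if "t \<in> U" for t
    using that unfolding U_def
  proof (induction rule: T.span_induct_alt)
    case base
    have "R 0 0" using R_scale[OF R_eval, of 0 undefined] by simp
    then show ?case ..
  next
    case (step c x y)
    then show ?case using R_add R_scale R_eval by blast
  qed
  define F where "F t = (if t \<in> U then THE v. R t v else 0)" for t
  have RF: "R t (F t)" if "t \<in> U" for t
  proof -
    obtain v where v: "R t v" using ex \<open>t \<in> U\<close> by blast
    then have "(THE v. R t v) = v" by (rule the_equality) (rule R_unique[OF _ v])
    with v \<open>t \<in> U\<close> show ?thesis by (simp add: F_def)
  qed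
  have F: "F \<in> linear_maps fscale U sV UNIV"
    unfolding linear_maps_def linear_on_def
  proof (intro CollectI conjI ballI allI impI)
    fix x y assume "x \<in> U" "y \<in> U"
    then show "F (x + y) = F x + F y"
      by (intro R_unique[of "x + y"] RF R_add) (auto simp: U_def T.span_add)
  next
    fix k x assume "x \<in> U"
    then show "F (fscale k x) = sV k (F x)"
      by (intro R_unique[of "fscale k x"] RF R_scale) (auto simp: U_def T.span_scale)
  qed (auto simp: F_def)
  have F_eval: "F (eval_at B x) = f x" if "x \<in> S" for x
    using that by (intro R_unique[OF RF R_eval]) (auto simp: U_def T.span_base)
  show ?thesis
  proof (rule ex1I[of _ F])
    show "F \<in> linear_maps fscale (module.span fscale (eval_at B ` S)) sV UNIV \<and>
          (\<forall>x\<in>S. F (eval_at B x) = f x)"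
      using F F_eval by (simp add: U_def)
  next
    fix G assume G: "G \<in> linear_maps fscale (module.span fscale (eval_at B ` S)) sV UNIV \<and>
          (\<forall>x\<in>S. G (eval_at B x) = f x)"
    show "G = F"
    proof
      fix t show "G t = F t"
      proof (cases "t \<in> U")
        case True
        have "linear_on fscale U sV UNIV G" "linear_on fscale U sV UNIV F"
          using F G by (auto simp: linear_maps_def U_def)
        note GF = this[unfolded U_def]
        have "G y = F y" if "y \<in> eval_at B ` S" for y
          using that G F_eval by force
        from linear_on_span_eq[OF T.vector_space_axioms V GF this True[unfolded U_def]]
        show ?thesis .
      next
        case False
        then show ?thesis using F G by (auto simp: linear_maps_def U_def)
      qed
    qed
  qed
qed

theorem tensor_lift_unique_existence:
  assumes V: "vector_space sV" and f: "bilinear_map sM sN sV f"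
  shows "\<exists>!F. F \<in> linear_maps fscale (tensor_space sM sN) sV UNIV \<and>
              (\<forall>x y. F (tensor sM sN x y) = f x y)"
proof -
  define B where "B = {\<beta>. bilinear_map sM sN (*) (curry \<beta>)}"
  have B: "(\<lambda>z. \<phi> (case_prod f z)) \<in> B" if \<phi>: "Vector_Spaces.linear sV (*) \<phi>" for \<phi>
  proof -
    have "Vector_Spaces.linear sN (*) (\<lambda>y. \<phi> (f x y))" for x
      using f Vector_Spaces.linear_compose[OF _ \<phi>, of sN "f x"]
      by (simp add: bilinear_map_def o_def)
    moreover have "Vector_Spaces.linear sM (*) (\<lambda>x. \<phi> (f x y))" for y
      using f Vector_Spaces.linear_compose[OF _ \<phi>, of sM "\<lambda>x. f x y"]
      by (simp add: bilinear_map_def o_def)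
    ultimately show ?thesis by (simp add: B_def bilinear_map_def curry_def)
  qed
  have tensor: "tensor sM sN x y = eval_at B (x, y)" for x y
    by (simp add: tensor_def B_def)
  have space: "tensor_space sM sN = module.span fscale (eval_at B ` UNIV)"
  proof -
    have "{tensor sM sN x y | x y. True} = eval_at B ` UNIV" by (auto simp: tensor)
    then show ?thesis by (simp add: tensor_space_def)
  qed
  show ?thesis
    using eval_lift_unique_existence[OF V B, where S = UNIV]
    by (simp add: space tensor)
qed

theorem mtensor_lift_unique_existence:
  fixes sC :: "'k::field \<Rightarrow> 'c::ab_group_add \<Rightarrow> 'c" and sA :: "'k \<Rightarrow> 'a::ab_group_add \<Rightarrow> 'a"
  assumes V: "vector_space sV" and f: "multilinear_map sC sA m sV f"
  shows "\<exists>!F. F \<in> linear_maps fscale (mtensor_space sC sA m) sV UNIV \<and>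
              (\<forall>c as. length as = m \<longrightarrow> F (mtensor sC sA m c as) = f c as)"
proof -
  define B where "B = {\<beta>. multilinear_map sC sA m (*) (curry \<beta>)}"
  define S :: "('c \<times> 'a list) set" where "S = {(c, as). length as = m}"
  have B: "(\<lambda>z. \<phi> (case_prod f z)) \<in> B" if \<phi>: "Vector_Spaces.linear sV (*) \<phi>" for \<phi>
  proof -
    have "Vector_Spaces.linear sC (*) (\<lambda>c. \<phi> (f c as))" if "length as = m" for as
      using f that Vector_Spaces.linear_compose[OF _ \<phi>, of sC "\<lambda>c. f c as"]
      by (simp add: multilinear_map_def o_def)
    moreover have "Vector_Spaces.linear sA (*) (\<lambda>x. \<phi> (f c (as[p := x])))"
      if "length as = m" "p < m" for c as p
      using f that Vector_Spaces.linear_compose[OF _ \<phi>, of sA "\<lambda>x. f c (as[p := x])"]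
      by (simp add: multilinear_map_def o_def)
    ultimately show ?thesis by (simp add: B_def multilinear_map_def curry_def)
  qed
  have tensor: "mtensor sC sA m c as = eval_at B (c, as)" for c as
    by (simp add: mtensor_def B_def)
  have space: "mtensor_space sC sA m = module.span fscale (eval_at B ` S)"
  proof -
    have "{mtensor sC sA m c as | c as. length as = m} = eval_at B ` S"
      by (auto simp: tensor S_def)
    then show ?thesis by (simp add: mtensor_space_def)
  qed
  show ?thesis
    using eval_lift_unique_existence[OF V B, where S = S]
    by (simp add: space tensor S_def)
qed


section \<open>Entwining structures\<close>

locale unital_algebra = vector_space scale
  for scale :: "'k::field \<Rightarrow> 'a::ab_group_add \<Rightarrow> 'a" +
  fixes mA :: "'a \<Rightarrow> 'a \<Rightarrow> 'a" and uA :: 'a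
  assumes mult_bilinear: "bilinear_map scale scale scale mA"
    and mult_assoc: "mA (mA x y) z = mA x (mA y z)"
    and mult_one_left: "mA uA x = x"
    and mult_one_right: "mA x uA = x"

locale counital_coalgebra = vector_space scale
  for scale :: "'k::field \<Rightarrow> 'c::ab_group_add \<Rightarrow> 'c" +
  fixes \<Delta> :: "'c \<Rightarrow> ('c, 'c, 'k) tensor" and \<epsilon> :: "'c \<Rightarrow> 'k"
  assumes comult_linear: "\<Delta> \<in> linear_maps scale UNIV fscale (tensor_space scale scale)"
    and counit_linear: "Vector_Spaces.linear scale (*) \<epsilon>"
    and coassoc:
      "tensor_lift scale scale fscale
         (\<lambda>x y. tensor_lift scale scale fscale (\<lambda>x1 x2. tensor3 scale scale scale x1 x2 y) (\<Delta> x)) (\<Delta> c) =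
       tensor_lift scale scale fscale
         (\<lambda>x y. tensor_lift scale scale fscale (\<lambda>y1 y2. tensor3 scale scale scale x y1 y2) (\<Delta> y)) (\<Delta> c)"
    and counit_left: "tensor_lift scale scale scale (\<lambda>x y. scale (\<epsilon> x) y) (\<Delta> c) = c"
    and counit_right: "tensor_lift scale scale scale (\<lambda>x y. scale (\<epsilon> y) x) (\<Delta> c) = c"

text \<open>
  The axioms are stated on the generators \<open>c \<otimes> a \<otimes> b\<close> resp. \<open>c \<otimes> a\<close> of the domain:
  \<open>(ab)\<^sub>\<psi> \<otimes> c\<^sup>\<psi> = a\<^sub>\<psi> b\<^sub>\<phi> \<otimes> c\<^sup>\<psi>\<^sup>\<phi>\<close>, and
  \<open>a\<^sub>\<psi> \<otimes> \<Delta>(c\<^sup>\<psi>) = a\<^sub>\<psi>\<^sub>\<phi> \<otimes> c\<^sub>1\<^sup>\<phi> \<otimes> c\<^sub>2\<^sup>\<psi>\<close> where \<open>\<Delta>(c) = c\<^sub>1 \<otimes> c\<^sub>2\<close>.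
\<close>

locale entwining_structure =
  A: unital_algebra sA mA uA + C: counital_coalgebra sC \<Delta> \<epsilon>
  for sA :: "'k::field \<Rightarrow> 'a::ab_group_add \<Rightarrow> 'a" and mA and uA
    and sC :: "'k \<Rightarrow> 'c::ab_group_add \<Rightarrow> 'c" and \<Delta> and \<epsilon> +
  fixes \<psi> :: "('c, 'a, 'k) tensor \<Rightarrow> ('a, 'c, 'k) tensor"
  assumes psi_linear:
      "\<psi> \<in> linear_maps fscale (tensor_space sC sA) fscale (tensor_space sA sC)"
    and psi_mult:
      "\<psi> (tensor sC sA c (mA a b)) =
       tensor_lift sA sC fscale
         (\<lambda>x d. tensor_lift sA sC fscale (\<lambda>y e. tensor sA sC (mA x y) e) (\<psi> (tensor sC sA d b)))
         (\<psi> (tensor sC sA c a))"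
    and psi_comult:
      "tensor_lift sA sC fscale
         (\<lambda>x d. tensor_lift sC sC fscale (\<lambda>d1 d2. tensor3 sA sC sC x d1 d2) (\<Delta> d))
         (\<psi> (tensor sC sA c a)) =
       tensor_lift sC sC fscale
         (\<lambda>c1 c2. tensor_lift sA sC fscale
            (\<lambda>x e2. tensor_lift sA sC fscale (\<lambda>y e1. tensor3 sA sC sC y e1 e2) (\<psi> (tensor sC sA c1 x)))
            (\<psi> (tensor sC sA c2 a)))
         (\<Delta> c)"
    and psi_counit:
      "tensor_lift sA sC sA (\<lambda>x d. sA (\<epsilon> d) x) (\<psi> (tensor sC sA c a)) = sA (\<epsilon> c) a"
    and psi_one: "\<psi> (tensor sC sA c uA) = tensor sA sC uA c"


section \<open>The Hochschild complex\<close>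

definition hochschild_cochains ::
  "('k::field \<Rightarrow> 'a::ab_group_add \<Rightarrow> 'a) \<Rightarrow> ('k \<Rightarrow> 'c::ab_group_add \<Rightarrow> 'c) \<Rightarrow> nat \<Rightarrow>
   (('c, 'a list, 'k) tensor \<Rightarrow> 'k) set" where
  "hochschild_cochains sA sC n = linear_maps fscale (mtensor_space sC sA (n + 1)) (*) UNIV"

text \<open>
  In the formula, \<open>as = [a\<^sub>1, \<dots>, a\<^sub>n\<^sub>+\<^sub>2]\<close>; note that \<open>as ! (i - 1)\<close> is \<open>a\<^sub>i\<close>.
\<close>

definition hochschild_diff ::
  "('k::field \<Rightarrow> 'a::ab_group_add \<Rightarrow> 'a) \<Rightarrow> ('a \<Rightarrow> 'a \<Rightarrow> 'a) \<Rightarrow> ('k \<Rightarrow> 'c::ab_group_add \<Rightarrow> 'c) \<Rightarrow>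
   (('c, 'a, 'k) tensor \<Rightarrow> ('a, 'c, 'k) tensor) \<Rightarrow> nat \<Rightarrow>
   (('c, 'a list, 'k) tensor \<Rightarrow> 'k) \<Rightarrow> (('c, 'a list, 'k) tensor \<Rightarrow> 'k)" where
  "hochschild_diff sA mA sC \<psi> n g =
     mtensor_lift sC sA (n + 2) (*)
       (\<lambda>c as.
          tensor_lift sA sC (*)
            (\<lambda>x d. g (mtensor sC sA (n + 1) d (butlast (tl as) @ [mA (last as) x])))
            (\<psi> (tensor sC sA c (hd as))) +
          (\<Sum>i = 1..n + 1. (- 1) ^ i *
             g (mtensor sC sA (n + 1) c
                  (take (i - 1) as @ [mA (as ! (i - 1)) (as ! i)] @ drop (i + 1) as))))"


section \<open>Matrix algebras\<close>

text \<open>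
  Matrices are indexed by a finite linearly ordered type \<open>'r\<close> with \<open>r\<close> elements, whose least
  element plays the role of the index \<open>1\<close>. The library product \<open>(**)\<close> is only available over
  type class semirings, whereas the product of \<open>A\<close> is a parameter here.
\<close>

definition mat_scale :: "('k \<Rightarrow> 'a \<Rightarrow> 'a) \<Rightarrow> 'k \<Rightarrow> 'a^'r^'r \<Rightarrow> 'a^'r^'r" where
  "mat_scale sA k X = (\<chi> i j. sA k (X $ i $ j))"

definition mat_mult :: "('a \<Rightarrow> 'a \<Rightarrow> 'a::ab_group_add) \<Rightarrow> 'a^'r^'r \<Rightarrow> 'a^'r^'r \<Rightarrow> 'a^'r^'r" where
  "mat_mult mA X Y = (\<chi> i j. \<Sum>l\<in>UNIV. mA (X $ i $ l) (Y $ l $ j))"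

definition mat_elem :: "'r \<Rightarrow> 'r \<Rightarrow> 'a::ab_group_add \<Rightarrow> 'a^'r^'r" where
  "mat_elem p q a = (\<chi> i j. if i = p \<and> j = q then a else 0)"

definition mat_pure :: "('k \<Rightarrow> 'a \<Rightarrow> 'a) \<Rightarrow> 'a \<Rightarrow> 'k^'r^'r \<Rightarrow> 'a^'r^'r"
  \<comment> \<open>the matrix \<open>a u\<close> corresponding to \<open>a \<otimes> u \<in> A \<otimes> M\<^sub>r(k)\<close>\<close>
  where "mat_pure sA a u = (\<chi> i j. sA (u $ i $ j) a)"

definition mat_psi ::
  "('k::field \<Rightarrow> 'a::ab_group_add \<Rightarrow> 'a) \<Rightarrow> ('k \<Rightarrow> 'c::ab_group_add \<Rightarrow> 'c) \<Rightarrow>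
   (('c, 'a, 'k) tensor \<Rightarrow> ('a, 'c, 'k) tensor) \<Rightarrow>
   ('c, 'a^'r^'r, 'k) tensor \<Rightarrow> ('a^'r^'r, 'c, 'k) tensor" where
  "mat_psi sA sC \<psi> =
     (THE \<Psi>. \<Psi> \<in> linear_maps fscale (tensor_space sC (mat_scale sA))
                    fscale (tensor_space (mat_scale sA) sC) \<and>
        (\<forall>c a u. \<Psi> (tensor sC (mat_scale sA) c (mat_pure sA a u)) =
           tensor_lift sA sC fscale (\<lambda>x d. tensor (mat_scale sA) sC (mat_pure sA x u) d)
             (\<psi> (tensor sC sA c a))))"

definition inc_one :: "'a::ab_group_add \<Rightarrow> 'a^('r::{finite,linorder})^('r::{finite,linorder})" where
  "inc_one a = mat_elem (Min UNIV) (Min UNIV) a"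

definition inc_cochain ::
  "('k::field \<Rightarrow> 'a::ab_group_add \<Rightarrow> 'a) \<Rightarrow> ('k \<Rightarrow> 'c::ab_group_add \<Rightarrow> 'c) \<Rightarrow> nat \<Rightarrow>
   (('c, ('a^('r::{finite,linorder})^('r::{finite,linorder})) list, 'k) tensor \<Rightarrow> 'k) \<Rightarrow>
   (('c, 'a list, 'k) tensor \<Rightarrow> 'k)" where
  "inc_cochain sA sC n f =
     f \<circ> mtensor_lift sC sA (n + 1) fscale
           (\<lambda>c as. mtensor sC (mat_scale sA) (n + 1) c (map inc_one as))"

text \<open>The generalized trace \<open>C \<otimes> M\<^sub>r(A)\<^sup>\<otimes>\<^sup>m \<rightarrow> C \<otimes> A\<^sup>\<otimes>\<^sup>m\<close>, and the map it induces on cochains.\<close>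

definition gen_trace ::
  "('k::field \<Rightarrow> 'a::ab_group_add \<Rightarrow> 'a) \<Rightarrow> ('k \<Rightarrow> 'c::ab_group_add \<Rightarrow> 'c) \<Rightarrow> nat \<Rightarrow>
   ('c, ('a^'r^'r) list, 'k) tensor \<Rightarrow> ('c, 'a list, 'k) tensor" where
  "gen_trace sA sC m =
     (THE F. F \<in> linear_maps fscale (mtensor_space sC (mat_scale sA) m) fscale (mtensor_space sC sA m) \<and>
        (\<forall>c as us. length as = m \<and> length us = m \<longrightarrow>
           F (mtensor sC (mat_scale sA) m c (map2 (mat_pure sA) as us)) =
           fscale (trace (foldr (**) us (mat 1))) (mtensor sC sA m c as)))"

definition tr_cochain ::
  "('k::field \<Rightarrow> 'a::ab_group_add \<Rightarrow> 'a) \<Rightarrow> ('k \<Rightarrow> 'c::ab_group_add \<Rightarrow> 'c) \<Rightarrow> nat \<Rightarrow>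
   (('c, 'a list, 'k) tensor \<Rightarrow> 'k) \<Rightarrow> (('c, ('a^'r^'r) list, 'k) tensor \<Rightarrow> 'k)" where
  "tr_cochain sA sC n g = g \<circ> gen_trace sA sC (n + 1)"


section \<open>Cochain complexes, homotopies and cohomology\<close>

definition cochain_complex ::
  "('k::field \<Rightarrow> 'v::ab_group_add \<Rightarrow> 'v) \<Rightarrow> (nat \<Rightarrow> 'v set) \<Rightarrow> (nat \<Rightarrow> 'v \<Rightarrow> 'v) \<Rightarrow> bool" where
  "cochain_complex s X d \<longleftrightarrow>
     vector_space s \<and> (\<forall>n. module.subspace s (X n)) \<and>
     (\<forall>n. linear_on s (X n) s (X (Suc n)) (d n)) \<and>
     (\<forall>n. \<forall>x\<in>X n. d (Suc n) (d n x) = 0)"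

definition cochain_map ::
  "('k::field \<Rightarrow> 'v::ab_group_add \<Rightarrow> 'v) \<Rightarrow> (nat \<Rightarrow> 'v set) \<Rightarrow> (nat \<Rightarrow> 'v \<Rightarrow> 'v) \<Rightarrow>
   ('k \<Rightarrow> 'w::ab_group_add \<Rightarrow> 'w) \<Rightarrow> (nat \<Rightarrow> 'w set) \<Rightarrow> (nat \<Rightarrow> 'w \<Rightarrow> 'w) \<Rightarrow>
   (nat \<Rightarrow> 'v \<Rightarrow> 'w) \<Rightarrow> bool" where
  "cochain_map s X d s' Y d' f \<longleftrightarrow>
     cochain_complex s X d \<and> cochain_complex s' Y d' \<and>
     (\<forall>n. linear_on s (X n) s' (Y n) (f n)) \<and>
     (\<forall>n. \<forall>x\<in>X n. f (Suc n) (d n x) = d' n (f n x))"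

definition cochain_homotopic ::
  "('k::field \<Rightarrow> 'v::ab_group_add \<Rightarrow> 'v) \<Rightarrow> (nat \<Rightarrow> 'v set) \<Rightarrow> (nat \<Rightarrow> 'v \<Rightarrow> 'v) \<Rightarrow>
   ('k \<Rightarrow> 'w::ab_group_add \<Rightarrow> 'w) \<Rightarrow> (nat \<Rightarrow> 'w set) \<Rightarrow> (nat \<Rightarrow> 'w \<Rightarrow> 'w) \<Rightarrow>
   (nat \<Rightarrow> 'v \<Rightarrow> 'w) \<Rightarrow> (nat \<Rightarrow> 'v \<Rightarrow> 'w) \<Rightarrow> bool" where
  "cochain_homotopic s X d s' Y d' f g \<longleftrightarrow>
     (\<exists>h :: nat \<Rightarrow> 'v \<Rightarrow> 'w.
        (\<forall>n. linear_on s (X (Suc n)) s' (Y n) (h n)) \<and>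
        (\<forall>x\<in>X 0. f 0 x - g 0 x = h 0 (d 0 x)) \<and>
        (\<forall>n. \<forall>x\<in>X (Suc n).
           f (Suc n) x - g (Suc n) x = d' n (h n x) + h (Suc n) (d (Suc n) x)))"

definition homotopy_inverses ::
  "('k::field \<Rightarrow> 'v::ab_group_add \<Rightarrow> 'v) \<Rightarrow> (nat \<Rightarrow> 'v set) \<Rightarrow> (nat \<Rightarrow> 'v \<Rightarrow> 'v) \<Rightarrow>
   ('k \<Rightarrow> 'w::ab_group_add \<Rightarrow> 'w) \<Rightarrow> (nat \<Rightarrow> 'w set) \<Rightarrow> (nat \<Rightarrow> 'w \<Rightarrow> 'w) \<Rightarrow>
   (nat \<Rightarrow> 'v \<Rightarrow> 'w) \<Rightarrow> (nat \<Rightarrow> 'w \<Rightarrow> 'v) \<Rightarrow> bool" where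
  "homotopy_inverses s X d s' Y d' f g \<longleftrightarrow>
     cochain_map s X d s' Y d' f \<and> cochain_map s' Y d' s X d g \<and>
     cochain_homotopic s X d s X d (\<lambda>n. g n \<circ> f n) (\<lambda>n. id) \<and>
     cochain_homotopic s' Y d' s' Y d' (\<lambda>n. f n \<circ> g n) (\<lambda>n. id)"

definition cocycles :: "(nat \<Rightarrow> 'v::ab_group_add set) \<Rightarrow> (nat \<Rightarrow> 'v \<Rightarrow> 'v) \<Rightarrow> nat \<Rightarrow> 'v set" where
  "cocycles X d n = {x \<in> X n. d n x = 0}"

definition coboundaries :: "(nat \<Rightarrow> 'v::ab_group_add set) \<Rightarrow> (nat \<Rightarrow> 'v \<Rightarrow> 'v) \<Rightarrow> nat \<Rightarrow> 'v set" where
  "coboundaries X d n = (case n of 0 \<Rightarrow> {0} | Suc m \<Rightarrow> d m ` X m)"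

text \<open>Cohomology classes are the cosets \<open>x + B\<^sup>n\<close> of cocycles \<open>x\<close>.\<close>

definition coh_class ::
  "(nat \<Rightarrow> 'v::ab_group_add set) \<Rightarrow> (nat \<Rightarrow> 'v \<Rightarrow> 'v) \<Rightarrow> nat \<Rightarrow> 'v \<Rightarrow> 'v set" where
  "coh_class X d n x = {x + b | b. b \<in> coboundaries X d n}"

definition cohomology ::
  "(nat \<Rightarrow> 'v::ab_group_add set) \<Rightarrow> (nat \<Rightarrow> 'v \<Rightarrow> 'v) \<Rightarrow> nat \<Rightarrow> 'v set set" where
  "cohomology X d n = coh_class X d n ` cocycles X d n"

definition coh_add :: "'v::ab_group_add set \<Rightarrow> 'v set \<Rightarrow> 'v set" where
  "coh_add K L = {x + y | x y. x \<in> K \<and> y \<in> L}"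

definition coh_scale ::
  "('k \<Rightarrow> 'v::ab_group_add \<Rightarrow> 'v) \<Rightarrow> (nat \<Rightarrow> 'v set) \<Rightarrow> (nat \<Rightarrow> 'v \<Rightarrow> 'v) \<Rightarrow> nat \<Rightarrow>
   'k \<Rightarrow> 'v set \<Rightarrow> 'v set" where
  "coh_scale s X d n k K = (\<Union>x\<in>K. coh_class X d n (s k x))"

definition coh_map ::
  "(nat \<Rightarrow> 'w::ab_group_add set) \<Rightarrow> (nat \<Rightarrow> 'w \<Rightarrow> 'w) \<Rightarrow> (nat \<Rightarrow> 'v \<Rightarrow> 'w) \<Rightarrow> nat \<Rightarrow>
   'v set \<Rightarrow> 'w set"
  \<comment> \<open>\<open>[x] \<mapsto> [f x]\<close> with target the cohomology of \<open>(Y, d')\<close>\<close>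
  where "coh_map Y d' f n K = (\<Union>x\<in>K. coh_class Y d' n (f n x))"

definition coh_linear ::
  "('k::field \<Rightarrow> 'v::ab_group_add \<Rightarrow> 'v) \<Rightarrow> (nat \<Rightarrow> 'v set) \<Rightarrow> (nat \<Rightarrow> 'v \<Rightarrow> 'v) \<Rightarrow>
   ('k \<Rightarrow> 'w::ab_group_add \<Rightarrow> 'w) \<Rightarrow> (nat \<Rightarrow> 'w set) \<Rightarrow> (nat \<Rightarrow> 'w \<Rightarrow> 'w) \<Rightarrow> nat \<Rightarrow>
   ('v set \<Rightarrow> 'w set) \<Rightarrow> bool" where
  "coh_linear s X d s' Y d' n F \<longleftrightarrow>
     (\<forall>K\<in>cohomology X d n. F K \<in> cohomology Y d' n) \<and>
     (\<forall>K\<in>cohomology X d n. \<forall>L\<in>cohomology X d n. F (coh_add K L) = coh_add (F K) (F L)) \<and>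
     (\<forall>k. \<forall>K\<in>cohomology X d n. F (coh_scale s X d n k K) = coh_scale s' Y d' n k (F K))"

definition inverse_coh_isomorphisms ::
  "('k::field \<Rightarrow> 'v::ab_group_add \<Rightarrow> 'v) \<Rightarrow> (nat \<Rightarrow> 'v set) \<Rightarrow> (nat \<Rightarrow> 'v \<Rightarrow> 'v) \<Rightarrow>
   ('k \<Rightarrow> 'w::ab_group_add \<Rightarrow> 'w) \<Rightarrow> (nat \<Rightarrow> 'w set) \<Rightarrow> (nat \<Rightarrow> 'w \<Rightarrow> 'w) \<Rightarrow> nat \<Rightarrow>
   ('v set \<Rightarrow> 'w set) \<Rightarrow> ('w set \<Rightarrow> 'v set) \<Rightarrow> bool" where
  "inverse_coh_isomorphisms s X d s' Y d' n F G \<longleftrightarrow>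
     coh_linear s X d s' Y d' n F \<and> coh_linear s' Y d' s X d n G \<and>
     (\<forall>K\<in>cohomology X d n. G (F K) = K) \<and> (\<forall>L\<in>cohomology Y d' n. F (G L) = L)"

end

theory Submission
  imports Defs
begin

text \<open>
  A cochain of degree \<open>n\<close> is the same as a form \<open>G (c, a\<^sub>1, \<dots>, a\<^sub>n\<^sub>+\<^sub>1)\<close> that is linear in each argument,
  and on forms the Hochschild differential is an alternating sum of faces: the cyclic face moves
  \<open>a\<^sub>1\<close> past \<open>c\<close> by \<open>\<psi>\<close> and multiplies it to \<open>a\<^sub>n\<^sub>+\<^sub>1\<close> from the right, the others multiply neighbours.
  Reading \<open>c \<otimes> a\<^sub>n\<^sub>+\<^sub>1\<close> as a coefficient in the \<open>A\<close>-bimodule \<open>C \<otimes> A\<close>, with right action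
  \<open>(c \<otimes> a) b = c\<^sup>\<psi> \<otimes> a b\<^sub>\<psi>\<close>, one sees an ordinary Hochschild complex, and the classical proof of Morita
  invariance for matrices can be followed.

  It rests on one homotopy. Let \<open>e\<^sub>k\<close> and \<open>f\<^sub>k\<close> be finite families in an entwined algebra with
  \<open>\<Sum> f\<^sub>k e\<^sub>k = 1\<close> and such that \<open>\<psi>\<close> moves them past every \<open>c\<close> unchanged. Then the endomorphism of
  the complex that sends \<open>G\<close> to
  \<open>(c, a\<^sub>1, \<dots>, a\<^sub>n\<^sub>+\<^sub>1) \<mapsto> \<Sum> G (c, e\<^sub>k\<^sub>0 a\<^sub>1 f\<^sub>k\<^sub>1, e\<^sub>k\<^sub>1 a\<^sub>2 f\<^sub>k\<^sub>2, \<dots>, e\<^sub>k\<^sub>n a\<^sub>n\<^sub>+\<^sub>1 f\<^sub>k\<^sub>0)\<close> is homotopic to the identity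
  (\<open>homotopy_formula\<close>). The homotopy is the alternating sum over \<open>j\<close> of the operations that
  conjugate the first \<open>j\<close> entries only and insert \<open>e\<^sub>k\<^sub>j\<close> behind them. Their compositions with the
  faces satisfy presimplicial relations (\<open>insertion_face_below\<close>, \<open>insertion_face_diagonal\<close>,
  \<open>insertion_face_above\<close>), so that the double sums telescope to the two ends
  \<open>insertion_first_face\<close> and \<open>insertion_last_face\<close>.

  In \<open>M\<^sub>r(A)\<close> take \<open>e\<^sub>k = E\<^sub>1\<^sub>k(1)\<close> and \<open>f\<^sub>k = E\<^sub>k\<^sub>1(1)\<close>. Then \<open>e\<^sub>k U f\<^sub>l = E\<^sub>1\<^sub>1(U\<^sub>k\<^sub>l)\<close>, and the endomorphism is
  \<open>tr \<circ> inc\<^sub>1\<close>, because the generalised trace is the sum over closed paths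
  \<open>\<Sum> G (c, (U\<^sub>1)\<^sub>k\<^sub>0\<^sub>k\<^sub>1, \<dots>, (U\<^sub>n\<^sub>+\<^sub>1)\<^sub>k\<^sub>n\<^sub>k\<^sub>0)\<close> (\<open>gen_trace_eq_trace_sum\<close>). In the other order, \<open>inc\<^sub>1 \<circ> tr\<close> is the identity
  (\<open>trace_inclusion\<close>). Both maps commute with the faces (\<open>trace_face\<close>, \<open>inclusion_face\<close>). The
  statement on cohomology follows from the one on complexes (\<open>homotopy_inverses_coh_isomorphisms\<close>).
\<close>

section \<open>Multilinear maps on lists\<close>

lemma linear_sum_family:
  assumes "vector_space s" "vector_space t" and "\<And>a. a \<in> S \<Longrightarrow> Vector_Spaces.linear s t (f a)"
  shows "Vector_Spaces.linear s t (\<lambda>x. \<Sum>a\<in>S. f a x)"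
proof -
  interpret t: vector_space t by fact
  show ?thesis
    using assms by (simp add: Vector_Spaces.linear_iff sum.distrib t.scale_sum_right)
qed

lemma linear_comp:
  assumes "Vector_Spaces.linear s t f" "Vector_Spaces.linear t u g"
  shows "Vector_Spaces.linear s u (\<lambda>x. g (f x))"
  using Vector_Spaces.linear_compose[OF assms] by (simp add: o_def)

lemma linear_imp_sum:
  assumes "Vector_Spaces.linear s t f"
  shows "f (\<Sum>a\<in>S. g a) = (\<Sum>a\<in>S. f (g a))"
proof -
  interpret Vector_Spaces.linear s t f by fact
  show ?thesis by (rule sum)
qed

lemma linear_imp_zero: "Vector_Spaces.linear s t f \<Longrightarrow> f 0 = 0"
  using linear_imp_sum[of s t f _ "{}"] by simp

text \<open>
  Linearity is asked at each splitting \<open>xs @ x # ys\<close> instead of at each index: lists are taken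
  apart by recursion and by splitting below, and a splitting survives both.
\<close>

definition slot_linear ::
  "('k::field \<Rightarrow> 'a::ab_group_add \<Rightarrow> 'a) \<Rightarrow> ('k \<Rightarrow> 'v::ab_group_add \<Rightarrow> 'v) \<Rightarrow> nat \<Rightarrow>
   ('a list \<Rightarrow> 'v) \<Rightarrow> bool" where
  "slot_linear sA sV m F \<longleftrightarrow>
     (\<forall>xs ys. length xs + Suc (length ys) = m \<longrightarrow> Vector_Spaces.linear sA sV (\<lambda>x. F (xs @ x # ys)))"

lemma slot_linearD:
  "slot_linear sA sV m F \<Longrightarrow> length xs + Suc (length ys) = m \<Longrightarrow>
     Vector_Spaces.linear sA sV (\<lambda>x. F (xs @ x # ys))"
  by (simp add: slot_linear_def)

lemma slot_linear_append:
  fixes sA :: "'k::field \<Rightarrow> 'a::ab_group_add \<Rightarrow> 'a"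
  assumes "slot_linear sA sV (length as + m + length bs) F"
  shows "slot_linear sA sV m (\<lambda>xs. F (as @ xs @ bs))"
  unfolding slot_linear_def
proof (intro allI impI)
  fix xs ys :: "'a list" assume "length xs + Suc (length ys) = m"
  then show "Vector_Spaces.linear sA sV (\<lambda>x. F (as @ (xs @ x # ys) @ bs))"
    using slot_linearD[OF assms, of "as @ xs" "ys @ bs"] by simp
qed

lemma slot_linear_Cons: "slot_linear sA sV (Suc m) F \<Longrightarrow> slot_linear sA sV m (\<lambda>xs. F (a # xs))"
  using slot_linear_append[of sA sV "[a]" m "[]" F] by simp

lemma slot_linear_eq_zero:
  fixes sA :: "'k::field \<Rightarrow> 'a::ab_group_add \<Rightarrow> 'a"
  assumes "slot_linear sA sV m F" "length xs = m" "0 \<in> set xs"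
  shows "F xs = 0"
proof -
  obtain us vs where "xs = us @ 0 # vs"
    using \<open>0 \<in> set xs\<close> by (meson split_list)
  then show ?thesis
    using slot_linearD[OF assms(1), of us vs] assms(2) linear_imp_zero by fastforce
qed

text \<open>
  Passage from indices to splittings, by \<open>xs = take p as\<close> and \<open>ys = drop (p + 1) as\<close>.
\<close>

lemma multilinear_map_iff_slot_linear:
  fixes sA :: "'k::field \<Rightarrow> 'a::ab_group_add \<Rightarrow> 'a"
  shows "multilinear_map sC sA m sV f \<longleftrightarrow>
     (\<forall>as. length as = m \<longrightarrow> Vector_Spaces.linear sC sV (\<lambda>c. f c as)) \<and>
     (\<forall>c. slot_linear sA sV m (f c))"
proof -
  have "(\<forall>as p. length as = m \<and> p < m \<longrightarrow> Vector_Spaces.linear sA sV (\<lambda>x. f c (as[p := x]))) \<longleftrightarrow>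
        slot_linear sA sV m (f c)" for c
    unfolding slot_linear_def
  proof (intro iffI allI impI)
    fix xs ys :: "'a list"
    assume *: "\<forall>as p. length as = m \<and> p < m \<longrightarrow> Vector_Spaces.linear sA sV (\<lambda>x. f c (as[p := x]))"
      and "length xs + Suc (length ys) = m"
    then show "Vector_Spaces.linear sA sV (\<lambda>x. f c (xs @ x # ys))"
      using *[rule_format, of "xs @ undefined # ys" "length xs"] by simp
  next
    fix as :: "'a list" and p
    assume *: "\<forall>xs ys. length xs + Suc (length ys) = m \<longrightarrow>
                 Vector_Spaces.linear sA sV (\<lambda>x. f c (xs @ x # ys))"
      and "length as = m \<and> p < m"
    then show "Vector_Spaces.linear sA sV (\<lambda>x. f c (as[p := x]))"
      using *[rule_format, of "take p as" "drop (Suc p) as"] by (simp add: upd_conv_take_nth_drop)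
  qed
  then show ?thesis by (auto simp: multilinear_map_def)
qed

lemma multilinear_map_linear_left:
  "multilinear_map sC sA m sV f \<Longrightarrow> length as = m \<Longrightarrow> Vector_Spaces.linear sC sV (\<lambda>c. f c as)"
  by (simp add: multilinear_map_def)

lemma multilinear_map_slot_linear: "multilinear_map sC sA m sV f \<Longrightarrow> slot_linear sA sV m (f c)"
  by (simp add: multilinear_map_iff_slot_linear)

lemma multilinear_map_slot:
  "multilinear_map sC sA m sV f \<Longrightarrow> length xs + Suc (length ys) = m \<Longrightarrow>
     Vector_Spaces.linear sA sV (\<lambda>x. f c (xs @ x # ys))"
  by (simp add: multilinear_map_iff_slot_linear slot_linear_def)

lemma multilinear_map_sum:
  assumes "vector_space sC" "vector_space sA" "vector_space sV"
    and "\<And>i. i \<in> S \<Longrightarrow> multilinear_map sC sA m sV (f i)"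
  shows "multilinear_map sC sA m sV (\<lambda>c as. \<Sum>i\<in>S. f i c as)"
  using assms unfolding multilinear_map_def by (auto intro!: linear_sum_family)

lemma multilinear_map_compose:
  assumes "multilinear_map sC sA m sV f" "Vector_Spaces.linear sV sW h"
  shows "multilinear_map sC sA m sW (\<lambda>c as. h (f c as))"
  using assms unfolding multilinear_map_def by (auto intro!: linear_comp[OF _ assms(2)])

lemma linear_times_const: "Vector_Spaces.linear (*) (*) (\<lambda>x. (k::'k::field) * x)"
  using vector_space_times by (auto simp: Vector_Spaces.linear_iff algebra_simps)

lemma bilinear_map_left: "bilinear_map sM sN sV f \<Longrightarrow> Vector_Spaces.linear sM sV (\<lambda>x. f x y)"
  and bilinear_map_right: "bilinear_map sM sN sV f \<Longrightarrow> Vector_Spaces.linear sN sV (\<lambda>y. f x y)"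
  by (simp_all add: bilinear_map_def)


section \<open>Lists with a product or a map at one place\<close>

text \<open>
  The inner face maps of the Hochschild complex on lists. Recursion makes the identities
  between them, and their interplay with index paths, provable by induction on the place.
\<close>

primrec mult_at :: "('a \<Rightarrow> 'a \<Rightarrow> 'a) \<Rightarrow> nat \<Rightarrow> 'a list \<Rightarrow> 'a list" where
  "mult_at m 0 xs = m (hd xs) (hd (tl xs)) # tl (tl xs)"
| "mult_at m (Suc i) xs = hd xs # mult_at m i (tl xs)"

lemma mult_at_conv_take_drop:
  "Suc i < length xs \<Longrightarrow> mult_at m i xs = take i xs @ [m (xs ! i) (xs ! Suc i)] @ drop (i + 2) xs"
proof (induction i arbitrary: xs)
  case 0
  then obtain x y zs where "xs = x # y # zs"
    by (cases xs; cases "tl xs") auto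
  then show ?case by simp
next
  case (Suc i)
  then obtain x ys where "xs = x # ys" by (cases xs) auto
  with Suc show ?case by simp
qed

lemma length_mult_at: "Suc i < length xs \<Longrightarrow> length (mult_at m i xs) = length xs - 1"
  by (simp add: mult_at_conv_take_drop)

lemma mult_at_append_left: "Suc i < length xs \<Longrightarrow> mult_at m i (xs @ ys) = mult_at m i xs @ ys"
  by (simp add: mult_at_conv_take_drop nth_append)

lemma mult_at_append_right: "mult_at m (length xs + i) (xs @ ys) = xs @ mult_at m i ys"
  by (induction xs) auto

lemma mult_at_map:
  assumes "\<And>x y. h (m x y) = m' (h x) (h y)"
  shows "Suc i < length xs \<Longrightarrow> mult_at m' i (map h xs) = map h (mult_at m i xs)"
  using assms by (simp add: mult_at_conv_take_drop take_map drop_map)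

text \<open>
  The presimplicial identity between inner faces. If the two places are adjacent, it is
  associativity; otherwise the products do not meet.
\<close>

lemma mult_at_mult_at:
  assumes "\<And>x y z. m (m x y) z = m x (m y z)"
  shows "i < j \<Longrightarrow> Suc j < length xs \<Longrightarrow> mult_at m i (mult_at m j xs) = mult_at m (j - 1) (mult_at m i xs)"
proof (induction i arbitrary: j xs)
  case 0
  then obtain x y z zs where xs: "xs = x # y # z # zs"
    by (cases xs; cases "tl xs"; cases "tl (tl xs)") auto
  obtain j' where "j = Suc j'" using \<open>0 < j\<close> by (cases j) auto
  then show ?case by (cases j') (simp_all add: xs assms)
next
  case (Suc i)
  then obtain j' where j': "j = Suc j'" by (cases j) auto
  then obtain j'' where j'': "j' = Suc j''" using Suc.prems by (cases j') auto
  have "mult_at m i (mult_at m j' (tl xs)) = mult_at m (j' - 1) (mult_at m i (tl xs))"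
    using Suc.prems by (intro Suc.IH) (auto simp: j')
  then show ?case by (simp add: j' j'')
qed

text \<open>
  The cyclic face multiplies the last entry from the right, so most operations below act on the
  last entry by a map that commutes with multiplication from the left.
\<close>

definition map_last :: "('a \<Rightarrow> 'a) \<Rightarrow> 'a list \<Rightarrow> 'a list" where
  "map_last g xs = butlast xs @ [g (last xs)]"

lemma map_last_snoc [simp]: "map_last g (xs @ [x]) = xs @ [g x]"
  by (simp add: map_last_def)

lemma map_last_append: "ys \<noteq> [] \<Longrightarrow> map_last g (xs @ ys) = xs @ map_last g ys"
  by (simp add: map_last_def butlast_append)

lemma map_last_Cons: "xs \<noteq> [] \<Longrightarrow> map_last g (x # xs) = x # map_last g xs"
  by (simp add: map_last_def)

lemma length_map_last: "xs \<noteq> [] \<Longrightarrow> length (map_last g xs) = length xs"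
  by (simp add: map_last_def)

lemma map_last_comp: "xs \<noteq> [] \<Longrightarrow> map_last g (map_last h xs) = map_last (\<lambda>x. g (h x)) xs"
  by (simp add: map_last_def)

lemma map_last_mult_at:
  assumes "\<And>x y. g (m x y) = m x (g y)"
  shows "Suc i < length xs \<Longrightarrow> map_last g (mult_at m i xs) = mult_at m i (map_last g xs)"
proof (induction i arbitrary: xs)
  case 0
  then obtain x y zs where "xs = x # y # zs"
    by (cases xs; cases "tl xs") auto
  then show ?case using assms by (cases zs) (auto simp: map_last_def)
next
  case (Suc i)
  then obtain x ys where xs: "xs = x # ys" and ys: "Suc i < length ys" by (cases xs) auto
  then have "mult_at m i ys \<noteq> []" "ys \<noteq> []" using length_mult_at[of i ys m] by auto
  with Suc.IH[OF ys] show ?case by (simp add: xs map_last_Cons)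
qed

lemma slot_linear_mult_at:
  fixes sA :: "'k::field \<Rightarrow> 'a::ab_group_add \<Rightarrow> 'a"
  assumes "\<And>y. Vector_Spaces.linear sA sA (\<lambda>x. m x y)" "\<And>x. Vector_Spaces.linear sA sA (\<lambda>y. m x y)"
  shows "slot_linear sA sV n F \<Longrightarrow> i < n \<Longrightarrow> slot_linear sA sV (Suc n) (\<lambda>xs. F (mult_at m i xs))"
proof (induction i arbitrary: n F)
  case (0 n F)
  show ?case
    unfolding slot_linear_def
  proof (intro allI impI)
    fix xs ys :: "'a list" assume len: "length xs + Suc (length ys) = Suc n"
    consider y ys' where "xs = []" "ys = y # ys'" | a where "xs = [a]" | a b xs' where "xs = a # b # xs'"
      using len \<open>0 < n\<close> by (cases xs; cases "tl xs"; cases ys) auto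
    then show "Vector_Spaces.linear sA sV (\<lambda>x. F (mult_at m 0 (xs @ x # ys)))"
    proof cases
      case 1
      then show ?thesis
        using linear_comp[OF assms(1) slot_linearD[OF 0(1), of "[]" ys']] len by simp
    next
      case 2
      then show ?thesis
        using linear_comp[OF assms(2) slot_linearD[OF 0(1), of "[]" ys]] len by simp
    next
      case (3 a b xs')
      then show ?thesis
        using slot_linearD[OF 0(1), of "m a b # xs'" ys] len by simp
    qed
  qed
next
  case (Suc i n F)
  obtain n' where n': "n = Suc n'" using Suc.prems by (cases n) auto
  show ?case
    unfolding slot_linear_def
  proof (intro allI impI)
    fix xs ys :: "'a list" assume len: "length xs + Suc (length ys) = Suc n"
    show "Vector_Spaces.linear sA sV (\<lambda>x. F (mult_at m (Suc i) (xs @ x # ys)))"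
    proof (cases xs)
      case Nil
      then show ?thesis
        using slot_linearD[OF Suc.prems(1), of "[]" "mult_at m i ys"] len Suc.prems
        by (simp add: length_mult_at)
    next
      case (Cons a xs')
      have "slot_linear sA sV (Suc n') (\<lambda>xs. F (a # mult_at m i xs))"
        using Suc.prems by (intro Suc.IH slot_linear_Cons) (auto simp: n')
      from slot_linearD[OF this, of xs' ys] show ?thesis
        using Cons len by (simp add: n')
    qed
  qed
qed

lemma slot_linear_map_last:
  fixes sA :: "'k::field \<Rightarrow> 'a::ab_group_add \<Rightarrow> 'a"
  assumes F: "slot_linear sA sV n F" and g: "Vector_Spaces.linear sA sA g"
  shows "slot_linear sA sV n (\<lambda>xs. F (map_last g xs))"
  unfolding slot_linear_def
proof (intro allI impI)
  fix xs ys :: "'a list" assume len: "length xs + Suc (length ys) = n"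
  show "Vector_Spaces.linear sA sV (\<lambda>x. F (map_last g (xs @ x # ys)))"
  proof (cases ys)
    case Nil
    then show ?thesis using linear_comp[OF g slot_linearD[OF F, of xs "[]"]] len by simp
  next
    case Cons
    then have "ys \<noteq> []" by simp
    with slot_linearD[OF F, of xs "map_last g ys"] len show ?thesis
      by (simp add: map_last_append map_last_Cons length_map_last)
  qed
qed


section \<open>Alternating double sums\<close>

text \<open>
  The cancellation behind \<open>\<delta>\<^sup>2 = 0\<close>: the terms with \<open>i < j\<close> and those with \<open>j \<le> i\<close> are matched
  by \<open>(j, i) \<mapsto> (i, j - 1)\<close>, which changes the sign.
\<close>

lemma alternating_double_sum_eq_zero:
  fixes D :: "nat \<Rightarrow> nat \<Rightarrow> 'k::comm_ring_1"
  assumes D: "\<And>i j. i < j \<Longrightarrow> j \<le> Suc n \<Longrightarrow> D j i = D i (j - 1)"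
  shows "(\<Sum>j\<le>Suc n. (- 1) ^ j * (\<Sum>i\<le>n. (- 1) ^ i * D j i)) = 0"
proof -
  define t where "t = (\<lambda>(j, i). (- 1) ^ (i + j) * D j i)"
  define U where "U = {(j, i). i < j \<and> j \<le> Suc n}"
  define L where "L = {(j, i). j \<le> i \<and> i \<le> n}"
  have split: "{..Suc n} \<times> {..n} = U \<union> L" "U \<inter> L = {}"
    by (auto simp: U_def L_def)
  have "finite (U \<union> L)" by (simp flip: split(1))
  then have fin: "finite U" "finite L" by auto
  have "sum t U = (\<Sum>p\<in>L. - t p)"
  proof (rule sum.reindex_bij_witness[of _ "\<lambda>(i, j). (Suc j, i)" "\<lambda>(j, i). (i, j - 1)"])
    fix p assume "p \<in> U"
    then obtain j i where p: "p = (Suc j, i)" "i \<le> j" "j \<le> n"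
      by (cases p; cases "fst p") (auto simp: U_def)
    then show "- t (case p of (j, i) \<Rightarrow> (i, j - 1)) = t p"
      using D[of i "Suc j"] by (simp add: t_def add.commute)
  qed (auto simp: U_def L_def)
  then have "sum t (U \<union> L) = 0"
    using fin split(2) by (simp add: sum.union_disjoint sum_negf)
  moreover have "(\<Sum>j\<le>Suc n. (- 1) ^ j * (\<Sum>i\<le>n. (- 1) ^ i * D j i)) = sum t ({..Suc n} \<times> {..n})"
    unfolding t_def sum.cartesian_product[symmetric] sum_distrib_left
    by (intro sum.cong refl) (simp add: power_add mult.assoc mult.left_commute)
  ultimately show ?thesis by (simp only: split(1))
qed

text \<open>
  The hypotheses are the relations between faces \<open>d\<^sub>i\<close> and the parts \<open>h\<^sub>j\<close> of a presimplicial
  homotopy; \<open>X i j\<close> stands for \<open>d\<^sub>i h\<^sub>j\<close> and \<open>Y i j\<close> for \<open>h\<^sub>j d\<^sub>i\<close>, both acting on chains. Away from the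
  diagonals \<open>i = j\<close> and \<open>i = j + 1\<close> the terms of \<open>X\<close> cancel those of \<open>Y\<close>. The two diagonals
  telescope, and only the first and the last term remain.
\<close>

lemma alternating_homotopy_sum:
  fixes X Y :: "nat \<Rightarrow> nat \<Rightarrow> 'k::comm_ring_1"
  assumes below: "\<And>i j. i < j \<Longrightarrow> j \<le> n \<Longrightarrow> X i j = Y i (j - 1)"
    and diagonal: "\<And>j. 1 \<le> j \<Longrightarrow> j \<le> n \<Longrightarrow> X j j = X j (j - 1)"
    and above: "\<And>i j. Suc j < i \<Longrightarrow> i \<le> Suc n \<Longrightarrow> X i j = Y (i - 1) j"
  shows "(\<Sum>j\<le>n. (- 1) ^ j * (\<Sum>i\<le>Suc n. (- 1) ^ i * X i j)) +
         (\<Sum>i\<le>n. (- 1) ^ i * (\<Sum>j<n. (- 1) ^ j * Y i j)) = X 0 0 - X (Suc n) n"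
proof -
  define t where "t = (\<lambda>(i, j). (- 1) ^ (i + j) * X i j)"
  define u where "u = (\<lambda>(i, j). (- 1) ^ (i + j) * Y i j)"
  define B where "B = {(i, j). i < j \<and> j \<le> n}"
  define C where "C = {(i, j). Suc j < i \<and> i \<le> Suc n}"
  define E where "E = (\<lambda>j. (j, j)) ` {..n}"
  define F where "F = (\<lambda>j. (Suc j, j)) ` {..n}"
  define B' where "B' = {(i, j). i \<le> j \<and> j < n}"
  define C' where "C' = {(i, j). j < i \<and> i \<le> n}"
  have split: "{..Suc n} \<times> {..n} = (B \<union> C) \<union> (E \<union> F)" "{..n} \<times> {..<n} = B' \<union> C'"
    and disjoint: "B \<inter> C = {}" "E \<inter> F = {}" "(B \<union> C) \<inter> (E \<union> F) = {}" "B' \<inter> C' = {}"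
    by (auto simp: B_def C_def E_def F_def B'_def C'_def image_iff)
  have "finite ((B \<union> C) \<union> (E \<union> F))" "finite (B' \<union> C')" by (simp_all flip: split)
  then have fin: "finite B" "finite C" "finite E" "finite F" "finite B'" "finite C'" by auto
  have B: "sum t B = (\<Sum>p\<in>B'. - u p)"
  proof (rule sum.reindex_bij_witness[of _ "\<lambda>(i, j). (i, Suc j)" "\<lambda>(i, j). (i, j - 1)"])
    fix p assume "p \<in> B"
    then obtain i j where p: "p = (i, Suc j)" "i \<le> j" "Suc j \<le> n"
      by (cases p; cases "snd p") (auto simp: B_def)
    then show "- u (case p of (i, j) \<Rightarrow> (i, j - 1)) = t p"
      using below[of i "Suc j"] by (simp add: t_def u_def)
  qed (auto simp: B_def B'_def)
  have C: "sum t C = (\<Sum>p\<in>C'. - u p)"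
  proof (rule sum.reindex_bij_witness[of _ "\<lambda>(i, j). (Suc i, j)" "\<lambda>(i, j). (i - 1, j)"])
    fix p assume "p \<in> C"
    then obtain i j where p: "p = (Suc i, j)" "j < i" "i \<le> n"
      by (cases p; cases "fst p") (auto simp: C_def)
    then show "- u (case p of (i, j) \<Rightarrow> (i - 1, j)) = t p"
      using above[of j "Suc i"] by (simp add: t_def u_def)
  qed (auto simp: C_def C'_def)
  \<comment> \<open>By the diagonal relation, \<open>X (j + 1) j\<close> is the next term \<open>X (j + 1) (j + 1)\<close>, except at the end.\<close>
  define z where "z j = (if j \<le> n then X j j else X (Suc n) n)" for j
  have "sum t E = (\<Sum>j\<le>n. X j j)" unfolding E_def
    by (subst sum.reindex) (auto simp: inj_on_def t_def power_add power_mult_distrib[symmetric])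
  moreover have "sum t F = (\<Sum>j\<le>n. - X (Suc j) j)" unfolding F_def
    by (subst sum.reindex) (auto simp: inj_on_def t_def power_add power_mult_distrib[symmetric])
  ultimately have "sum t E + sum t F = (\<Sum>j\<le>n. X j j - X (Suc j) j)"
    by (simp add: sum_subtractf sum_negf)
  also have "\<dots> = (\<Sum>j\<le>n. z j - z (Suc j))"
    using diagonal[of "Suc _"] by (intro sum.cong refl) (auto simp: z_def not_le less_Suc_eq_le antisym)
  also have "\<dots> = z 0 - z (Suc n)" by (rule sum_telescope)
  finally have EF: "sum t E + sum t F = X 0 0 - X (Suc n) n" by (simp add: z_def)
  have "(\<Sum>j\<le>n. (- 1) ^ j * (\<Sum>i\<le>Suc n. (- 1) ^ i * X i j)) = (\<Sum>i\<le>Suc n. \<Sum>j\<le>n. t (i, j))"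
    unfolding sum_distrib_left
    by (subst sum.swap) (simp add: t_def power_add mult.assoc mult.left_commute)
  also have "\<dots> = sum t ({..Suc n} \<times> {..n})" by (simp add: sum.cartesian_product)
  also have "\<dots> = sum t B + sum t C + (sum t E + sum t F)"
    unfolding split(1) using fin disjoint by (simp add: sum.union_disjoint)
  finally have tt: "(\<Sum>j\<le>n. (- 1) ^ j * (\<Sum>i\<le>Suc n. (- 1) ^ i * X i j)) =
      sum t B + sum t C + (sum t E + sum t F)" .
  have "(\<Sum>i\<le>n. (- 1) ^ i * (\<Sum>j<n. (- 1) ^ j * Y i j)) = (\<Sum>i\<le>n. \<Sum>j<n. u (i, j))"
    unfolding sum_distrib_left
    by (simp add: u_def power_add mult.assoc)
  also have "\<dots> = sum u ({..n} \<times> {..<n})" by (simp add: sum.cartesian_product)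
  also have "\<dots> = sum u B' + sum u C'"
    unfolding split(2) using fin disjoint by (simp add: sum.union_disjoint)
  finally show ?thesis unfolding tt EF by (simp add: B C sum_negf)
qed


section \<open>Sums over index paths\<close>

text \<open>
  The sum of \<open>\<Phi> [w k\<^sub>0 k\<^sub>1 x\<^sub>1, \<dots>, w k\<^sub>n\<^sub>-\<^sub>1 k\<^sub>n x\<^sub>n] k\<^sub>n\<close> over all paths \<open>k = k\<^sub>0, k\<^sub>1, \<dots>, k\<^sub>n\<close> of indices. With
  \<open>w k l U = U $ k $ l\<close> it expands the rows of a product of matrices. The end point \<open>k\<^sub>n\<close> is handed to
  \<open>\<Phi>\<close> so that the path can be continued or closed.
\<close>

primrec path_sum ::
  "('r::finite \<Rightarrow> 'r \<Rightarrow> 'x \<Rightarrow> 'y) \<Rightarrow> 'x list \<Rightarrow> 'r \<Rightarrow> ('y list \<Rightarrow> 'r \<Rightarrow> 'v::comm_monoid_add) \<Rightarrow> 'v" where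
  "path_sum w [] k \<Phi> = \<Phi> [] k"
| "path_sum w (x # xs) k \<Phi> = (\<Sum>l\<in>UNIV. path_sum w xs l (\<lambda>ys q. \<Phi> (w k l x # ys) q))"

text \<open>
  The sum over closed paths. For \<open>w k l U = U $ k $ l\<close> this is the generalised trace.
\<close>

definition cyclic_sum ::
  "('r::finite \<Rightarrow> 'r \<Rightarrow> 'x \<Rightarrow> 'y) \<Rightarrow> ('y list \<Rightarrow> 'v::comm_monoid_add) \<Rightarrow> 'x list \<Rightarrow> 'v" where
  "cyclic_sum w \<Phi> xs =
     (\<Sum>k\<in>UNIV. path_sum w (butlast xs) k (\<lambda>ys q. \<Phi> (ys @ [w q k (last xs)])))"

lemma path_sum_cong:
  "(\<And>ys q. length ys = length xs \<Longrightarrow> \<Phi> ys q = \<Psi> ys q) \<Longrightarrow> path_sum w xs k \<Phi> = path_sum w xs k \<Psi>"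
proof (induction xs arbitrary: k \<Phi> \<Psi>)
  case (Cons x xs)
  have "path_sum w xs l (\<lambda>ys q. \<Phi> (w k l x # ys) q) = path_sum w xs l (\<lambda>ys q. \<Psi> (w k l x # ys) q)" for l
    by (rule Cons.IH) (simp add: Cons.prems)
  then show ?case by simp
qed simp

lemma cyclic_sum_cong:
  assumes "xs \<noteq> []" "\<And>ys. length ys = length xs \<Longrightarrow> \<Phi> ys = \<Psi> ys"
  shows "cyclic_sum w \<Phi> xs = cyclic_sum w \<Psi> xs"
  unfolding cyclic_sum_def using assms by (intro sum.cong refl path_sum_cong) simp

lemma sum_in_additive_on:
  assumes S: "0 \<in> S" "\<And>x y. x \<in> S \<Longrightarrow> y \<in> S \<Longrightarrow> x + y \<in> S"
    and h: "h 0 = 0" "\<And>x y. x \<in> S \<Longrightarrow> y \<in> S \<Longrightarrow> h (x + y) = h x + h y"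
    and g: "\<And>i. i \<in> I \<Longrightarrow> g i \<in> S"
  shows "(\<Sum>i\<in>I. g i) \<in> S \<and> h (\<Sum>i\<in>I. g i) = (\<Sum>i\<in>I. h (g i))"
  using g by (induction I rule: infinite_finite_induct) (auto simp: S h)

text \<open>
  The set \<open>S\<close> is there because a cochain is additive on its tensor space only.
\<close>

lemma path_sum_additive_on:
  assumes S: "0 \<in> S" "\<And>x y. x \<in> S \<Longrightarrow> y \<in> S \<Longrightarrow> x + y \<in> S"
    and h: "h 0 = 0" "\<And>x y. x \<in> S \<Longrightarrow> y \<in> S \<Longrightarrow> h (x + y) = h x + h y"
  shows "(\<And>ys q. length ys = length xs \<Longrightarrow> \<Phi> ys q \<in> S) \<Longrightarrow>
    path_sum w xs k \<Phi> \<in> S \<and> h (path_sum w xs k \<Phi>) = path_sum w xs k (\<lambda>ys q. h (\<Phi> ys q))"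
proof (induction xs arbitrary: k \<Phi>)
  case (Cons x xs)
  have IH: "path_sum w xs l (\<lambda>ys q. \<Phi> (w k l x # ys) q) \<in> S \<and>
      h (path_sum w xs l (\<lambda>ys q. \<Phi> (w k l x # ys) q)) =
      path_sum w xs l (\<lambda>ys q. h (\<Phi> (w k l x # ys) q))" for l
    by (rule Cons.IH) (simp add: Cons.prems)
  then show ?case
    using sum_in_additive_on[of S h UNIV "\<lambda>l. path_sum w xs l (\<lambda>ys q. \<Phi> (w k l x # ys) q)"] S h
    by simp
qed simp

lemma cyclic_sum_additive_on:
  assumes S: "0 \<in> S" "\<And>x y. x \<in> S \<Longrightarrow> y \<in> S \<Longrightarrow> x + y \<in> S"
    and h: "h 0 = 0" "\<And>x y. x \<in> S \<Longrightarrow> y \<in> S \<Longrightarrow> h (x + y) = h x + h y"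
    and xs: "xs \<noteq> []" "\<And>ys. length ys = length xs \<Longrightarrow> \<Phi> ys \<in> S"
  shows "cyclic_sum w \<Phi> xs \<in> S" "h (cyclic_sum w \<Phi> xs) = cyclic_sum w (\<lambda>ys. h (\<Phi> ys)) xs"
proof -
  have *: "path_sum w (butlast xs) k (\<lambda>ys q. \<Phi> (ys @ [w q k (last xs)])) \<in> S \<and>
      h (path_sum w (butlast xs) k (\<lambda>ys q. \<Phi> (ys @ [w q k (last xs)]))) =
      path_sum w (butlast xs) k (\<lambda>ys q. h (\<Phi> (ys @ [w q k (last xs)])))" for k
    using xs by (intro path_sum_additive_on S h) auto
  then show "cyclic_sum w \<Phi> xs \<in> S" "h (cyclic_sum w \<Phi> xs) = cyclic_sum w (\<lambda>ys. h (\<Phi> ys)) xs"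
    using sum_in_additive_on[of S h UNIV "\<lambda>k. path_sum w (butlast xs) k (\<lambda>ys q. \<Phi> (ys @ [w q k (last xs)]))"] S h
    by (simp_all add: cyclic_sum_def)
qed

lemma path_sum_sum:
  "path_sum w xs k (\<lambda>ys q. \<Sum>i\<in>I. \<Phi> i ys q) = (\<Sum>i\<in>I. path_sum w xs k (\<Phi> i))"
proof (induction xs arbitrary: k \<Phi>)
  case (Cons x xs)
  then show ?case by (simp add: sum.swap[of _ I])
qed simp

lemma path_sum_add:
  "path_sum w xs k (\<lambda>ys q. \<Phi> ys q + \<Psi> ys q) = path_sum w xs k \<Phi> + path_sum w xs k \<Psi>"
  by (induction xs arbitrary: k \<Phi> \<Psi>) (simp_all add: sum.distrib)

lemma path_sum_mult_left:
  fixes a :: "'k::semiring_0"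
  shows "path_sum w xs k (\<lambda>ys q. a * \<Phi> ys q) = a * path_sum w xs k \<Phi>"
  by (induction xs arbitrary: k \<Phi>) (simp_all add: sum_distrib_left)

lemma cyclic_sum_linear_combination:
  fixes a :: "'i \<Rightarrow> 'k::semiring_0"
  shows "cyclic_sum w (\<lambda>ys. \<Sum>i\<in>I. a i * \<Phi> i ys) xs = (\<Sum>i\<in>I. a i * cyclic_sum w (\<Phi> i) xs)"
  unfolding cyclic_sum_def path_sum_sum path_sum_mult_left sum_distrib_left by (rule sum.swap)

lemma path_sum_map: "path_sum (\<lambda>k l x. h (w k l x)) xs k \<Phi> = path_sum w xs k (\<lambda>ys q. \<Phi> (map h ys) q)"
  by (induction xs arbitrary: k \<Phi>) simp_all

lemma cyclic_sum_map: "cyclic_sum (\<lambda>k l x. h (w k l x)) \<Phi> xs = cyclic_sum w (\<lambda>ys. \<Phi> (map h ys)) xs"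
  by (simp add: cyclic_sum_def path_sum_map)

lemma path_sum_snoc:
  "path_sum w (xs @ [x]) k \<Phi> = path_sum w xs k (\<lambda>ys q. \<Sum>l\<in>UNIV. \<Phi> (ys @ [w q l x]) l)"
  by (induction xs arbitrary: k \<Phi>) simp_all

text \<open>
  The definition of \<open>cyclic_sum\<close> treats the closing entry separately, which suits the cyclic
  face; this is the more symmetric description.
\<close>

lemma cyclic_sum_closed_paths:
  assumes "xs \<noteq> []"
  shows "cyclic_sum w \<Phi> xs = (\<Sum>k\<in>UNIV. path_sum w xs k (\<lambda>ys q. if q = k then \<Phi> ys else 0))"
proof -
  obtain bs x where "xs = bs @ [x]" using assms by (cases xs rule: rev_cases) auto
  then show ?thesis by (simp add: cyclic_sum_def path_sum_snoc)
qed

text \<open>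
  If \<open>w\<close> turns products into matrix products, then multiplying two neighbours before taking
  paths is the same as multiplying them afterwards: the path through the two factors has one
  more intermediate index, and the sum over it is the expanded product.
\<close>

lemma path_sum_mult_at:
  assumes mult: "\<And>k l x y. w k l (m x y) = (\<Sum>h\<in>UNIV. m' (w k h x) (w h l y))"
  shows "Suc i < length xs \<Longrightarrow> (\<And>q. slot_linear sA sV (length xs - 1) (\<lambda>ys. \<Phi> ys q)) \<Longrightarrow>
    path_sum w (mult_at m i xs) k \<Phi> = path_sum w xs k (\<lambda>ys q. \<Phi> (mult_at m' i ys) q)"
proof (induction i arbitrary: xs k \<Phi>)
  case 0
  then obtain x y zs where xs: "xs = x # y # zs"
    by (cases xs; cases "tl xs") auto
  have "path_sum w zs l (\<lambda>ys q. \<Phi> (w k l (m x y) # ys) q) =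
        (\<Sum>h\<in>UNIV. path_sum w zs l (\<lambda>ys q. \<Phi> (m' (w k h x) (w h l y) # ys) q))" for l
  proof -
    have "\<Phi> (w k l (m x y) # ys) q = (\<Sum>h\<in>UNIV. \<Phi> (m' (w k h x) (w h l y) # ys) q)"
      if "length ys = length zs" for ys q
      using linear_imp_sum[OF slot_linearD[OF 0(2), of "[]" ys]] that by (simp add: mult xs)
    then show ?thesis
      unfolding path_sum_sum[symmetric] by (intro path_sum_cong)
  qed
  then show ?case
    by (subst xs, simp add: xs) (rule sum.swap)
next
  case (Suc i)
  then obtain x ys where xs: "xs = x # ys" and ys: "Suc i < length ys" by (cases xs) auto
  have "Suc (length ys - 1) = length ys" using ys by linarith
  then have "slot_linear sA sV (length ys - 1) (\<lambda>zs. \<Phi> (w k l x # zs) q)" for l q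
    using Suc.prems(2)[of q] by (intro slot_linear_Cons) (simp add: xs)
  from Suc.IH[OF ys this] show ?case by (simp add: xs)
qed

text \<open>
  The same for closed paths. The product of the last two entries is the one that
  \<open>path_sum_mult_at\<close> does not cover, as it involves the closing entry.
\<close>

lemma cyclic_sum_mult_at:
  assumes mult: "\<And>k l x y. w k l (m x y) = (\<Sum>h\<in>UNIV. m' (w k h x) (w h l y))"
    and i: "Suc i < length xs" and \<Phi>: "slot_linear sA sV (length xs - 1) \<Phi>"
  shows "cyclic_sum w \<Phi> (mult_at m i xs) = cyclic_sum w (\<lambda>ys. \<Phi> (mult_at m' i ys)) xs"
proof -
  obtain bs x where xs: "xs = bs @ [x]" using i by (cases xs rule: rev_cases) auto
  show ?thesis
  proof (cases "Suc i < length bs")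
    case True
    have "Suc (length bs - 1) = length bs" using True by linarith
    then have "slot_linear sA sV (length bs - 1) (\<lambda>ys. \<Phi> (ys @ [w q k x]))" for q k
      using slot_linear_append[of sA sV "[]" "length bs - 1" "[w q k x]" \<Phi>] \<Phi>
      by (simp add: xs)
    then have "path_sum w (mult_at m i bs) k (\<lambda>ys q. \<Phi> (ys @ [w q k x])) =
               path_sum w bs k (\<lambda>ys q. \<Phi> (mult_at m' i ys @ [w q k x]))" for k
      by (rule path_sum_mult_at[where w = w and m = m and m' = m', OF mult True])
    also have "path_sum w bs k (\<lambda>ys q. \<Phi> (mult_at m' i ys @ [w q k x])) =
               path_sum w bs k (\<lambda>ys q. \<Phi> (mult_at m' i (ys @ [w q k x])))" for k
      using True by (intro path_sum_cong) (simp add: mult_at_append_left)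
    finally show ?thesis
      using True by (simp add: cyclic_sum_def xs mult_at_append_left)
  next
    case False
    with i obtain cs y where bs: "bs = cs @ [y]" and "i = length cs"
      by (cases bs rule: rev_cases) (auto simp: xs)
    then have ms: "mult_at m'' i (us @ [u, v]) = us @ [m'' u v]" if "length us = length cs" for us m'' u v
      using mult_at_append_right[of m'' us 0 "[u, v]"] that by simp
    have "\<Phi> (ys @ [w q k (m y x)]) = (\<Sum>h\<in>UNIV. \<Phi> (ys @ [m' (w q h y) (w h k x)]))"
      if "length ys = length cs" for ys q k
      using linear_imp_sum[OF slot_linearD[OF \<Phi>, of ys "[]"]] that by (simp add: mult xs bs)
    then show ?thesis
      by (auto simp: cyclic_sum_def xs bs ms path_sum_snoc butlast_append intro!: sum.cong path_sum_cong)
  qed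
qed

lemma linear_path_sum:
  assumes "vector_space s" "vector_space t"
  shows "(\<And>ys q. length ys = length xs \<Longrightarrow> Vector_Spaces.linear s t (\<lambda>x. \<Psi> x ys q)) \<Longrightarrow>
    Vector_Spaces.linear s t (\<lambda>x. path_sum w xs k (\<Psi> x))"
proof (induction xs arbitrary: k \<Psi>)
  case (Cons a xs)
  then show ?case by (auto intro!: linear_sum_family[OF assms])
qed simp

lemma linear_path_sum_slot:
  fixes w :: "'r::finite \<Rightarrow> 'r \<Rightarrow> 'a::ab_group_add \<Rightarrow> 'b::ab_group_add"
  assumes vs: "vector_space s" "vector_space t"
    and w: "\<And>k l. Vector_Spaces.linear s sB (w k l)"
  shows "(\<And>us vs q. length us = length xs \<Longrightarrow> length vs = length ys \<Longrightarrow>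
             Vector_Spaces.linear sB t (\<lambda>x. \<Phi> (us @ x # vs) q)) \<Longrightarrow>
    Vector_Spaces.linear s t (\<lambda>x. path_sum w (xs @ x # ys) k \<Phi>)"
proof (induction xs arbitrary: k \<Phi>)
  case Nil
  have "Vector_Spaces.linear s t (\<lambda>x. path_sum w ys l (\<lambda>zs q. \<Phi> (w k l x # zs) q))" for l
  proof (rule linear_path_sum[OF vs])
    fix zs :: "'b list" and q assume "length zs = length ys"
    then show "Vector_Spaces.linear s t (\<lambda>x. \<Phi> (w k l x # zs) q)"
      using linear_comp[OF w Nil[of "[]" zs]] by simp
  qed
  then show ?case by (auto intro!: linear_sum_family[OF vs])
next
  case (Cons a xs)
  have "Vector_Spaces.linear s t (\<lambda>x. path_sum w (xs @ x # ys) l (\<lambda>zs q. \<Phi> (w k l a # zs) q))" for l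
    using Cons.prems[of "w k l a # _"] by (intro Cons.IH) simp
  then show ?case by (auto intro!: linear_sum_family[OF vs])
qed

lemma slot_linear_cyclic_sum:
  fixes sA :: "'k::field \<Rightarrow> 'a::ab_group_add \<Rightarrow> 'a" and sB :: "'k \<Rightarrow> 'b::ab_group_add \<Rightarrow> 'b"
  assumes vs: "vector_space sA" "vector_space sV"
    and w: "\<And>k l. Vector_Spaces.linear sA sB (w k l)" and \<Phi>: "slot_linear sB sV n \<Phi>"
  shows "slot_linear sA sV n (cyclic_sum w \<Phi>)"
  unfolding slot_linear_def
proof (intro allI impI)
  fix xs ys :: "'a list" assume len: "length xs + Suc (length ys) = n"
  show "Vector_Spaces.linear sA sV (\<lambda>x. cyclic_sum w \<Phi> (xs @ x # ys))"
  proof (cases ys rule: rev_cases)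
    case Nil
    have "Vector_Spaces.linear sA sV (\<lambda>x. path_sum w xs k (\<lambda>us q. \<Phi> (us @ [w q k x])))" for k
      using linear_comp[OF w slot_linearD[OF \<Phi>, of _ "[]"]] len
      by (intro linear_path_sum[OF vs]) (simp add: Nil)
    then show ?thesis by (auto simp: Nil cyclic_sum_def intro!: linear_sum_family[OF vs])
  next
    case (snoc zs z)
    have "Vector_Spaces.linear sA sV (\<lambda>x. path_sum w (xs @ x # zs) k (\<lambda>us q. \<Phi> (us @ [w q k z])))" for k
      using slot_linearD[OF \<Phi>, of _ "_ @ [w _ k z]"] len
      by (intro linear_path_sum_slot[OF vs w]) (simp add: snoc)
    then show ?thesis
      by (auto simp: snoc cyclic_sum_def butlast_append intro!: linear_sum_family[OF vs])
  qed
qed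

lemma multilinear_cyclic_sum:
  fixes w :: "'r::finite \<Rightarrow> 'r \<Rightarrow> 'a::ab_group_add \<Rightarrow> 'b::ab_group_add"
  assumes vs: "vector_space sC" "vector_space sA" "vector_space sV"
    and w: "\<And>k l. Vector_Spaces.linear sA sB (w k l)" and f: "multilinear_map sC sB (Suc n) sV f"
  shows "multilinear_map sC sA (Suc n) sV (\<lambda>c. cyclic_sum w (f c))"
  unfolding multilinear_map_iff_slot_linear
proof (intro conjI allI impI)
  fix as :: "'a list" assume "length as = Suc n"
  then show "Vector_Spaces.linear sC sV (\<lambda>c. cyclic_sum w (f c) as)"
    unfolding cyclic_sum_def
    by (intro linear_sum_family linear_path_sum vs multilinear_map_linear_left[OF f]) simp
next
  fix c show "slot_linear sA sV (Suc n) (cyclic_sum w (f c))"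
    by (rule slot_linear_cyclic_sum[OF vs(2,3) w multilinear_map_slot_linear[OF f]])
qed


section \<open>Hochschild cochains as multilinear forms\<close>

text \<open>
  The entwining enters the Hochschild complex only through the numbers \<open>F (a\<^sub>\<psi>) (c\<^sup>\<psi>)\<close> for bilinear
  forms \<open>F\<close>, and \<open>ent c a F\<close> is this number. The axioms \<open>ent_mult\<close> and \<open>ent_one\<close> are the
  compatibility of \<open>\<psi>\<close> with product and unit. Linearity in \<open>F\<close> is required for arbitrary functions
  \<open>F\<close>, so that finite sums pass through \<open>ent\<close> without checking bilinearity of each summand; a
  choice of representatives \<open>\<Sum> x\<^sub>i \<otimes> d\<^sub>i\<close> of \<open>\<psi> (c \<otimes> a)\<close> gives such a functional.
\<close>

locale entwined_algebra = A: unital_algebra sA mA uA + C: vector_space sC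
  for sA :: "'k::field \<Rightarrow> 'a::ab_group_add \<Rightarrow> 'a" and mA and uA
    and sC :: "'k \<Rightarrow> 'c::ab_group_add \<Rightarrow> 'c" +
  fixes ent :: "'c \<Rightarrow> 'a \<Rightarrow> ('a \<Rightarrow> 'c \<Rightarrow> 'k) \<Rightarrow> 'k"
  assumes ent_add: "ent c a (\<lambda>x d. F x d + G x d) = ent c a F + ent c a G"
    and ent_scale: "ent c a (\<lambda>x d. k * F x d) = k * ent c a F"
    and ent_linear_left: "bilinear_map sA sC (*) F \<Longrightarrow> Vector_Spaces.linear sC (*) (\<lambda>c. ent c a F)"
    and ent_linear_right: "bilinear_map sA sC (*) F \<Longrightarrow> Vector_Spaces.linear sA (*) (\<lambda>a. ent c a F)"
    and ent_mult: "bilinear_map sA sC (*) F \<Longrightarrow>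
      ent c (mA a b) F = ent c a (\<lambda>x d. ent d b (\<lambda>y e. F (mA x y) e))"
    and ent_one: "bilinear_map sA sC (*) F \<Longrightarrow> ent c uA F = F uA c"
begin

lemma mult_linear_left: "Vector_Spaces.linear sA sA (\<lambda>x. mA x y)"
  and mult_linear_right: "Vector_Spaces.linear sA sA (mA x)"
  using A.mult_bilinear by (simp_all add: bilinear_map_def)

lemma ent_zero: "ent c a (\<lambda>x d. 0) = 0"
  using ent_scale[of c a 0 "\<lambda>x d. 0"] by simp

lemma ent_sum: "ent c a (\<lambda>x d. \<Sum>i\<in>I. F i x d) = (\<Sum>i\<in>I. ent c a (F i))"
  by (induction I rule: infinite_finite_induct) (simp_all add: ent_zero ent_add)

lemma ent_path_sum:
  "ent c a (\<lambda>x d. path_sum w xs k (\<Phi> x d)) = path_sum w xs k (\<lambda>ys q. ent c a (\<lambda>x d. \<Phi> x d ys q))"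
  by (induction xs arbitrary: k \<Phi>) (simp_all add: ent_sum)

lemma ent_linear:
  assumes "vector_space s" "\<And>x d. Vector_Spaces.linear s (*) (\<lambda>z. F z x d)"
  shows "Vector_Spaces.linear s (*) (\<lambda>z. ent c a (F z))"
proof -
  have "F (x + y) = (\<lambda>z d. F x z d + F y z d)" "F (s k x) = (\<lambda>z d. k * F x z d)" for x y k
    using assms(2) by (auto simp: Vector_Spaces.linear_iff fun_eq_iff)
  then show ?thesis
    using assms(1) by (simp add: Vector_Spaces.linear_iff ent_add ent_scale vector_space_times)
qed

abbreviation form :: "nat \<Rightarrow> ('c \<Rightarrow> 'a list \<Rightarrow> 'k) \<Rightarrow> bool" where
  "form m \<equiv> multilinear_map sC sA m (*)"

text \<open>
  The coface maps, on forms. Face \<open>0\<close> is the cyclic one: it moves the first entry past \<open>c\<close> and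
  multiplies it to the last entry from the right.
\<close>

fun face :: "nat \<Rightarrow> ('c \<Rightarrow> 'a list \<Rightarrow> 'k) \<Rightarrow> 'c \<Rightarrow> 'a list \<Rightarrow> 'k" where
  "face 0 G c as = ent c (hd as) (\<lambda>x d. G d (map_last (\<lambda>a. mA a x) (tl as)))"
| "face (Suc i) G c as = G c (mult_at mA i as)"

definition differential :: "nat \<Rightarrow> ('c \<Rightarrow> 'a list \<Rightarrow> 'k) \<Rightarrow> 'c \<Rightarrow> 'a list \<Rightarrow> 'k" where
  "differential n G c as = (\<Sum>i\<le>Suc n. (- 1) ^ i * face i G c as)"

lemma bilinear_map_last:
  assumes G: "form m G" and as: "length as = m" "as \<noteq> []"
  shows "bilinear_map sA sC (*) (\<lambda>x d. G d (map_last (\<lambda>a. mA a x) as))"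
proof -
  obtain bs b where bs: "as = bs @ [b]" using as(2) by (cases as rule: rev_cases) auto
  show ?thesis
    unfolding bilinear_map_def
    using multilinear_map_linear_left[OF G] as
      linear_comp[OF mult_linear_right multilinear_map_slot[OF G, of bs "[]"]]
    by (simp add: bs)
qed

text \<open>
  An inner face merges two slots. In the cyclic face the slot \<open>hd as\<close> is linear because \<open>ent\<close>
  is linear in the algebra, and the other slots because \<open>ent\<close> is linear in the form.
\<close>

lemma face_form:
  assumes G: "form m G" and "0 < m" "i \<le> m"
  shows "form (Suc m) (face i G)"
proof (cases i)
  case (Suc j)
  have "face (Suc j) G = (\<lambda>c xs. G c (mult_at mA j xs))"
    by (simp add: fun_eq_iff)
  then show ?thesis
    using Suc assms slot_linear_mult_at[OF mult_linear_left mult_linear_right multilinear_map_slot_linear[OF G], of j]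
    by (auto simp: multilinear_map_iff_slot_linear length_mult_at)
next
  case 0
  show ?thesis
    unfolding multilinear_map_iff_slot_linear slot_linear_def 0
  proof (intro conjI allI impI)
    fix as :: "'a list" assume "length as = Suc m"
    then have "length (tl as) = m" "tl as \<noteq> []" using \<open>0 < m\<close> by (cases as; auto)+
    then show "Vector_Spaces.linear sC (*) (\<lambda>c. face 0 G c as)"
      by (auto intro!: ent_linear_left bilinear_map_last[OF G])
  next
    fix c and xs ys :: "'a list" assume len: "length xs + Suc (length ys) = Suc m"
    show "Vector_Spaces.linear sA (*) (\<lambda>x. face 0 G c (xs @ x # ys))"
    proof (cases xs)
      case Nil
      then show ?thesis
        using len \<open>0 < m\<close> by (auto intro!: ent_linear_right bilinear_map_last[OF G])
    next
      case (Cons a xs')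
      have "Vector_Spaces.linear sA (*) (\<lambda>x. G d (map_last (\<lambda>a. mA a y) (xs' @ x # ys)))" for y d
        using len Cons
        by (intro slot_linearD[OF slot_linear_map_last[OF multilinear_map_slot_linear[OF G] mult_linear_left]])
          simp
      then show ?thesis
        using Cons by (auto intro!: ent_linear A.vector_space_axioms)
    qed
  qed
qed

lemma differential_form:
  assumes "form (Suc n) G"
  shows "form (Suc (Suc n)) (differential n G)"
  unfolding differential_def using assms
  by (intro multilinear_map_sum multilinear_map_compose[OF face_form linear_times_const]
      A.vector_space_axioms C.vector_space_axioms vector_space_times) auto

lemma face_sum: "face i (\<lambda>c as. \<Sum>j\<in>J. k j * G j c as) c as = (\<Sum>j\<in>J. k j * face i (G j) c as)"
  by (cases i) (simp_all add: ent_sum ent_scale)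

lemma face_cong:
  assumes "\<And>c as. length as = m \<Longrightarrow> G c as = H c as" "i \<le> m" "length as = Suc m" "0 < m"
  shows "face i G c as = face i H c as"
proof (cases i)
  case 0
  from assms have "length (tl as) = m" "tl as \<noteq> []" by (cases as; auto)+
  with assms show ?thesis by (simp add: 0 length_map_last)
qed (use assms in \<open>simp add: length_mult_at\<close>)

lemma differential_cong:
  assumes "\<And>c as. length as = Suc n \<Longrightarrow> G c as = H c as" "length as = Suc (Suc n)"
  shows "differential n G c as = differential n H c as"
  unfolding differential_def using face_cong[OF assms(1)] assms(2) by (intro sum.cong) auto

text \<open>
  The presimplicial identities. The only one about the entwining is \<open>i = 0\<close>, \<open>j = 1\<close>: moving a
  product past \<open>c\<close> is moving its factors past \<open>c\<close> one after the other.
\<close>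

lemma face_face:
  assumes G: "form (Suc n) G" and len: "length as = Suc (Suc (Suc n))" and ij: "i < j" "j \<le> Suc (Suc n)"
  shows "face j (face i G) c as = face i (face (j - 1) G) c as"
proof -
  obtain a bs where as: "as = a # bs" and bs: "length bs = Suc (Suc n)"
    using len by (cases as) auto
  obtain j' where j: "j = Suc j'" using ij by (cases j) auto
  show ?thesis
  proof (cases i)
    case (Suc i')
    then obtain j'' where "j' = Suc j''" using ij j by (cases j') auto
    then show ?thesis
      using mult_at_mult_at[OF A.mult_assoc, of i' j' as] ij len by (simp add: Suc j)
  next
    case 0
    show ?thesis
    proof (cases j')
      case 0
      obtain b ds where ds: "bs = b # ds" "length ds = Suc n" using bs by (cases bs) auto
      then have "ds \<noteq> []" by auto
      have "ent c (mA a b) (\<lambda>x d. G d (map_last (\<lambda>a. mA a x) ds)) =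
            ent c a (\<lambda>x d. ent d b (\<lambda>y e. G e (map_last (\<lambda>a. mA a (mA x y)) ds)))"
        using ds by (intro ent_mult bilinear_map_last[OF G]) auto
      then show ?thesis
        using \<open>ds \<noteq> []\<close> by (simp add: \<open>i = 0\<close> j 0 as ds map_last_Cons map_last_comp A.mult_assoc)
    next
      case (Suc j'')
      have "map_last (\<lambda>a. mA a x) (mult_at mA j'' bs) = mult_at mA j'' (map_last (\<lambda>a. mA a x) bs)" for x
        using ij bs by (intro map_last_mult_at A.mult_assoc) (simp add: j Suc)
      then show ?thesis by (simp add: \<open>i = 0\<close> j Suc as)
    qed
  qed
qed

lemma differential_differential:
  assumes "form (Suc n) G" "length as = Suc (Suc (Suc n))"
  shows "differential (Suc n) (differential n G) c as = 0"
proof -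
  have "face j (differential n G) c as = (\<Sum>i\<le>Suc n. (- 1) ^ i * face j (face i G) c as)" for j
    unfolding differential_def by (rule face_sum)
  then show ?thesis
    using alternating_double_sum_eq_zero[of "Suc n" "\<lambda>j i. face j (face i G) c as"] face_face[OF assms]
    by (simp only: differential_def[of "Suc n"])
qed


section \<open>A homotopy for generalised conjugations\<close>

text \<open>
  That is, \<open>\<psi> (c \<otimes> z) = z \<otimes> c\<close> for all \<open>c\<close>.
\<close>

definition entwining_invariant :: "'a \<Rightarrow> bool" where
  "entwining_invariant z \<longleftrightarrow> (\<forall>c F. bilinear_map sA sC (*) F \<longrightarrow> ent c z F = F z c)"

lemma bilinear_map_mult_left:
  "bilinear_map sA sC (*) F \<Longrightarrow> bilinear_map sA sC (*) (\<lambda>x d. F (mA z x) d)"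
  and bilinear_map_mult_right:
  "bilinear_map sA sC (*) F \<Longrightarrow> bilinear_map sA sC (*) (\<lambda>x d. F (mA x z) d)"
  unfolding bilinear_map_def
  by (auto intro: linear_comp[OF mult_linear_right] linear_comp[OF mult_linear_left])

lemma bilinear_map_ent:
  assumes F: "bilinear_map sA sC (*) F"
  shows "bilinear_map sA sC (*) (\<lambda>x d. ent d b (\<lambda>y e. F (mA x y) e))"
  unfolding bilinear_map_def
  using linear_comp[OF mult_linear_left bilinear_map_left[OF F]]
  by (auto intro!: ent_linear_left bilinear_map_mult_left[OF F] ent_linear A.vector_space_axioms)

text \<open>
  Invariant factors on both sides of \<open>b\<close> are untouched when the product moves past \<open>c\<close>.
\<close>

lemma ent_invariant_mult:
  assumes "entwining_invariant e" "entwining_invariant f" and F: "bilinear_map sA sC (*) F"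
  shows "ent c (mA (mA e b) f) F = ent c b (\<lambda>x d. F (mA (mA e x) f) d)"
proof -
  have "ent c (mA (mA e b) f) F = ent c (mA e b) (\<lambda>x d. F (mA x f) d)"
    using assms(2) bilinear_map_mult_left[OF F]
    by (simp add: ent_mult[OF F] entwining_invariant_def)
  also have "\<dots> = ent c e (\<lambda>x d. ent d b (\<lambda>y e. F (mA (mA x y) f) e))"
    by (rule ent_mult[OF bilinear_map_mult_right[OF F]])
  also have "\<dots> = ent c b (\<lambda>x d. F (mA (mA e x) f) d)"
    using assms(1) bilinear_map_ent[OF bilinear_map_mult_right[OF F, of f]]
    by (simp add: entwining_invariant_def)
  finally show ?thesis .
qed

text \<open>
  The matrix \<open>(e\<^sub>k x f\<^sub>l)\<^sub>k\<^sub>l\<close>. If \<open>\<Sum> f\<^sub>k e\<^sub>k = 1\<close>, it depends on \<open>x\<close> multiplicatively.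
\<close>

definition conjugate :: "('r \<Rightarrow> 'a) \<Rightarrow> ('r \<Rightarrow> 'a) \<Rightarrow> 'r \<Rightarrow> 'r \<Rightarrow> 'a \<Rightarrow> 'a" where
  "conjugate e f k l x = mA (mA (e k) x) (f l)"

text \<open>
  The part \<open>h\<^sub>j\<close> of the homotopy. It evaluates \<open>G\<close> on the chain
  \<open>(c, e\<^sub>k\<^sub>0 a\<^sub>1 f\<^sub>k\<^sub>1, \<dots>, e\<^sub>k\<^sub>j\<^sub>-\<^sub>1 a\<^sub>j f\<^sub>k\<^sub>j, e\<^sub>k\<^sub>j, a\<^sub>j\<^sub>+\<^sub>1, \<dots>, a\<^sub>n\<^sub>-\<^sub>1, a\<^sub>n f\<^sub>k\<^sub>0)\<close>, summed over all indices: the first \<open>j\<close>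
  entries are conjugated already, \<open>e\<^sub>k\<^sub>j\<close> separates them from the rest, and \<open>f\<^sub>k\<^sub>0\<close> at the last entry
  waits for \<open>e\<^sub>k\<^sub>0\<close> to come round by the cyclic face.
\<close>

definition insertion ::
  "('r::finite \<Rightarrow> 'a) \<Rightarrow> ('r \<Rightarrow> 'a) \<Rightarrow> nat \<Rightarrow> ('c \<Rightarrow> 'a list \<Rightarrow> 'k) \<Rightarrow> 'c \<Rightarrow> 'a list \<Rightarrow> 'k" where
  "insertion e f j G c as =
     (\<Sum>k\<in>UNIV. path_sum (conjugate e f) (take j as) k
        (\<lambda>ys q. G c (ys @ e q # map_last (\<lambda>a. mA a (f k)) (drop j as))))"

definition homotopy ::
  "('r::finite \<Rightarrow> 'a) \<Rightarrow> ('r \<Rightarrow> 'a) \<Rightarrow> nat \<Rightarrow> ('c \<Rightarrow> 'a list \<Rightarrow> 'k) \<Rightarrow> 'c \<Rightarrow> 'a list \<Rightarrow> 'k" where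
  "homotopy e f n G c as = (\<Sum>j<n. (- 1) ^ j * insertion e f j G c as)"

lemma insertion_sum:
  "insertion e f j (\<lambda>c as. \<Sum>i\<in>I. x i * G i c as) c as = (\<Sum>i\<in>I. x i * insertion e f j (G i) c as)"
  unfolding insertion_def path_sum_sum path_sum_mult_left sum_distrib_left by (rule sum.swap)

lemma homotopy_add:
  "homotopy e f n (\<lambda>c as. G c as + H c as) c as = homotopy e f n G c as + homotopy e f n H c as"
  by (simp add: homotopy_def insertion_def path_sum_add sum.distrib distrib_left)

lemma homotopy_scale: "homotopy e f n (\<lambda>c as. k * G c as) c as = k * homotopy e f n G c as"
  by (simp add: homotopy_def insertion_def path_sum_mult_left sum_distrib_left mult.left_commute)

lemma homotopy_cong:
  assumes "\<And>c as. length as = Suc n \<Longrightarrow> G c as = H c as" and len: "length as = n"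
  shows "homotopy e f n G c as = homotopy e f n H c as"
  unfolding homotopy_def
proof (intro sum.cong refl arg_cong[where f = "(*) _"])
  fix j assume "j \<in> {..<n}"
  then have "drop j as \<noteq> []" "j < n" using len by auto
  then show "insertion e f j G c as = insertion e f j H c as"
    unfolding insertion_def using len
    by (intro sum.cong refl path_sum_cong assms(1)) (simp add: length_map_last)
qed

context
  fixes e f :: "'r::finite \<Rightarrow> 'a"
  assumes partition_of_one: "(\<Sum>k\<in>UNIV. mA (f k) (e k)) = uA"
    and invariant: "\<And>k. entwining_invariant (e k)" "\<And>k. entwining_invariant (f k)"
begin

lemma insertion_append:
  "insertion e f (length ts) G c (ts @ zs) =
     (\<Sum>k\<in>UNIV. path_sum (conjugate e f) ts k (\<lambda>ys q. G c (ys @ e q # map_last (\<lambda>a. mA a (f k)) zs)))"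
  by (simp add: insertion_def)

lemma partition_mult: "(\<Sum>k\<in>UNIV. mA a (mA (f k) (mA (e k) x))) = mA a x"
proof -
  have "(\<Sum>k\<in>UNIV. mA a (mA (f k) (mA (e k) x))) = mA a (mA (\<Sum>k\<in>UNIV. mA (f k) (e k)) x)"
    by (simp add: A.mult_assoc linear_imp_sum[OF mult_linear_right] linear_imp_sum[OF mult_linear_left])
  then show ?thesis by (simp add: partition_of_one A.mult_one_left)
qed

lemma conjugate_mult: "conjugate e f k l (mA x y) = (\<Sum>h\<in>UNIV. mA (conjugate e f k h x) (conjugate e f h l y))"
proof -
  have "(\<Sum>h\<in>UNIV. mA (conjugate e f k h x) (conjugate e f h l y)) =
        (\<Sum>h\<in>UNIV. mA (mA (e k) x) (mA (f h) (mA (e h) (mA y (f l)))))"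
    by (simp add: conjugate_def A.mult_assoc)
  then show ?thesis by (simp only: partition_mult) (simp add: conjugate_def A.mult_assoc)
qed

lemma linear_conjugate: "Vector_Spaces.linear sA sA (conjugate e f k l)"
  unfolding conjugate_def using linear_comp[OF mult_linear_right mult_linear_left] .

text \<open>
  If \<open>f\<^sub>k\<close> and \<open>e\<^sub>k\<close> meet in the last entry, the sum over \<open>k\<close> removes both.
\<close>

lemma form_partition:
  assumes G: "form m G" and zs: "length ts + length zs = m" "zs \<noteq> []"
  shows "(\<Sum>k\<in>UNIV. G c (ts @ map_last (\<lambda>a. mA a (mA (f k) (mA (e k) x))) zs)) =
         G c (ts @ map_last (\<lambda>a. mA a x) zs)"
proof -
  obtain bs b where bs: "zs = bs @ [b]" using zs(2) by (cases zs rule: rev_cases) auto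
  have "G c ((ts @ bs) @ (\<Sum>k\<in>UNIV. mA b (mA (f k) (mA (e k) x))) # []) =
        (\<Sum>k\<in>UNIV. G c ((ts @ bs) @ mA b (mA (f k) (mA (e k) x)) # []))"
    using zs(1) by (intro linear_imp_sum[OF multilinear_map_slot[OF G]]) (simp add: bs)
  then show ?thesis by (simp add: bs partition_mult)
qed

text \<open>
  One end of the telescope. In \<open>(c, e\<^sub>k, a\<^sub>1, \<dots>, a\<^sub>n\<^sub>+\<^sub>1 f\<^sub>k)\<close> the cyclic face moves \<open>e\<^sub>k\<close> past \<open>c\<close> unchanged,
  and the last entry becomes \<open>a\<^sub>n\<^sub>+\<^sub>1 f\<^sub>k e\<^sub>k\<close>, which sums to \<open>a\<^sub>n\<^sub>+\<^sub>1\<close>.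
\<close>

lemma insertion_first_face:
  assumes G: "form (Suc n) G" and len: "length as = Suc n"
  shows "insertion e f 0 (face 0 G) c as = G c as"
proof -
  have "as \<noteq> []" using len by auto
  \<comment> \<open>The trailing unit gives the last entry the shape required by \<open>form_partition\<close>.\<close>
  have "face 0 G c (e k # map_last (\<lambda>a. mA a (f k)) as) =
        G c ([] @ map_last (\<lambda>a. mA a (mA (f k) (mA (e k) uA))) as)" for k
  proof -
    have "bilinear_map sA sC (*) (\<lambda>x d. G d (map_last (\<lambda>a. mA a x) (map_last (\<lambda>a. mA a (f k)) as)))"
      using len \<open>as \<noteq> []\<close> by (intro bilinear_map_last[OF G]) (auto simp: length_map_last map_last_def)
    then show ?thesis
      using invariant(1) \<open>as \<noteq> []\<close>
      by (simp add: entwining_invariant_def map_last_comp A.mult_assoc A.mult_one_right)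
  qed
  then have "insertion e f 0 (face 0 G) c as =
      (\<Sum>k\<in>UNIV. G c ([] @ map_last (\<lambda>a. mA a (mA (f k) (mA (e k) uA))) as))"
    by (simp add: insertion_def del: face.simps)
  also have "\<dots> = G c ([] @ map_last (\<lambda>a. mA a uA) as)"
    using len \<open>as \<noteq> []\<close> by (intro form_partition[OF G]) auto
  also have "\<dots> = G c as"
    using \<open>as \<noteq> []\<close> by (simp add: map_last_def A.mult_one_right)
  finally show ?thesis .
qed

text \<open>
  The cyclic face moves \<open>e\<^sub>k\<^sub>0 a\<^sub>1 f\<^sub>k\<^sub>1\<close> to the last entry \<open>a\<^sub>n\<^sub>+\<^sub>1 f\<^sub>k\<^sub>0\<close>. As \<open>e\<^sub>k\<^sub>0\<close> and \<open>f\<^sub>k\<^sub>1\<close> pass \<open>c\<close> unchanged,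
  the result is \<open>a\<^sub>n\<^sub>+\<^sub>1 f\<^sub>k\<^sub>0 e\<^sub>k\<^sub>0 a\<^sub>1\<^sub>\<psi> f\<^sub>k\<^sub>1\<close>. The sum over \<open>k\<^sub>0\<close> leaves \<open>a\<^sub>n\<^sub>+\<^sub>1 a\<^sub>1\<^sub>\<psi> f\<^sub>k\<^sub>1\<close>, where the first index is
  now \<open>k\<^sub>1\<close>: this is \<open>h\<^sub>j\<close> of the cyclic face of \<open>(c, a\<^sub>1, \<dots>, a\<^sub>n\<^sub>+\<^sub>1)\<close>.
\<close>

lemma insertion_cyclic_face:
  assumes G: "form (Suc n) G" and len: "length as = Suc n" and j: "j < n"
  shows "insertion e f (Suc j) (face 0 G) c as = face 0 (insertion e f j G) c as"
proof -
  obtain b ts zs where as: "as = b # ts @ zs" and ts: "length ts = j" and zs: "zs \<noteq> []"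
    using len j by (cases as) (auto intro: that[of _ "take j (tl as)" "drop j (tl as)"])
  have step: "face 0 G c (conjugate e f k l b # ys @ e q # map_last (\<lambda>a. mA a (f k)) zs) =
      ent c b (\<lambda>x d. G d ((ys @ [e q]) @ map_last (\<lambda>a. mA a (mA (f k) (mA (e k) (mA x (f l))))) zs))"
    if "length ys = length ts" for k l ys q
  proof -
    have "bilinear_map sA sC (*)
       (\<lambda>x d. G d (map_last (\<lambda>a. mA a x) (ys @ e q # map_last (\<lambda>a. mA a (f k)) zs)))"
      using that len zs
      by (intro bilinear_map_last[OF G]) (auto simp: as length_map_last)
    then have "face 0 G c (conjugate e f k l b # ys @ e q # map_last (\<lambda>a. mA a (f k)) zs) =
       ent c b (\<lambda>x d. G d (map_last (\<lambda>a. mA a (mA (mA (e k) x) (f l)))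
                              (ys @ e q # map_last (\<lambda>a. mA a (f k)) zs)))"
      using ent_invariant_mult[OF invariant] by (simp add: conjugate_def)
    then show ?thesis
      using zs by (simp add: map_last_append map_last_Cons map_last_comp length_map_last A.mult_assoc
          map_last_def[of _ "map_last _ _"]) (simp add: map_last_def A.mult_assoc)
  qed
  have "insertion e f (Suc j) (face 0 G) c as =
      (\<Sum>k\<in>UNIV. \<Sum>l\<in>UNIV. path_sum (conjugate e f) ts l
         (\<lambda>ys q. face 0 G c (conjugate e f k l b # ys @ e q # map_last (\<lambda>a. mA a (f k)) zs)))"
    using insertion_append[of "b # ts" "face 0 G" c zs] by (simp add: as ts)
  also have "\<dots> = (\<Sum>k\<in>UNIV. \<Sum>l\<in>UNIV. path_sum (conjugate e f) ts l
       (\<lambda>ys q. ent c b (\<lambda>x d. G d ((ys @ [e q]) @ map_last (\<lambda>a. mA a (mA (f k) (mA (e k) (mA x (f l))))) zs))))"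
    by (intro sum.cong refl path_sum_cong step)
  also have "\<dots> = (\<Sum>l\<in>UNIV. path_sum (conjugate e f) ts l
       (\<lambda>ys q. ent c b (\<lambda>x d. \<Sum>k\<in>UNIV. G d ((ys @ [e q]) @ map_last (\<lambda>a. mA a (mA (f k) (mA (e k) (mA x (f l))))) zs))))"
    by (subst sum.swap) (simp add: ent_sum path_sum_sum)
  also have "\<dots> = (\<Sum>l\<in>UNIV. path_sum (conjugate e f) ts l
       (\<lambda>ys q. ent c b (\<lambda>x d. G d ((ys @ [e q]) @ map_last (\<lambda>a. mA a (mA x (f l))) zs))))"
    using len zs by (intro sum.cong refl path_sum_cong) (subst form_partition[OF G]; simp add: as)
  also have "\<dots> = ent c b (\<lambda>x d. \<Sum>l\<in>UNIV. path_sum (conjugate e f) ts l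
       (\<lambda>ys q. G d (ys @ e q # map_last (\<lambda>a. mA a (mA x (f l))) zs)))"
    by (simp add: ent_sum ent_path_sum)
  also have "\<dots> = ent c b (\<lambda>x d. insertion e f (length ts) G d (ts @ map_last (\<lambda>a. mA a x) zs))"
    using zs by (simp add: insertion_append map_last_comp A.mult_assoc)
  also have "\<dots> = face 0 (insertion e f j G) c as"
    using zs by (simp add: as ts map_last_append)
  finally show ?thesis .
qed

text \<open>
  Both entries that are multiplied lie in the conjugated part.
\<close>

lemma insertion_face_below:
  assumes G: "form (Suc n) G" and len: "length as = Suc n" and ij: "i < j" "j \<le> n"
  shows "insertion e f j (face i G) c as = face i (insertion e f (j - 1) G) c as"
proof (cases i)
  case 0
  then show ?thesis
    using insertion_cyclic_face[OF G len, of "j - 1"] ij by simp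
next
  case (Suc i')
  obtain ts zs where as: "as = ts @ zs" and ts: "length ts = j" and zs: "zs \<noteq> []"
    using len ij by (auto intro: that[of "take j as" "drop j as"])
  have i': "Suc i' < length ts" using ij ts Suc by simp
  let ?Z = "\<lambda>k. map_last (\<lambda>a. mA a (f k)) zs"
  have lin: "slot_linear sA (*) (length ts - 1) (\<lambda>ys. G c (ys @ e q # ?Z k))" for q k
    using slot_linear_append[of sA "(*)" "[]" "length ts - 1" "e q # ?Z k" "G c"] i' len zs
      multilinear_map_slot_linear[OF G, of c]
    by (simp add: as length_map_last)
  have "insertion e f j (face i G) c as =
      (\<Sum>k\<in>UNIV. path_sum (conjugate e f) ts k (\<lambda>ys q. G c (mult_at mA i' ys @ e q # ?Z k)))"
    using i' unfolding as ts[symmetric] insertion_append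
    by (intro sum.cong refl path_sum_cong) (simp add: Suc mult_at_append_left)
  also have "\<dots> = (\<Sum>k\<in>UNIV. path_sum (conjugate e f) (mult_at mA i' ts) k (\<lambda>ys q. G c (ys @ e q # ?Z k)))"
    by (intro sum.cong refl path_sum_mult_at[where w = "conjugate e f" and sA = sA and sV = "(*)", OF conjugate_mult i', symmetric] lin)
  also have "\<dots> = insertion e f (length (mult_at mA i' ts)) G c (mult_at mA i' ts @ zs)"
    by (rule insertion_append[symmetric])
  finally show ?thesis
    using i' by (simp add: as Suc mult_at_append_left length_mult_at ts)
qed

text \<open>
  In \<open>h\<^sub>j\<close> the inserted \<open>e\<^sub>k\<^sub>j\<close> is multiplied with its left neighbour \<open>e\<^sub>k\<^sub>j\<^sub>-\<^sub>1 a\<^sub>j f\<^sub>k\<^sub>j\<close>, and the sum over \<open>k\<^sub>j\<close>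
  leaves \<open>e\<^sub>k\<^sub>j\<^sub>-\<^sub>1 a\<^sub>j\<close>. In \<open>h\<^sub>j\<^sub>-\<^sub>1\<close> the inserted \<open>e\<^sub>k\<^sub>j\<^sub>-\<^sub>1\<close> is multiplied with its right neighbour \<open>a\<^sub>j\<close>.
\<close>

lemma insertion_face_diagonal:
  assumes G: "form (Suc n) G" and len: "length as = Suc n" and j: "1 \<le> j" "j \<le> n"
  shows "insertion e f j (face j G) c as = insertion e f (j - 1) (face j G) c as"
proof -
  obtain ts b zs where as: "as = ts @ b # zs" and ts: "length ts = j - 1" and zs: "zs \<noteq> []"
    using len j id_take_nth_drop[of "j - 1" as] 
    by (auto intro!: that[of "take (j - 1) as" "as ! (j - 1)" "drop j as"])
  obtain j' where j': "j = Suc j'" using j by (cases j) auto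
  let ?Z = "\<lambda>k. map_last (\<lambda>a. mA a (f k)) zs"
  have m: "mult_at mA j' (ys @ u # v # vs) = ys @ mA u v # vs" if "length ys = length ts" for ys u v vs
    using mult_at_append_right[of mA ys 0 "u # v # vs"] that ts by (simp add: j')
  have merge: "(\<Sum>l\<in>UNIV. G c (ys @ mA (conjugate e f q l b) (e l) # ?Z k)) = G c (ys @ mA (e q) b # ?Z k)"
    if "length ys = length ts" for ys q k
  proof -
    have "G c (ys @ (\<Sum>l\<in>UNIV. mA (mA (e q) b) (mA (f l) (mA (e l) uA))) # ?Z k) =
          (\<Sum>l\<in>UNIV. G c (ys @ mA (mA (e q) b) (mA (f l) (mA (e l) uA)) # ?Z k))"
      using len that zs
      by (intro linear_imp_sum[OF multilinear_map_slot[OF G]]) (simp add: as length_map_last)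
    then show ?thesis
      unfolding partition_mult by (simp add: conjugate_def A.mult_assoc A.mult_one_right)
  qed
  have "insertion e f j (face j G) c as = (\<Sum>k\<in>UNIV. path_sum (conjugate e f) ts k
          (\<lambda>ys q. \<Sum>l\<in>UNIV. G c (mult_at mA j' (ys @ conjugate e f q l b # e l # ?Z k))))"
    using insertion_append[of "ts @ [b]" "face j G" c zs] by (simp add: as ts j' path_sum_snoc)
  also have "\<dots> = (\<Sum>k\<in>UNIV. path_sum (conjugate e f) ts k
          (\<lambda>ys q. G c (mult_at mA j' (ys @ e q # b # ?Z k))))"
    by (intro sum.cong refl path_sum_cong) (simp add: m merge)
  also have "\<dots> = insertion e f (length ts) (face j G) c (ts @ b # zs)"
    unfolding insertion_append using zs by (simp add: j' map_last_Cons)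
  finally show ?thesis by (simp add: as ts)
qed

text \<open>
  Both entries lie behind the inserted one. Multiplication from the right by \<open>f\<^sub>k\<^sub>0\<close> at the last
  entry commutes with the product, by associativity.
\<close>

lemma insertion_face_above:
  assumes len: "length as = Suc n" and ij: "Suc j < i" "i \<le> Suc n"
  shows "insertion e f j (face i G) c as = face (i - 1) (insertion e f j G) c as"
proof -
  obtain ts zs where as: "as = ts @ zs" and ts: "length ts = j"
    using len ij by (auto intro: that[of "take j as" "drop j as"])
  obtain h where i: "i = Suc (j + Suc h)"
    using less_imp_Suc_add[OF ij(1)] by auto
  have h: "Suc h < length zs" using len ij ts by (simp add: as i)
  let ?g = "\<lambda>k a. mA a (f k)"
  have "insertion e f j (face i G) c as =
      (\<Sum>k\<in>UNIV. path_sum (conjugate e f) ts k (\<lambda>ys q. G c (ys @ e q # map_last (?g k) (mult_at mA h zs))))"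
    unfolding as ts[symmetric] insertion_append
  proof (intro sum.cong refl path_sum_cong)
    fix k q and ys :: "'a list" assume "length ys = length ts"
    then show "face i G c (ys @ e q # map_last (?g k) zs) =
               G c (ys @ e q # map_last (?g k) (mult_at mA h zs))"
      using mult_at_append_right[of mA ys "Suc h" "e q # map_last (?g k) zs"]
        map_last_mult_at[of "?g k" mA, OF A.mult_assoc h]
      by (simp add: i ts)
  qed
  also have "\<dots> = face (i - 1) (insertion e f j G) c as"
    using insertion_append[of ts G c "mult_at mA h zs"] mult_at_append_right[of mA ts h zs]
    by (simp add: as i ts)
  finally show ?thesis .
qed

text \<open>
  The other end of the telescope: \<open>e\<^sub>k\<^sub>n\<close> meets \<open>a\<^sub>n\<^sub>+\<^sub>1 f\<^sub>k\<^sub>0\<close>, and every entry is conjugated.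
\<close>

lemma insertion_last_face:
  assumes len: "length as = Suc n"
  shows "insertion e f n (face (Suc n) G) c as = cyclic_sum (conjugate e f) (G c) as"
proof -
  obtain ts b where as: "as = ts @ [b]" and ts: "length ts = n"
    using len by (cases as rule: rev_cases) auto
  have "insertion e f n (face (Suc n) G) c as =
      (\<Sum>k\<in>UNIV. path_sum (conjugate e f) ts k (\<lambda>ys q. G c (ys @ [conjugate e f q k b])))"
    unfolding as ts[symmetric] insertion_append
  proof (intro sum.cong refl path_sum_cong)
    fix k q and ys :: "'a list" assume "length ys = length ts"
    then show "face (Suc (length ts)) G c (ys @ e q # map_last (\<lambda>a. mA a (f k)) [b]) =
               G c (ys @ [conjugate e f q k b])"
      using mult_at_append_right[of mA ys 0 "[e q, mA b (f k)]"]
      by (simp add: map_last_def conjugate_def A.mult_assoc)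
  qed
  then show ?thesis by (simp add: cyclic_sum_def as)
qed

lemma insertion_form:
  assumes G: "form (Suc m) G" and j: "j < m"
  shows "form m (insertion e f j G)"
  unfolding insertion_def
proof (rule multilinear_map_sum)
  fix k
  let ?g = "\<lambda>a. mA a (f k)"
  let ?I = "\<lambda>c as. path_sum (conjugate e f) (take j as) k (\<lambda>ys q. G c (ys @ e q # map_last ?g (drop j as)))"
  show "form m ?I"
    unfolding multilinear_map_iff_slot_linear slot_linear_def
  proof (intro conjI allI impI)
    fix as :: "'a list" assume len: "length as = m"
    then have "drop j as \<noteq> []" using j by simp
    then show "Vector_Spaces.linear sC (*) (\<lambda>c. ?I c as)"
      using len j
      by (intro linear_path_sum C.vector_space_axioms vector_space_times multilinear_map_linear_left[OF G])
        (simp add: length_map_last)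
  next
    fix c and xs ys :: "'a list" assume len: "length xs + Suc (length ys) = m"
    show "Vector_Spaces.linear sA (*) (\<lambda>x. ?I c (xs @ x # ys))"
    proof (cases "j \<le> length xs")
      case True
      have "Vector_Spaces.linear sA (*) (\<lambda>x. G c (zs @ e q # map_last ?g (drop j xs @ x # ys)))"
        if "length zs = j" for zs q
      proof -
        have "slot_linear sA (*) (length (drop j xs) + Suc (length ys)) (\<lambda>us. G c ((zs @ [e q]) @ us @ []))"
          using multilinear_map_slot_linear[OF G, of c] len that True
          by (intro slot_linear_append) (simp add: algebra_simps)
        from slot_linearD[OF slot_linear_map_last[OF this mult_linear_left]]
        show ?thesis by simp
      qed
      then show ?thesis
        using True by (auto intro!: linear_path_sum A.vector_space_axioms vector_space_times)
    next
      case False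
      then obtain i where i: "j = length xs + Suc i"
        using less_imp_Suc_add[of "length xs" j] by auto
      then have ne: "drop i ys \<noteq> []" using len j by simp
      have "Vector_Spaces.linear sA (*) (\<lambda>x. G c ((us @ x # vs) @ e q # map_last ?g (drop i ys)))"
        if "length us = length xs" "length vs = length (take i ys)" for us vs q
        using multilinear_map_slot[OF G, of us "vs @ e q # map_last ?g (drop i ys)"] that len ne i j
        by (simp add: length_map_last)
      then show ?thesis
        unfolding i using linear_path_sum_slot[where w = "conjugate e f" and \<Phi> = "\<lambda>ys' q. G c (ys' @ e q # map_last ?g (drop i ys))",
            OF A.vector_space_axioms vector_space_times linear_conjugate]
        by simp
    qed
  qed
qed (rule A.vector_space_axioms C.vector_space_axioms vector_space_times)+

lemma homotopy_form:
  assumes "form (Suc n) G"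
  shows "form n (homotopy e f n G)"
  unfolding homotopy_def using assms
  by (intro multilinear_map_sum multilinear_map_compose[OF insertion_form linear_times_const]
      A.vector_space_axioms C.vector_space_axioms vector_space_times) auto

text \<open>
  Conjugation by a partition of one is homotopic to the identity. In degree \<open>0\<close> there is no
  cochain of lower degree, hence the case distinction.
\<close>

theorem homotopy_formula:
  assumes G: "form (Suc n) G" and len: "length as = Suc n"
  shows "homotopy e f (Suc n) (differential n G) c as +
           (if n = 0 then 0 else differential (n - 1) (homotopy e f n G) c as) =
         G c as - cyclic_sum (conjugate e f) (G c) as"
proof -
  have "homotopy e f (Suc n) (differential n G) c as =
      (\<Sum>j\<le>n. (- 1) ^ j * (\<Sum>i\<le>Suc n. (- 1) ^ i * insertion e f j (face i G) c as))"
    unfolding homotopy_def differential_def insertion_sum by (simp add: lessThan_Suc_atMost)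
  moreover have "(if n = 0 then 0 else differential (n - 1) (homotopy e f n G) c as) =
      (\<Sum>i\<le>n. (- 1) ^ i * (\<Sum>j<n. (- 1) ^ j * face i (insertion e f j G) c as))"
    unfolding homotopy_def differential_def face_sum by simp
  moreover have "insertion e f j (face i G) c as = face (i - 1) (insertion e f j G) c as"
    if "Suc j < i" "i \<le> Suc n" for i j
    using that by (rule insertion_face_above[OF len])
  ultimately show ?thesis
    using alternating_homotopy_sum[where X = "\<lambda>i j. insertion e f j (face i G) c as"
        and Y = "\<lambda>i j. face i (insertion e f j G) c as" and n = n]
      insertion_face_below[OF G len] insertion_face_diagonal[OF G len]
      insertion_first_face[OF G len] insertion_last_face[OF len, of G]
    by simp
qed

end

end


section \<open>From tensors to forms\<close>

lemma linear_on_add: "linear_on sV S sW T f \<Longrightarrow> x \<in> S \<Longrightarrow> y \<in> S \<Longrightarrow> f (x + y) = f x + f y"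
  and linear_on_scale: "linear_on sV S sW T f \<Longrightarrow> x \<in> S \<Longrightarrow> f (sV k x) = sW k (f x)"
  and linear_on_in: "linear_on sV S sW T f \<Longrightarrow> x \<in> S \<Longrightarrow> f x \<in> T"
  by (simp_all add: linear_on_def)

lemma linear_mapsD: "f \<in> linear_maps sV S sW T \<Longrightarrow> linear_on sV S sW T f"
  by (simp add: linear_maps_def)

lemma linear_on_zero:
  assumes "vector_space sV" "vector_space sW" "module.subspace sV S" "linear_on sV S sW T f"
  shows "f 0 = 0"
proof -
  interpret V: vector_space sV by fact
  interpret W: vector_space sW by fact
  show ?thesis
    using linear_on_scale[OF assms(4) V.subspace_0[OF assms(3)], of 0] by simp
qed

lemma linear_on_sum_list:
  assumes "vector_space sV" "vector_space sW" "module.subspace sV S" "linear_on sV S sW T f"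
    and "\<And>z. z \<in> set zs \<Longrightarrow> g z \<in> S"
  shows "(\<Sum>z\<leftarrow>zs. g z) \<in> S \<and> f (\<Sum>z\<leftarrow>zs. g z) = (\<Sum>z\<leftarrow>zs. f (g z))"
proof -
  interpret V: vector_space sV by fact
  show ?thesis
    using assms(5)
    by (induction zs) (auto simp: linear_on_zero[OF assms(1-4)] linear_on_add[OF assms(4)]
        V.subspace_0[OF assms(3)] V.subspace_add[OF assms(3)])
qed

lemma linear_on_sum:
  assumes "vector_space sV" "vector_space sW" "module.subspace sV S" "linear_on sV S sW T f"
    and "\<And>i. i \<in> I \<Longrightarrow> g i \<in> S"
  shows "f (\<Sum>i\<in>I. g i) = (\<Sum>i\<in>I. f (g i))"
proof -
  interpret V: vector_space sV by fact
  have "(\<Sum>i\<in>I. g i) \<in> S \<and> f (\<Sum>i\<in>I. g i) = (\<Sum>i\<in>I. f (g i))"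
    using assms(5)
    by (induction I rule: infinite_finite_induct)
      (auto simp: linear_on_zero[OF assms(1-4)] linear_on_add[OF assms(4)]
        V.subspace_0[OF assms(3)] V.subspace_add[OF assms(3)])
  then show ?thesis ..
qed

lemma linear_linear_on_comp:
  assumes "Vector_Spaces.linear s sV h" "\<And>z. h z \<in> S" "linear_on sV S sW T f" "vector_space sW"
  shows "Vector_Spaces.linear s sW (\<lambda>z. f (h z))"
  using assms by (auto simp: Vector_Spaces.linear_iff linear_on_def)

text \<open>
  Universal properties yield maps into a whole function type. The values on generators decide
  whether such a map lands in a smaller subspace, such as another tensor product.
\<close>

lemma linear_on_span_into:
  assumes V: "vector_space sV" and W: "vector_space sW" and T: "module.subspace sW T"
    and f: "linear_on sV (module.span sV S) sW U f" and gen: "\<And>x. x \<in> S \<Longrightarrow> f x \<in> T"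
  shows "linear_on sV (module.span sV S) sW T f"
proof -
  interpret V: vector_space sV by fact
  interpret W: vector_space sW by fact
  have "t \<in> V.span S \<and> f t \<in> T" if "t \<in> V.span S" for t
    using that
  proof (induction rule: V.span_induct_alt)
    case base
    show ?case
      using linear_on_zero[OF V W V.subspace_span f] W.subspace_0[OF T] by (simp add: V.span_zero)
  next
    case (step c x y)
    have "x \<in> V.span S" "sV c x \<in> V.span S"
      using step.hyps by (auto intro: V.span_base V.span_scale)
    then show ?case
      using step gen by (auto simp: linear_on_add[OF f] linear_on_scale[OF f] V.span_add
          intro!: W.subspace_add[OF T] W.subspace_scale[OF T])
  qed
  then show ?thesis using f by (simp add: linear_on_def)
qed

lemma linear_sum_list_family:
  assumes "vector_space s" "vector_space t" and "\<And>z. z \<in> set zs \<Longrightarrow> Vector_Spaces.linear s t (f z)"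
  shows "Vector_Spaces.linear s t (\<lambda>x. \<Sum>z\<leftarrow>zs. f z x)"
proof -
  have "Vector_Spaces.linear s t (\<lambda>x. \<Sum>i\<in>{0..<length zs}. f (zs ! i) x)"
    using assms by (intro linear_sum_family) auto
  then show ?thesis by (simp add: sum_list_sum_nth)
qed

lemma tensor_bilinear:
  assumes "vector_space sM" "vector_space sN"
  shows "bilinear_map sM sN fscale (tensor sM sN)"
  using assms vector_space_fscale
  by (auto simp: bilinear_map_def Vector_Spaces.linear_iff tensor_def eval_at_def fscale_def fun_eq_iff)

interpretation fs: vector_space "fscale :: 'k::field \<Rightarrow> ('x \<Rightarrow> 'k) \<Rightarrow> ('x \<Rightarrow> 'k)"
  by (rule vector_space_fscale)

lemma tensor_in_space: "tensor sM sN x y \<in> tensor_space sM sN"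
  unfolding tensor_space_def by (rule fs.span_base) blast

lemma subspace_tensor_space: "module.subspace fscale (tensor_space sM sN)"
  unfolding tensor_space_def by (rule fs.subspace_span)

lemma tensor_lift_linear:
  assumes "vector_space sV" "bilinear_map sM sN sV f"
  shows "linear_on fscale (tensor_space sM sN) sV UNIV (tensor_lift sM sN sV f)"
    and "tensor_lift sM sN sV f (tensor sM sN x y) = f x y"
  using theI'[OF tensor_lift_unique_existence[OF assms]]
  by (simp_all add: tensor_lift_def linear_maps_def)

lemma tensor_lift_linear_maps:
  assumes "vector_space sV" "bilinear_map sM sN sV f"
  shows "tensor_lift sM sN sV f \<in> linear_maps fscale (tensor_space sM sN) sV UNIV"
  using theI'[OF tensor_lift_unique_existence[OF assms]] by (simp add: tensor_lift_def)

text \<open>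
  Scalars are absorbed into the left factor.
\<close>

lemma tensor_space_sum_list:
  fixes sM :: "'k::field \<Rightarrow> 'm::ab_group_add \<Rightarrow> 'm"
  assumes M: "vector_space sM" and N: "vector_space sN" and t: "t \<in> tensor_space sM sN"
  shows "\<exists>zs. t = (\<Sum>(x, y)\<leftarrow>zs. tensor sM sN x y)"
  using t unfolding tensor_space_def
proof (induction rule: fs.span_induct_alt)
  case base
  show ?case by (rule exI[of _ "[]"]) simp
next
  case (step c t u)
  then obtain x y zs where "t = tensor sM sN x y" "u = (\<Sum>(x, y)\<leftarrow>zs. tensor sM sN x y)"
    by auto
  moreover have "fscale c (tensor sM sN x y) = tensor sM sN (sM c x) y"
    using bilinear_map_left[OF tensor_bilinear[OF M N]] by (simp add: Vector_Spaces.linear_iff)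
  ultimately show ?case
    by (intro exI[of _ "(sM c x, y) # zs"]) simp
qed

text \<open>
  Sweedler notation made literal: a representation \<open>t = \<Sum> x\<^sub>i \<otimes> y\<^sub>i\<close> is chosen, and \<open>f\<close> is summed over
  it. For bilinear \<open>f\<close> this is the value of the induced linear map, but it makes sense, and is
  linear in \<open>f\<close>, for every \<open>f\<close>.
\<close>

definition sweedler_sum ::
  "('k::field \<Rightarrow> 'm::ab_group_add \<Rightarrow> 'm) \<Rightarrow> ('k \<Rightarrow> 'n::ab_group_add \<Rightarrow> 'n) \<Rightarrow>
   ('m, 'n, 'k) tensor \<Rightarrow> ('m \<Rightarrow> 'n \<Rightarrow> 'v::ab_group_add) \<Rightarrow> 'v" where
  "sweedler_sum sM sN t f =
     (\<Sum>(x, y)\<leftarrow>(SOME zs. t = (\<Sum>(x, y)\<leftarrow>zs. tensor sM sN x y)). f x y)"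

lemma sweedler_sum_tensor:
  assumes "vector_space sM" "vector_space sN" "t \<in> tensor_space sM sN"
  shows "sweedler_sum sM sN t (tensor sM sN) = t"
  using someI_ex[OF tensor_space_sum_list[OF assms]] by (simp add: sweedler_sum_def)

lemma linear_on_sweedler_sum:
  assumes "vector_space sV" "vector_space sW" "module.subspace sV S" "linear_on sV S sW T f"
    and "\<And>x y. g x y \<in> S"
  shows "f (sweedler_sum sM sN t g) = sweedler_sum sM sN t (\<lambda>x y. f (g x y))"
  using linear_on_sum_list[OF assms(1-4), of _ "\<lambda>(x, y). g x y"] assms(5)
  by (simp add: sweedler_sum_def case_prod_unfold)

lemma tensor_lift_sweedler_sum:
  assumes "vector_space sM" "vector_space sN" "vector_space sV"
    and "bilinear_map sM sN sV f" "t \<in> tensor_space sM sN"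
  shows "tensor_lift sM sN sV f t = sweedler_sum sM sN t f"
proof -
  have "tensor_lift sM sN sV f (sweedler_sum sM sN t (tensor sM sN)) = sweedler_sum sM sN t f"
    using linear_on_sweedler_sum[OF vector_space_fscale assms(3) subspace_tensor_space
        tensor_lift_linear(1)[OF assms(3,4)] tensor_in_space, of sM sN t]
    by (simp add: tensor_lift_linear(2)[OF assms(3,4)])
  then show ?thesis by (simp add: sweedler_sum_tensor assms)
qed

lemma sweedler_sum_add:
  "sweedler_sum sM sN t (\<lambda>x y. f x y + g x y) = sweedler_sum sM sN t f + sweedler_sum sM sN t g"
  by (simp add: sweedler_sum_def case_prod_unfold sum_list_addf)

lemma sweedler_sum_sum:
  "sweedler_sum sM sN t (\<lambda>x y. \<Sum>i\<in>I. f i x y) = (\<Sum>i\<in>I. sweedler_sum sM sN t (f i))"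
proof -
  have "sweedler_sum sM sN t (\<lambda>x y. 0) = 0"
    by (simp add: sweedler_sum_def case_prod_unfold)
  then show ?thesis
    by (induction I rule: infinite_finite_induct) (simp_all add: sweedler_sum_add)
qed

lemma sweedler_sum_linear:
  assumes "Vector_Spaces.linear sV sW h"
  shows "h (sweedler_sum sM sN t f) = sweedler_sum sM sN t (\<lambda>x y. h (f x y))"
proof -
  interpret Vector_Spaces.linear sV sW h by fact
  have "h (\<Sum>z\<leftarrow>zs. g z) = (\<Sum>z\<leftarrow>zs. h (g z))" for zs and g :: "'e \<times> 'f \<Rightarrow> 'b"
    by (induction zs) (simp_all add: add)
  then show ?thesis by (simp add: sweedler_sum_def case_prod_unfold)
qed

lemma linear_sweedler_sum:
  assumes "vector_space s" "vector_space sV" "\<And>x y. Vector_Spaces.linear s sV (\<lambda>z. f z x y)"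
  shows "Vector_Spaces.linear s sV (\<lambda>z. sweedler_sum sM sN t (f z))"
  unfolding sweedler_sum_def
  using assms(3) by (intro linear_sum_list_family assms(1,2)) (auto simp: case_prod_unfold)

lemma mtensor_multilinear:
  assumes "vector_space sC" "vector_space sA"
  shows "multilinear_map sC sA m fscale (mtensor sC sA m)"
  using assms vector_space_fscale
  by (auto simp: multilinear_map_def Vector_Spaces.linear_iff mtensor_def eval_at_def fscale_def fun_eq_iff)

lemma mtensor_in_space: "length as = m \<Longrightarrow> mtensor sC sA m c as \<in> mtensor_space sC sA m"
  unfolding mtensor_space_def by (rule fs.span_base) blast

lemma subspace_mtensor_space: "module.subspace fscale (mtensor_space sC sA m)"
  unfolding mtensor_space_def by (rule fs.subspace_span)

lemma mtensor_lift_linear_maps: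
  assumes "vector_space sV" "multilinear_map sC sA m sV f"
  shows "mtensor_lift sC sA m sV f \<in> linear_maps fscale (mtensor_space sC sA m) sV UNIV"
    and "length as = m \<Longrightarrow> mtensor_lift sC sA m sV f (mtensor sC sA m c as) = f c as"
  using theI'[OF mtensor_lift_unique_existence[OF assms]]
  by (simp_all add: mtensor_lift_def)

lemma mtensor_lift_cong:
  assumes "\<And>c as. length as = m \<Longrightarrow> f c as = g c as"
  shows "mtensor_lift sC sA m sV f = mtensor_lift sC sA m sV g"
proof -
  have "(\<forall>c as. length as = m \<longrightarrow> F (mtensor sC sA m c as) = f c as) \<longleftrightarrow>
        (\<forall>c as. length as = m \<longrightarrow> F (mtensor sC sA m c as) = g c as)" for F
    using assms by auto
  then show ?thesis by (simp add: mtensor_lift_def)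
qed

lemma mtensor_space_eqI:
  assumes V: "vector_space sV"
    and f: "linear_on fscale (mtensor_space sC sA m) sV T f"
    and g: "linear_on fscale (mtensor_space sC sA m) sV T g"
    and eq: "\<And>c as. length as = m \<Longrightarrow> f (mtensor sC sA m c as) = g (mtensor sC sA m c as)"
    and t: "t \<in> mtensor_space sC sA m"
  shows "f t = g t"
  using linear_on_span_eq[OF vector_space_fscale V f[unfolded mtensor_space_def]
      g[unfolded mtensor_space_def] _ t[unfolded mtensor_space_def]] eq
  by blast

lemma mtensor_linear_maps_eqI:
  assumes V: "vector_space sV"
    and f: "f \<in> linear_maps fscale (mtensor_space sC sA m) sV T"
    and g: "g \<in> linear_maps fscale (mtensor_space sC sA m) sV T"
    and eq: "\<And>c as. length as = m \<Longrightarrow> f (mtensor sC sA m c as) = g (mtensor sC sA m c as)"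
  shows "f = g"
proof
  fix t show "f t = g t"
    using mtensor_space_eqI[OF V f[THEN linear_mapsD] g[THEN linear_mapsD] eq] f g
    by (cases "t \<in> mtensor_space sC sA m") (auto simp: linear_maps_def)
qed

text \<open>
  One direction of the universal property; the other is \<open>mtensor_lift_linear_maps\<close>.
\<close>

lemma multilinear_map_mtensor:
  assumes vs: "vector_space sC" "vector_space sA" "vector_space sV"
    and g: "linear_on fscale (mtensor_space sC sA m) sV T g"
  shows "multilinear_map sC sA m sV (\<lambda>c as. g (mtensor sC sA m c as))"
proof -
  note mt = mtensor_multilinear[OF vs(1,2), of m]
  show ?thesis
    unfolding multilinear_map_iff_slot_linear slot_linear_def
    using linear_linear_on_comp[OF multilinear_map_linear_left[OF mt] _ g vs(3)]
      linear_linear_on_comp[OF multilinear_map_slot[OF mt] _ g vs(3)]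
    by (simp add: mtensor_in_space)
qed


section \<open>The Hochschild complex in terms of forms\<close>

text \<open>
  These two are mutually inverse bijections between cochains of degree \<open>n\<close> and multilinear forms
  on \<open>C \<times> A\<^sup>n\<^sup>+\<^sup>1\<close>, the latter considered on lists of length \<open>n + 1\<close> only.
\<close>

abbreviation cochain_form ::
  "('k::field \<Rightarrow> 'a::ab_group_add \<Rightarrow> 'a) \<Rightarrow> ('k \<Rightarrow> 'c::ab_group_add \<Rightarrow> 'c) \<Rightarrow> nat \<Rightarrow>
   (('c, 'a list, 'k) tensor \<Rightarrow> 'k) \<Rightarrow> 'c \<Rightarrow> 'a list \<Rightarrow> 'k" where
  "cochain_form sA sC n g c as \<equiv> g (mtensor sC sA (Suc n) c as)"

abbreviation cochain_of_form ::
  "('k::field \<Rightarrow> 'a::ab_group_add \<Rightarrow> 'a) \<Rightarrow> ('k \<Rightarrow> 'c::ab_group_add \<Rightarrow> 'c) \<Rightarrow> nat \<Rightarrow>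
   ('c \<Rightarrow> 'a list \<Rightarrow> 'k) \<Rightarrow> (('c, 'a list, 'k) tensor \<Rightarrow> 'k)" where
  "cochain_of_form sA sC n \<equiv> mtensor_lift sC sA (Suc n) (*)"

lemma cochains_subspace:
  "module.subspace fscale (hochschild_cochains sA sC n)"
  unfolding hochschild_cochains_def fs.subspace_def
  by (auto simp: linear_maps_def linear_on_def fscale_def algebra_simps)

lemma cochain_eqI:
  assumes "f \<in> hochschild_cochains sA sC n" "g \<in> hochschild_cochains sA sC n"
    and "\<And>c as. length as = Suc n \<Longrightarrow> cochain_form sA sC n f c as = cochain_form sA sC n g c as"
  shows "f = g"
  using mtensor_linear_maps_eqI[OF vector_space_times] assms
  by (fastforce simp: hochschild_cochains_def)

lemma cochain_form_multilinear:
  assumes "vector_space sA" "vector_space sC" "g \<in> hochschild_cochains sA sC n"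
  shows "multilinear_map sC sA (Suc n) (*) (cochain_form sA sC n g)"
  using multilinear_map_mtensor[OF assms(2,1) vector_space_times linear_mapsD] assms(3)
  by (simp add: hochschild_cochains_def)

lemma cochain_of_form:
  assumes "multilinear_map sC sA (Suc n) (*) G"
  shows "cochain_of_form sA sC n G \<in> hochschild_cochains sA sC n"
    and "length as = Suc n \<Longrightarrow> cochain_form sA sC n (cochain_of_form sA sC n G) c as = G c as"
  using mtensor_lift_linear_maps[OF vector_space_times assms]
  by (simp_all add: hochschild_cochains_def)

text \<open>
  Both complexes of the theorem are instances, so that the translation between cochains and
  forms is done once.
\<close>

locale entwined_complex = entwined_algebra sA mA uA sC ent
  for sA :: "'k::field \<Rightarrow> 'a::ab_group_add \<Rightarrow> 'a" and mA and uA
    and sC :: "'k \<Rightarrow> 'c::ab_group_add \<Rightarrow> 'c" and ent +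
  fixes \<psi> :: "('c, 'a, 'k) tensor \<Rightarrow> ('a, 'c, 'k) tensor"
  assumes tensor_lift_psi: "bilinear_map sA sC (*) F \<Longrightarrow>
      tensor_lift sA sC (*) F (\<psi> (tensor sC sA c a)) = ent c a F"
begin

abbreviation "X \<equiv> hochschild_cochains sA sC"
abbreviation "\<delta> \<equiv> hochschild_diff sA mA sC \<psi>"
abbreviation "form_of \<equiv> cochain_form sA sC"

lemma form_of_form: "g \<in> X n \<Longrightarrow> form (Suc n) (form_of n g)"
  by (rule cochain_form_multilinear[OF A.vector_space_axioms C.vector_space_axioms])

lemma hochschild_diff_eq:
  assumes g: "g \<in> X n"
  shows "\<delta> n g = cochain_of_form sA sC (Suc n) (differential n (form_of n g))"
proof -
  let ?G = "form_of n g"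
  have "tensor_lift sA sC (*)
            (\<lambda>x d. g (mtensor sC sA (n + 1) d (butlast (tl as) @ [mA (last as) x])))
            (\<psi> (tensor sC sA c (hd as))) +
          (\<Sum>i = 1..n + 1. (- 1) ^ i *
             g (mtensor sC sA (n + 1) c
                  (take (i - 1) as @ [mA (as ! (i - 1)) (as ! i)] @ drop (i + 1) as))) =
        differential n ?G c as" if len: "length as = n + 2" for c as
  proof -
    have tl: "length (tl as) = Suc n" "tl as \<noteq> []" using len by (cases as; auto)+
    then have "butlast (tl as) @ [mA (last as) x] = map_last (\<lambda>a. mA a x) (tl as)" for x
      by (simp add: map_last_def last_tl)
    then have "tensor_lift sA sC (*)
            (\<lambda>x d. g (mtensor sC sA (n + 1) d (butlast (tl as) @ [mA (last as) x])))
            (\<psi> (tensor sC sA c (hd as))) = face 0 ?G c as"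
      using tensor_lift_psi[OF bilinear_map_last[OF form_of_form[OF g] tl]] by simp
    moreover have "(\<Sum>i = 1..n + 1. (- 1) ^ i *
             g (mtensor sC sA (n + 1) c
                  (take (i - 1) as @ [mA (as ! (i - 1)) (as ! i)] @ drop (i + 1) as))) =
          (\<Sum>i = 1..Suc n. (- 1) ^ i * face i ?G c as)"
    proof (intro sum.cong)
      fix i assume "i \<in> {1..Suc n}"
      then obtain j where "i = Suc j" "Suc j < length as" using len by (cases i) auto
      then show "(- 1) ^ i * g (mtensor sC sA (n + 1) c
                  (take (i - 1) as @ [mA (as ! (i - 1)) (as ! i)] @ drop (i + 1) as)) =
            (- 1) ^ i * face i ?G c as"
        by (simp add: mult_at_conv_take_drop)
    qed simp
    moreover have "{..Suc n} = insert 0 {1..Suc n}" by auto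
    ultimately show ?thesis by (simp add: differential_def)
  qed
  then show ?thesis
    unfolding hochschild_diff_def by (subst mtensor_lift_cong) simp_all
qed

lemma hochschild_diff_cochain:
  assumes "g \<in> X n"
  shows "\<delta> n g \<in> X (Suc n)"
    and "length as = Suc (Suc n) \<Longrightarrow> form_of (Suc n) (\<delta> n g) c as = differential n (form_of n g) c as"
  using cochain_of_form[OF differential_form[OF form_of_form[OF assms]]]
  by (simp_all add: hochschild_diff_eq[OF assms])

lemma differential_linear:
  "differential n (\<lambda>c as. G c as + H c as) c as = differential n G c as + differential n H c as"
  "differential n (\<lambda>c as. k * G c as) c as = k * differential n G c as"
proof -
  have "face i (\<lambda>c as. G c as + H c as) c as = face i G c as + face i H c as" for i
    by (cases i) (simp_all add: ent_add)
  then show "differential n (\<lambda>c as. G c as + H c as) c as = differential n G c as + differential n H c as"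
    by (simp add: differential_def distrib_left sum.distrib del: sum.atMost_Suc)
  have "face i (\<lambda>c as. k * G c as) c as = k * face i G c as" for i
    by (cases i) (simp_all add: ent_scale)
  then show "differential n (\<lambda>c as. k * G c as) c as = k * differential n G c as"
    by (simp add: differential_def sum_distrib_left mult.left_commute del: sum.atMost_Suc)
qed

text \<open>
  Maps between spaces of cochains are compared through their forms.
\<close>

lemma linear_on_cochainsI:
  assumes T: "\<And>g. g \<in> Y \<Longrightarrow> F g \<in> X m"
    and Y: "module.subspace fscale Y"
    and add: "\<And>g h c as. g \<in> Y \<Longrightarrow> h \<in> Y \<Longrightarrow> length as = Suc m \<Longrightarrow>
        form_of m (F (g + h)) c as = form_of m (F g) c as + form_of m (F h) c as"
    and scale: "\<And>g k c as. g \<in> Y \<Longrightarrow> length as = Suc m \<Longrightarrow>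
        form_of m (F (fscale k g)) c as = k * form_of m (F g) c as"
  shows "linear_on fscale Y fscale (X m) F"
  unfolding linear_on_def
proof (intro conjI ballI allI)
  fix g h assume "g \<in> Y" "h \<in> Y"
  then show "F (g + h) = F g + F h"
    using add by (intro cochain_eqI[OF T fs.subspace_add[OF cochains_subspace T T]])
      (auto intro: fs.subspace_add[OF Y])
next
  fix k g assume "g \<in> Y"
  then show "F (fscale k g) = fscale k (F g)"
    using scale by (intro cochain_eqI[OF T fs.subspace_scale[OF cochains_subspace T]])
      (auto intro: fs.subspace_scale[OF Y, unfolded fscale_def] simp: fscale_def)
qed (rule T)

lemma hochschild_complex: "cochain_complex fscale X \<delta>"
  unfolding cochain_complex_def
proof (intro conjI allI ballI)
  fix n
  show "linear_on fscale (X n) fscale (X (Suc n)) (\<delta> n)"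
    by (rule linear_on_cochainsI)
      (simp_all add: hochschild_diff_cochain cochains_subspace differential_linear fscale_def
        fs.subspace_add[OF cochains_subspace] fs.subspace_scale[OF cochains_subspace, unfolded fscale_def])
next
  fix n g assume g: "g \<in> X n"
  show "\<delta> (Suc n) (\<delta> n g) = 0"
  proof (rule cochain_eqI)
    fix c and as :: "'a list" assume "length as = Suc (Suc (Suc n))"
    then show "form_of (Suc (Suc n)) (\<delta> (Suc n) (\<delta> n g)) c as = form_of (Suc (Suc n)) 0 c as"
      using differential_cong[OF hochschild_diff_cochain(2)[OF g]]
        differential_differential[OF form_of_form[OF g]]
      by (simp add: hochschild_diff_cochain g)
  qed (simp_all add: hochschild_diff_cochain g fs.subspace_0[OF cochains_subspace])
qed (simp_all add: vector_space_fscale cochains_subspace)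

end


section \<open>Matrices over an entwined algebra\<close>

definition mat_one :: "'a::zero \<Rightarrow> 'a^'r^'r" where
  "mat_one u = (\<chi> i j. if i = j then u else 0)"

text \<open>
  The functional of the entwining \<open>c \<otimes> E\<^sub>i\<^sub>j(a) \<mapsto> E\<^sub>i\<^sub>j(a\<^sub>\<psi>) \<otimes> c\<^sup>\<psi>\<close>, extended additively to
  \<open>U = \<Sum> E\<^sub>i\<^sub>j(U\<^sub>i\<^sub>j)\<close>.
\<close>

definition mat_ent ::
  "('c \<Rightarrow> 'a::ab_group_add \<Rightarrow> ('a \<Rightarrow> 'c \<Rightarrow> 'k::field) \<Rightarrow> 'k) \<Rightarrow>
   'c \<Rightarrow> 'a^'r::finite^'r \<Rightarrow> ('a^'r^'r \<Rightarrow> 'c \<Rightarrow> 'k) \<Rightarrow> 'k" where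
  "mat_ent ent c U F = (\<Sum>i\<in>UNIV. \<Sum>j\<in>UNIV. ent c (U $ i $ j) (\<lambda>x d. F (mat_elem i j x) d))"

lemma vector_space_mat_scale:
  assumes "vector_space sA" shows "vector_space (mat_scale sA)"
proof -
  interpret vector_space sA by fact
  show ?thesis
    by unfold_locales (simp_all add: mat_scale_def vec_eq_iff scale_right_distrib scale_left_distrib)
qed

lemma linear_mat_elem:
  assumes "vector_space sA" shows "Vector_Spaces.linear sA (mat_scale sA) (mat_elem i j)"
proof -
  interpret vector_space sA by fact
  show ?thesis
    using assms vector_space_mat_scale[OF assms]
    by (auto simp: Vector_Spaces.linear_iff mat_scale_def mat_elem_def vec_eq_iff)
qed

lemma linear_mat_entry:
  assumes "vector_space sA" shows "Vector_Spaces.linear (mat_scale sA) sA (\<lambda>U. U $ i $ j)"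
  using assms vector_space_mat_scale[OF assms]
  by (auto simp: Vector_Spaces.linear_iff mat_scale_def)

lemma linear_mat_pure:
  assumes "vector_space sA" shows "Vector_Spaces.linear sA (mat_scale sA) (\<lambda>x. mat_pure sA x u)"
proof -
  interpret vector_space sA by fact
  show ?thesis
    using assms vector_space_mat_scale[OF assms]
    by (auto simp: Vector_Spaces.linear_iff mat_scale_def mat_pure_def vec_eq_iff
        scale_right_distrib mult.commute)
qed

lemma sum_if_eq_pair:
  fixes i :: "'a::finite" and j :: "'b::finite"
  shows "(\<Sum>p\<in>UNIV. \<Sum>q\<in>UNIV. if i = p \<and> j = q then f p q else 0) = f i j"
    and "(\<Sum>p\<in>UNIV. \<Sum>q\<in>UNIV. if p = i \<and> q = j then f p q else 0) = f i j"
proof -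
  have "(\<Sum>q\<in>UNIV. if i = p \<and> j = q then f p q else 0) = (if i = p then f p j else 0)" for p
    by (cases "i = p") simp_all
  then show "(\<Sum>p\<in>UNIV. \<Sum>q\<in>UNIV. if i = p \<and> j = q then f p q else 0) = f i j" by simp
  then show "(\<Sum>p\<in>UNIV. \<Sum>q\<in>UNIV. if p = i \<and> q = j then f p q else 0) = f i j"
    by (simp add: eq_commute)
qed

lemma sum_mat_elem_entries:
  "(\<Sum>i\<in>UNIV. \<Sum>j\<in>UNIV. mat_elem i j (U $ i $ j)) = (U :: 'a::ab_group_add^'r::finite^'r)"
  by (simp add: vec_eq_iff sum_component mat_elem_def sum_if_eq_pair)

lemma mat_elem_entry: "mat_elem p q x $ i $ j = (if i = p \<and> j = q then x else 0)"
  by (simp add: mat_elem_def)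

lemma sum_mat_elem_diagonal: "(\<Sum>k\<in>UNIV. mat_elem k k u) = (mat_one u :: 'a::ab_group_add^'r::finite^'r)"
proof -
  have "(\<Sum>k\<in>UNIV. if i = k \<and> j = k then u else 0) = (if i = j then u else 0)" for i j :: 'r
    by (cases "i = j") (auto intro: sum.neutral)
  then show ?thesis by (simp add: vec_eq_iff sum_component mat_elem_entry mat_one_def)
qed

lemma mat_elem_eq_mat_pure:
  assumes "vector_space sA"
  shows "mat_elem i j x = mat_pure sA x (mat_elem i j 1)"
proof -
  interpret vector_space sA by fact
  show ?thesis by (auto simp: mat_elem_def mat_pure_def vec_eq_iff)
qed

lemma mat_pure_eq_sum:
  assumes "vector_space sA"
  shows "mat_pure sA x u = (\<Sum>i\<in>UNIV. \<Sum>j\<in>UNIV. mat_elem i j (sA (u $ i $ j) x))"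
  using sum_mat_elem_entries[of "mat_pure sA x u"] by (simp add: mat_pure_def)

context unital_algebra
begin

lemma mult_zero: "mA 0 x = 0" "mA x 0 = 0"
  using mult_bilinear unfolding bilinear_map_def by (auto dest: linear_imp_zero)

lemma mult_sum: "mA (\<Sum>i\<in>I. g i) x = (\<Sum>i\<in>I. mA (g i) x)" "mA x (\<Sum>i\<in>I. g i) = (\<Sum>i\<in>I. mA x (g i))"
  using mult_bilinear unfolding bilinear_map_def by (auto intro: linear_imp_sum)

lemma mat_mult_mat_elem: "(mat_mult mA U (mat_elem i j x)) $ p $ q = (if q = j then mA (U $ p $ i) x else 0)"
  by (simp add: mat_mult_def mat_elem_def if_distrib[of "mA _"] mult_zero cong: if_cong)

lemma mat_elem_mat_mult: "(mat_mult mA (mat_elem i j x) U) $ p $ q = (if p = i then mA x (U $ j $ q) else 0)"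
  by (simp add: mat_mult_def mat_elem_def if_distrib[of "\<lambda>y. mA y _"] mult_zero cong: if_cong)

lemma mat_elem_mult_mat_elem:
  "mat_mult mA (mat_elem i l x) (mat_elem m j y) = (if m = l then mat_elem i j (mA x y) else 0)"
  by (auto simp: vec_eq_iff mat_mult_mat_elem) (auto simp: mat_elem_def mult_zero)

lemma unital_algebra_mat: "unital_algebra (mat_scale scale) (mat_mult mA) (mat_one uA :: 'a^'r::finite^'r)"
proof (intro unital_algebra.intro vector_space_mat_scale vector_space_axioms unital_algebra_axioms.intro)
  have add: "mA (x + y) z = mA x z + mA y z" "mA z (x + y) = mA z x + mA z y"
    and scale: "mA (scale k x) z = scale k (mA x z)" "mA z (scale k x) = scale k (mA z x)" for x y z k
    using mult_bilinear by (auto simp: bilinear_map_def Vector_Spaces.linear_iff)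
  show "bilinear_map (mat_scale scale) (mat_scale scale) (mat_scale scale)
          (mat_mult mA :: 'a^'r^'r \<Rightarrow> _)"
    using vector_space_mat_scale[OF vector_space_axioms]
    by (auto simp: bilinear_map_def Vector_Spaces.linear_iff mat_mult_def mat_scale_def vec_eq_iff
        add scale sum.distrib scale_sum_right)
  show "mat_mult mA (mat_mult mA x y) z = mat_mult mA x (mat_mult mA y z)" for x y z :: "'a^'r^'r"
  proof -
    have "(\<Sum>l\<in>UNIV. mA (\<Sum>h\<in>UNIV. mA (x $ i $ h) (y $ h $ l)) (z $ l $ j)) =
          (\<Sum>h\<in>UNIV. mA (x $ i $ h) (\<Sum>l\<in>UNIV. mA (y $ h $ l) (z $ l $ j)))" for i j
      unfolding mult_sum by (subst sum.swap) (simp add: mult_assoc)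
    then show ?thesis by (simp add: mat_mult_def vec_eq_iff)
  qed
  show "mat_mult mA (mat_one uA) x = x" "mat_mult mA x (mat_one uA) = x" for x :: "'a^'r^'r"
    by (simp_all add: vec_eq_iff mat_mult_def mat_one_def if_distrib[of "mA _"]
        if_distrib[of "\<lambda>y. mA y _"] mult_zero mult_one_left mult_one_right cong: if_cong)
qed

end

context entwined_algebra
begin

lemma bilinear_map_mat_elem:
  assumes "bilinear_map (mat_scale sA) sC (*) F"
  shows "bilinear_map sA sC (*) (\<lambda>x d. F (mat_elem i j x) d)"
  using linear_comp[OF linear_mat_elem[OF A.vector_space_axioms] bilinear_map_left[OF assms]]
    bilinear_map_right[OF assms]
  by (simp add: bilinear_map_def)

lemma ent_algebra_zero: "bilinear_map sA sC (*) F \<Longrightarrow> ent c 0 F = 0"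
  by (rule linear_imp_zero[OF ent_linear_right])

lemma mat_ent_mat_elem:
  assumes F: "bilinear_map (mat_scale sA) sC (*) F"
  shows "mat_ent ent c (mat_elem p q z) F = ent c z (\<lambda>x d. F (mat_elem p q x) d)"
proof -
  have "ent c (mat_elem p q z $ i $ j) (\<lambda>x d. F (mat_elem i j x) d) =
        (if i = p \<and> j = q then ent c z (\<lambda>x d. F (mat_elem i j x) d) else 0)" for i j
    using ent_algebra_zero[OF bilinear_map_mat_elem[OF F]] by (simp add: mat_elem_def)
  then show ?thesis by (simp add: mat_ent_def sum_if_eq_pair)
qed

text \<open>
  On the right hand side the product \<open>E\<^sub>i\<^sub>l(x) E\<^sub>m\<^sub>j(y)\<close> vanishes unless \<open>l = m\<close>, which leaves the sum
  over \<open>l\<close> in the entries of \<open>U V\<close>.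
\<close>

lemma mat_ent_mult:
  fixes F :: "'a^'r::finite^'r \<Rightarrow> 'c \<Rightarrow> 'k"
  assumes F: "bilinear_map (mat_scale sA) sC (*) F"
  shows "mat_ent ent c (mat_mult mA U V) F =
         mat_ent ent c U (\<lambda>X d. mat_ent ent d V (\<lambda>Y e. F (mat_mult mA X Y) e))"
proof -
  note F' = bilinear_map_mat_elem[OF F]
  have F0: "F 0 = (\<lambda>e. 0)"
    using linear_imp_zero[OF bilinear_map_left[OF F]] by auto
  \<comment> \<open>The terms with \<open>m \<noteq> l\<close> are \<open>ent\<close> of the zero form.\<close>
  have inner: "mat_ent ent d V (\<lambda>Y e. F (mat_mult mA (mat_elem i l x) Y) e) =
      (\<Sum>j\<in>UNIV. ent d (V $ l $ j) (\<lambda>y e. F (mat_elem i j (mA x y)) e))" for d i l x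
  proof -
    have "mat_ent ent d V (\<lambda>Y e. F (mat_mult mA (mat_elem i l x) Y) e) =
      (\<Sum>m\<in>UNIV. if m = l then \<Sum>j\<in>UNIV. ent d (V $ m $ j) (\<lambda>y e. F (mat_elem i j (mA x y)) e) else 0)"
      unfolding mat_ent_def A.mat_elem_mult_mat_elem
      by (intro sum.cong refl) (simp add: F0 ent_zero)
    then show ?thesis by simp
  qed
  have "mat_ent ent c (mat_mult mA U V) F =
      (\<Sum>i\<in>UNIV. \<Sum>j\<in>UNIV. \<Sum>l\<in>UNIV. ent c (mA (U $ i $ l) (V $ l $ j)) (\<lambda>x d. F (mat_elem i j x) d))"
    by (simp add: mat_ent_def mat_mult_def linear_imp_sum[OF ent_linear_right[OF F']])
  also have "\<dots> = (\<Sum>i\<in>UNIV. \<Sum>l\<in>UNIV. \<Sum>j\<in>UNIV. ent c (U $ i $ l)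
      (\<lambda>x d. ent d (V $ l $ j) (\<lambda>y e. F (mat_elem i j (mA x y)) e)))"
    unfolding ent_mult[OF F'] by (intro sum.cong refl sum.swap)
  also have "\<dots> = mat_ent ent c U (\<lambda>X d. mat_ent ent d V (\<lambda>Y e. F (mat_mult mA X Y) e))"
    unfolding mat_ent_def[of ent c U] inner by (simp add: ent_sum)
  finally show ?thesis .
qed

lemma entwined_algebra_mat:
  "entwined_algebra (mat_scale sA) (mat_mult mA) (mat_one uA :: 'a^'r::finite^'r) sC (mat_ent ent)"
proof (intro entwined_algebra.intro A.unital_algebra_mat C.vector_space_axioms entwined_algebra_axioms.intro)
  fix c :: 'c and U V :: "'a^'r^'r" and F G :: "'a^'r^'r \<Rightarrow> 'c \<Rightarrow> 'k" and k :: 'k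
  show "mat_ent ent c U (\<lambda>x d. F x d + G x d) = mat_ent ent c U F + mat_ent ent c U G"
    by (simp add: mat_ent_def ent_add sum.distrib)
  show "mat_ent ent c U (\<lambda>x d. k * F x d) = k * mat_ent ent c U F"
    by (simp add: mat_ent_def ent_scale sum_distrib_left)
  assume F: "bilinear_map (mat_scale sA) sC (*) F"
  note F' = bilinear_map_mat_elem[OF F]
  show "Vector_Spaces.linear sC (*) (\<lambda>c. mat_ent ent c U F)"
    unfolding mat_ent_def
    by (intro linear_sum_family C.vector_space_axioms vector_space_times ent_linear_left F')
  show "Vector_Spaces.linear (mat_scale sA) (*) (\<lambda>a. mat_ent ent c a F)"
    unfolding mat_ent_def
    by (intro linear_sum_family vector_space_mat_scale A.vector_space_axioms vector_space_times
        linear_comp[OF linear_mat_entry ent_linear_right] F')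
  show "mat_ent ent c (mat_mult mA U V) F =
        mat_ent ent c U (\<lambda>x d. mat_ent ent d V (\<lambda>y e. F (mat_mult mA x y) e))"
    by (rule mat_ent_mult[OF F])
  have "mat_ent ent c (mat_one uA) F =
      (\<Sum>i\<in>UNIV. \<Sum>j\<in>UNIV. if j = i then F (mat_elem i j uA) c else 0)"
    unfolding mat_ent_def mat_one_def
    by (intro sum.cong refl) (simp add: ent_one[OF F'] ent_algebra_zero[OF F'])
  also have "\<dots> = (\<Sum>i\<in>UNIV. F (mat_elem i i uA) c)" by simp
  also have "\<dots> = F (\<Sum>i\<in>UNIV. mat_elem i i uA) c"
    by (rule linear_imp_sum[OF bilinear_map_left[OF F], symmetric])
  also have "(\<Sum>i\<in>UNIV. mat_elem i i uA) = (mat_one uA :: 'a^'r^'r)"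
    by (rule sum_mat_elem_diagonal)
  finally show "mat_ent ent c (mat_one uA) F = F (mat_one uA) c" .
qed

interpretation M: entwined_algebra "mat_scale sA" "mat_mult mA" "mat_one uA :: 'a^'r::finite^'r" sC "mat_ent ent"
  by (rule entwined_algebra_mat)

text \<open>
  The trace commutes with all faces. For inner faces this holds because entries of a product
  expand along paths. For the cyclic face, with first entry \<open>B\<close> and last entry \<open>A\<close>, moving
  \<open>E\<^sub>i\<^sub>j(B\<^sub>i\<^sub>j)\<close> behind \<open>A\<close> gives a matrix that lives in column \<open>j\<close>. This forces the path to start at
  \<open>j\<close>, as it does when \<open>B\<^sub>i\<^sub>j\<close> is the first step of a path starting at \<open>i\<close>.
\<close>

lemma trace_face:
  fixes Us :: "('a^'r::finite^'r) list"
  assumes G: "form (Suc n) G" and len: "length Us = Suc (Suc n)" and i: "i \<le> Suc n"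
  shows "M.face i (\<lambda>c. cyclic_sum (\<lambda>k l U. U $ k $ l) (G c)) c Us =
         cyclic_sum (\<lambda>k l U. U $ k $ l) (face i G c) Us"
proof (cases i)
  case (Suc h)
  have "cyclic_sum (\<lambda>k l U. U $ k $ l) (G c) (mult_at (mat_mult mA) h Us) =
        cyclic_sum (\<lambda>k l U. U $ k $ l) (\<lambda>ys. G c (mult_at mA h ys)) Us"
    using i len multilinear_map_slot_linear[OF G]
    by (intro cyclic_sum_mult_at[where sA = sA and sV = "(*)"]) (simp_all add: Suc mat_mult_def)
  moreover have "face (Suc h) G c = (\<lambda>ys. G c (mult_at mA h ys))" by (simp add: fun_eq_iff)
  ultimately show ?thesis by (simp add: Suc)
next
  case 0
  let ?e = "\<lambda>k l U. (U :: 'a^'r^'r) $ k $ l"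
  obtain B bs A where Us: "Us = B # bs @ [A]" and bs: "length bs = n"
    using len by (cases Us; cases "tl Us" rule: rev_cases) auto
  have "cyclic_sum ?e (G d) (bs @ [mat_mult mA A (mat_elem i j x)]) =
        path_sum ?e bs j (\<lambda>ys q. G d (ys @ [mA (A $ q $ i) x]))" for i j x d
  proof -
    have "path_sum ?e bs k (\<lambda>ys q. G d (ys @ [mat_mult mA A (mat_elem i j x) $ q $ k])) =
          (if k = j then path_sum ?e bs j (\<lambda>ys q. G d (ys @ [mA (A $ q $ i) x])) else 0)" for k
    proof (cases "k = j")
      case False
      have "path_sum ?e bs k (\<lambda>ys q. G d (ys @ [mat_mult mA A (mat_elem i j x) $ q $ k])) =
            path_sum ?e bs k (\<lambda>ys q. 0)"
        using slot_linear_eq_zero[OF multilinear_map_slot_linear[OF G]] bs False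
        by (intro path_sum_cong) (simp add: A.mat_mult_mat_elem)
      also have "\<dots> = 0"
        using path_sum_sum[of ?e bs k "\<lambda>i ys q. 0" "{} :: nat set"] by simp
      finally show ?thesis using False by simp
    qed (simp add: A.mat_mult_mat_elem)
    then have "cyclic_sum ?e (G d) (bs @ [mat_mult mA A (mat_elem i j x)]) =
      (\<Sum>k\<in>UNIV. if k = j then path_sum ?e bs j (\<lambda>ys q. G d (ys @ [mA (A $ q $ i) x])) else 0)"
      by (simp add: cyclic_sum_def)
    then show ?thesis by simp
  qed
  then have "M.face 0 (\<lambda>c. cyclic_sum ?e (G c)) c Us =
      (\<Sum>i\<in>UNIV. \<Sum>j\<in>UNIV. path_sum ?e bs j
         (\<lambda>ys q. ent c (B $ i $ j) (\<lambda>x d. G d (ys @ [mA (A $ q $ i) x]))))"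
    by (simp add: Us mat_ent_def ent_path_sum)
  then show ?thesis by (simp add: 0 Us cyclic_sum_def)
qed

text \<open>
  \<open>E\<^sub>p\<^sub>p\<close> is multiplicative and compatible with the entwining.
\<close>

lemma inclusion_face:
  fixes p :: "'r::finite"
  assumes G: "M.form (Suc n) (G :: _ \<Rightarrow> ('a^'r^'r) list \<Rightarrow> _)" and len: "length as = Suc (Suc n)" and i: "i \<le> Suc n"
  shows "face i (\<lambda>c as. G c (map (mat_elem p p) as)) c as = M.face i G c (map (mat_elem p p) as)"
proof (cases i)
  case (Suc h)
  then show ?thesis
    using len i by (simp add: mult_at_map A.mat_elem_mult_mat_elem)
next
  case 0
  obtain b bs a where as: "as = b # bs @ [a]" and bs: "length bs = n"
    using len by (cases as; cases "tl as" rule: rev_cases) auto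
  have "bilinear_map (mat_scale sA) sC (*)
     (\<lambda>X d. G d (map_last (\<lambda>a. mat_mult mA a X) (map (mat_elem p p) (bs @ [a]))))"
    by (intro M.bilinear_map_last[OF G]) (simp_all add: bs)
  from mat_ent_mat_elem[OF this] show ?thesis
    by (simp add: 0 as A.mat_elem_mult_mat_elem map_last_snoc[of _ "map _ _"])
qed

text \<open>
  Only the constant path \<open>p, p, \<dots>, p\<close> meets no zero entry.
\<close>

lemma trace_inclusion:
  assumes \<Phi>: "slot_linear sA (*) (length as) \<Phi>" and "as \<noteq> []"
  shows "cyclic_sum (\<lambda>k l U. U $ k $ l) \<Phi> (map (mat_elem p p) as :: ('a^'r::finite^'r) list) = \<Phi> as"
proof -
  let ?e = "\<lambda>k l U. (U :: 'a^'r^'r) $ k $ l"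
  \<comment> \<open>Steps away from \<open>p\<close> contribute a zero entry, on which \<open>\<Psi>\<close> vanishes.\<close>
  have path: "path_sum ?e (map (mat_elem p p) xs) k \<Psi> = (if k = p then \<Psi> xs p else 0)"
    if "\<And>ys q. length ys = length xs \<Longrightarrow> 0 \<in> set ys \<or> q \<noteq> p \<Longrightarrow> \<Psi> ys q = 0"
    for xs k and \<Psi> :: "'a list \<Rightarrow> 'r \<Rightarrow> 'k"
    using that
  proof (induction xs arbitrary: k \<Psi>)
    case (Cons x xs)
    have "path_sum ?e (map (mat_elem p p) xs) l (\<lambda>ys q. \<Psi> (mat_elem p p x $ k $ l # ys) q) =
          (if l = p then \<Psi> (mat_elem p p x $ k $ l # xs) p else 0)" for l
      by (rule Cons.IH) (simp add: Cons.prems)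
    then have "path_sum ?e (map (mat_elem p p) (x # xs)) k \<Psi> =
          (\<Sum>l\<in>UNIV. if l = p then \<Psi> (mat_elem p p x $ k $ l # xs) p else 0)" by simp
    also have "\<dots> = \<Psi> (mat_elem p p x $ k $ p # xs) p" by simp
    finally show ?case
      using Cons.prems[of "0 # xs" p] by (simp add: mat_elem_entry)
  qed auto
  obtain bs b where as: "as = bs @ [b]" using assms(2) by (cases as rule: rev_cases) auto
  have zero: "\<Phi> ys = 0" if "length ys = length as" "0 \<in> set ys" for ys
    using slot_linear_eq_zero[OF \<Phi> that] .
  have "path_sum ?e (map (mat_elem p p) bs) k (\<lambda>ys q. \<Phi> (ys @ [mat_elem p p b $ q $ k])) =
        (if k = p then \<Phi> as else 0)" for k
    using zero by (subst path) (auto simp: as mat_elem_entry)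
  then show ?thesis by (simp add: cyclic_sum_def as)
qed

lemma mat_elem_entwining_invariant: "M.entwining_invariant (mat_elem p q uA :: 'a^'r::finite^'r)"
  unfolding M.entwining_invariant_def
  by (simp add: mat_ent_mat_elem ent_one[OF bilinear_map_mat_elem])

text \<open>
  The families \<open>e\<^sub>k = E\<^sub>p\<^sub>k(1)\<close> and \<open>f\<^sub>k = E\<^sub>k\<^sub>p(1)\<close> satisfy the conditions of the homotopy.
\<close>

lemma mat_elem_partition_of_one:
  "(\<Sum>k\<in>UNIV. mat_mult mA (mat_elem k p uA) (mat_elem p k uA)) = (mat_one uA :: 'a^'r::finite^'r)"
  by (simp add: A.mat_elem_mult_mat_elem A.mult_one_left sum_mat_elem_diagonal)

text \<open>
  Thus conjugation by these families is the trace followed by the inclusion \<open>E\<^sub>p\<^sub>p\<close>.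
\<close>

lemma conj_mat_elem:
  "mat_mult mA (mat_mult mA (mat_elem p k uA) U) (mat_elem l p uA) = (mat_elem p p (U $ k $ l) :: 'a^'r::finite^'r)"
  by (auto simp: vec_eq_iff A.mat_mult_mat_elem A.mat_elem_mat_mult A.mult_one_left A.mult_one_right A.mult_zero)
    (auto simp: mat_elem_def)

lemma matrix_homotopy:
  fixes p :: "'r::finite" and G :: "'c \<Rightarrow> ('a^'r^'r) list \<Rightarrow> 'k"
  defines "h \<equiv> M.homotopy (\<lambda>k. mat_elem p k uA) (\<lambda>k. mat_elem k p uA)"
  shows "M.form (Suc n) G \<Longrightarrow> M.form n (h n G)"
    and "M.form (Suc n) G \<Longrightarrow> length as = Suc n \<Longrightarrow>
      h (Suc n) (M.differential n G) c as + (if n = 0 then 0 else M.differential (n - 1) (h n G) c as) =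
         G c as - cyclic_sum (\<lambda>k l U. U $ k $ l) (\<lambda>xs. G c (map (mat_elem p p) xs)) as"
proof -
  note conditions = mat_elem_partition_of_one mat_elem_entwining_invariant mat_elem_entwining_invariant
  show "M.form n (h n G)" if "M.form (Suc n) G"
    using M.homotopy_form[OF conditions that] unfolding h_def .
  have "M.conjugate (\<lambda>k. mat_elem p k uA) (\<lambda>k. mat_elem k p uA) = (\<lambda>k l U. mat_elem p p (U $ k $ l))"
    unfolding M.conjugate_def by (simp add: conj_mat_elem fun_eq_iff)
  then show "h (Suc n) (M.differential n G) c as +
      (if n = 0 then 0 else M.differential (n - 1) (h n G) c as) =
         G c as - cyclic_sum (\<lambda>k l U. U $ k $ l) (\<lambda>xs. G c (map (mat_elem p p) xs)) as"
    if "M.form (Suc n) G" "length as = Suc n"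
    using M.homotopy_formula[OF conditions that] unfolding h_def by (simp add: cyclic_sum_map[where h = "mat_elem p p"])
qed

end


section \<open>The complexes of an entwining structure and of its matrices\<close>

text \<open>
  The matrices \<open>a u\<close> span \<open>M\<^sub>r(A)\<close>, since \<open>E\<^sub>i\<^sub>j(a)\<close> is one of them. This is what makes the
  definitions by values on pure matrices unambiguous.
\<close>

lemma linear_eq_on_mat_pure:
  fixes U :: "'a::ab_group_add^'r::finite^'r"
  assumes A: "vector_space sA"
    and f: "Vector_Spaces.linear (mat_scale sA) sV f" and g: "Vector_Spaces.linear (mat_scale sA) sV g"
    and eq: "\<And>a u. f (mat_pure sA a u) = g (mat_pure sA a u)"
  shows "f U = g U"
proof -
  have "f (\<Sum>i\<in>UNIV. \<Sum>j\<in>UNIV. mat_elem i j (U $ i $ j)) = g (\<Sum>i\<in>UNIV. \<Sum>j\<in>UNIV. mat_elem i j (U $ i $ j))"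
    unfolding linear_imp_sum[OF f] linear_imp_sum[OF g]
    by (simp add: mat_elem_eq_mat_pure[OF A] eq)
  then show ?thesis by (simp add: sum_mat_elem_entries)
qed

lemma subspace_sweedler_sum:
  fixes f :: "'m::ab_group_add \<Rightarrow> 'n::ab_group_add \<Rightarrow> 'x \<Rightarrow> 'k::field"
  assumes S: "module.subspace fscale S" and f: "\<And>x y. f x y \<in> S"
  shows "sweedler_sum sM sN t f \<in> S"
proof -
  have "(\<Sum>(x, y)\<leftarrow>zs. f x y) \<in> S" for zs
  proof (induction zs)
    case Nil
    show ?case using fs.subspace_0[OF S] by (simp add: zero_fun_def)
  next
    case (Cons z zs)
    then show ?case using fs.subspace_add[OF S f[of "fst z" "snd z"]] by (simp add: case_prod_unfold plus_fun_def)
  qed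
  then show ?thesis by (simp add: sweedler_sum_def)
qed

context entwining_structure
begin

definition ent :: "'c \<Rightarrow> 'a \<Rightarrow> ('a \<Rightarrow> 'c \<Rightarrow> 'k) \<Rightarrow> 'k" where
  "ent c a F = sweedler_sum sA sC (\<psi> (tensor sC sA c a)) F"

lemmas vsA = A.vector_space_axioms and vsC = C.vector_space_axioms

lemma psi_in: "\<psi> (tensor sC sA c a) \<in> tensor_space sA sC"
  using linear_on_in[OF linear_mapsD[OF psi_linear] tensor_in_space] .

lemma tensor_lift_psi:
  "vector_space sV \<Longrightarrow> bilinear_map sA sC sV f \<Longrightarrow>
    tensor_lift sA sC sV f (\<psi> (tensor sC sA c a)) = sweedler_sum sA sC (\<psi> (tensor sC sA c a)) f"
  by (rule tensor_lift_sweedler_sum[OF vsA vsC _ _ psi_in])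

lemma psi_tensor_linear:
  "Vector_Spaces.linear sC fscale (\<lambda>c. \<psi> (tensor sC sA c a))"
  "Vector_Spaces.linear sA fscale (\<lambda>a. \<psi> (tensor sC sA c a))"
  by (rule linear_linear_on_comp[OF _ tensor_in_space linear_mapsD[OF psi_linear] vector_space_fscale],
      rule bilinear_map_left[OF tensor_bilinear[OF vsC vsA]] bilinear_map_right[OF tensor_bilinear[OF vsC vsA]])+

lemma sweedler_sum_psi_linear:
  assumes V: "vector_space sV" and f: "bilinear_map sA sC sV f"
  shows "Vector_Spaces.linear sC sV (\<lambda>c. sweedler_sum sA sC (\<psi> (tensor sC sA c a)) f)"
    and "Vector_Spaces.linear sA sV (\<lambda>a. sweedler_sum sA sC (\<psi> (tensor sC sA c a)) f)"
  unfolding tensor_lift_psi[OF assms, symmetric]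
  by (rule linear_linear_on_comp[OF psi_tensor_linear(1) psi_in tensor_lift_linear(1)[OF assms] V]
      linear_linear_on_comp[OF psi_tensor_linear(2) psi_in tensor_lift_linear(1)[OF assms] V])+

lemma mult_linear: "Vector_Spaces.linear sA sA (\<lambda>x. mA x y)" "Vector_Spaces.linear sA sA (mA x)"
  using A.mult_bilinear by (simp_all add: bilinear_map_def)

text \<open>
  The axiom for products with all induced maps replaced by sums over representatives, which is
  possible as the functions involved are bilinear.
\<close>

lemma psi_mult_sweedler:
  "\<psi> (tensor sC sA c (mA a b)) =
     sweedler_sum sA sC (\<psi> (tensor sC sA c a))
       (\<lambda>x d. sweedler_sum sA sC (\<psi> (tensor sC sA d b)) (\<lambda>y e. tensor sA sC (mA x y) e))"
proof -
  note tb = tensor_bilinear[OF vsA vsC]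
  have inner: "bilinear_map sA sC fscale (\<lambda>y e. tensor sA sC (mA x y) e)" for x
    unfolding bilinear_map_def
    using linear_comp[OF mult_linear(2) bilinear_map_left[OF tb]] bilinear_map_right[OF tb] by simp
  have "Vector_Spaces.linear sA fscale
      (\<lambda>x. sweedler_sum sA sC (\<psi> (tensor sC sA d b)) (\<lambda>y e. tensor sA sC (mA x y) e))" for d
    by (rule linear_sweedler_sum[OF vsA vector_space_fscale linear_comp[OF mult_linear(1) bilinear_map_left[OF tb]]])
  then have "bilinear_map sA sC fscale
    (\<lambda>x d. sweedler_sum sA sC (\<psi> (tensor sC sA d b)) (\<lambda>y e. tensor sA sC (mA x y) e))"
    unfolding bilinear_map_def
    using sweedler_sum_psi_linear(1)[OF vector_space_fscale inner] by simp
  from tensor_lift_psi[OF vector_space_fscale this] show ?thesis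
    unfolding psi_mult tensor_lift_psi[OF vector_space_fscale inner] .
qed

lemma ent_mult:
  assumes F: "bilinear_map sA sC (*) F"
  shows "ent c (mA a b) F = ent c a (\<lambda>x d. ent d b (\<lambda>y e. F (mA x y) e))"
proof -
  note lift = linear_on_sweedler_sum[OF vector_space_fscale vector_space_times subspace_tensor_space
      tensor_lift_linear(1)[OF vector_space_times F]]
  have "ent c (mA a b) F = tensor_lift sA sC (*) F (\<psi> (tensor sC sA c (mA a b)))"
    by (simp add: ent_def tensor_lift_psi[OF vector_space_times F])
  also have "\<dots> = ent c a (\<lambda>x d. ent d b (\<lambda>y e. F (mA x y) e))"
    unfolding psi_mult_sweedler ent_def
    by (simp add: lift subspace_sweedler_sum[OF subspace_tensor_space] tensor_in_space
        tensor_lift_linear(2)[OF vector_space_times F])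
  finally show ?thesis .
qed

lemma entwined_complex: "entwined_complex sA mA uA sC ent \<psi>"
proof (intro entwined_complex.intro entwined_algebra.intro entwined_algebra_axioms.intro
    entwined_complex_axioms.intro A.unital_algebra_axioms vsC)
  fix c a b and F G :: "'a \<Rightarrow> 'c \<Rightarrow> 'k" and k
  show "ent c a (\<lambda>x d. F x d + G x d) = ent c a F + ent c a G"
    unfolding ent_def by (rule sweedler_sum_add)
  show "ent c a (\<lambda>x d. k * F x d) = k * ent c a F"
    unfolding ent_def by (rule sweedler_sum_linear[OF linear_times_const, symmetric])
  assume F: "bilinear_map sA sC (*) F"
  show "Vector_Spaces.linear sC (*) (\<lambda>c. ent c a F)" "Vector_Spaces.linear sA (*) (\<lambda>a. ent c a F)"
    unfolding ent_def by (rule sweedler_sum_psi_linear[OF vector_space_times F])+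
  show "ent c (mA a b) F = ent c a (\<lambda>x d. ent d b (\<lambda>y e. F (mA x y) e))"
    by (rule ent_mult[OF F])
  show lift: "tensor_lift sA sC (*) F (\<psi> (tensor sC sA c a)) = ent c a F" for c a
    unfolding ent_def by (rule tensor_lift_psi[OF vector_space_times F])
  show "ent c uA F = F uA c"
    unfolding lift[symmetric] psi_one by (rule tensor_lift_linear(2)[OF vector_space_times F])
qed

text \<open>
  The formula on elementary matrices defines a bilinear, hence a linear map. It has the values
  that characterise \<open>mat_psi\<close>, because \<open>\<Sum> u\<^sub>i\<^sub>j E\<^sub>i\<^sub>j(x)\<close> is the pure matrix \<open>x u\<close>.
\<close>

lemma mat_psi_tensor:
  fixes U :: "'a^'r::finite^'r"
  shows "mat_psi sA sC \<psi> (tensor sC (mat_scale sA) c U) =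
    (\<Sum>i\<in>UNIV. \<Sum>j\<in>UNIV. sweedler_sum sA sC (\<psi> (tensor sC sA c (U $ i $ j)))
       (\<lambda>x d. tensor (mat_scale sA) sC (mat_elem i j x) d))"
proof -
  let ?sM = "mat_scale sA :: 'k \<Rightarrow> 'a^'r^'r \<Rightarrow> 'a^'r^'r"
  have vsM: "vector_space ?sM" by (rule vector_space_mat_scale[OF vsA])
  define B where "B c U = (\<Sum>i\<in>UNIV. \<Sum>j\<in>UNIV. sweedler_sum sA sC (\<psi> (tensor sC sA c (U $ i $ j)))
       (\<lambda>x d. tensor ?sM sC (mat_elem i j x) d))" for c and U :: "'a^'r^'r"
  note tb = tensor_bilinear[OF vsM vsC]
  have comp: "bilinear_map sA sC fscale (\<lambda>x d. tensor ?sM sC (h x) d)"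
    if "Vector_Spaces.linear sA ?sM h" for h
    unfolding bilinear_map_def
    using linear_comp[OF that bilinear_map_left[OF tb]] bilinear_map_right[OF tb] by simp
  note elem = comp[OF linear_mat_elem[OF vsA]]
  have B: "bilinear_map sC ?sM fscale B"
    unfolding bilinear_map_def B_def
    using sweedler_sum_psi_linear[OF vector_space_fscale elem]
    by (auto intro!: linear_sum_family vsC vsM vector_space_fscale linear_comp[OF linear_mat_entry[OF vsA]])
  have B_in: "B c U \<in> tensor_space ?sM sC" for c U
    unfolding B_def
    by (intro fs.subspace_sum subspace_sweedler_sum subspace_tensor_space tensor_in_space)
  have B_pure: "B c (mat_pure sA a u) =
      tensor_lift sA sC fscale (\<lambda>x d. tensor ?sM sC (mat_pure sA x u) d) (\<psi> (tensor sC sA c a))" for c a u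
  proof -
    have "B c (mat_pure sA a u) = (\<Sum>i\<in>UNIV. \<Sum>j\<in>UNIV.
        sweedler_sum sA sC (\<psi> (tensor sC sA c a)) (\<lambda>x d. tensor ?sM sC (mat_elem i j (sA (u $ i $ j) x)) d))"
      unfolding B_def
    proof (intro sum.cong refl)
      fix i j
      let ?S = "\<lambda>a f. sweedler_sum sA sC (\<psi> (tensor sC sA c a)) f"
      have "?S (sA (u $ i $ j) a) (\<lambda>x d. tensor ?sM sC (mat_elem i j x) d) =
          fscale (u $ i $ j) (?S a (\<lambda>x d. tensor ?sM sC (mat_elem i j x) d))"
        using sweedler_sum_psi_linear(2)[OF vector_space_fscale elem] by (simp add: Vector_Spaces.linear_iff)
      also have "\<dots> = ?S a (\<lambda>x d. fscale (u $ i $ j) (tensor ?sM sC (mat_elem i j x) d))"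
        by (rule sweedler_sum_linear[of fscale fscale])
          (simp add: Vector_Spaces.linear_iff vector_space_fscale fs.scale_right_distrib mult.commute)
      also have "\<dots> = ?S a (\<lambda>x d. tensor ?sM sC (mat_elem i j (sA (u $ i $ j) x)) d)"
        using bilinear_map_left[OF elem] by (simp add: Vector_Spaces.linear_iff)
      finally show "?S (mat_pure sA a u $ i $ j) (\<lambda>x d. tensor ?sM sC (mat_elem i j x) d) =
          ?S a (\<lambda>x d. tensor ?sM sC (mat_elem i j (sA (u $ i $ j) x)) d)"
        by (simp add: mat_pure_def)
    qed
    also have "\<dots> = sweedler_sum sA sC (\<psi> (tensor sC sA c a)) (\<lambda>x d. tensor ?sM sC (mat_pure sA x u) d)"
      unfolding mat_pure_eq_sum[OF vsA] linear_imp_sum[OF bilinear_map_left[OF tb]]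
      by (simp add: sweedler_sum_sum)
    finally show ?thesis
      by (simp add: tensor_lift_psi[OF vector_space_fscale comp[OF linear_mat_pure[OF vsA]]])
  qed
  let ?L = "tensor_lift sC ?sM fscale B"
  note L = tensor_lift_linear(2)[OF vector_space_fscale B]
  have L_lin: "linear_on fscale (tensor_space sC ?sM) fscale (tensor_space ?sM sC) ?L"
    using linear_on_span_into[OF vector_space_fscale vector_space_fscale subspace_tensor_space
        linear_mapsD[OF tensor_lift_linear_maps[OF vector_space_fscale B], unfolded tensor_space_def[of sC]]]
      L B_in
    unfolding tensor_space_def[of sC] by fastforce
  have "mat_psi sA sC \<psi> = ?L"
    unfolding mat_psi_def
  proof (rule the_equality, intro conjI allI)
    show "?L \<in> linear_maps fscale (tensor_space sC ?sM) fscale (tensor_space ?sM sC)"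
      using L_lin tensor_lift_linear_maps[OF vector_space_fscale B] by (simp add: linear_maps_def)
    show "?L (tensor sC ?sM c (mat_pure sA a u)) =
        tensor_lift sA sC fscale (\<lambda>x d. tensor ?sM sC (mat_pure sA x u) d) (\<psi> (tensor sC sA c a))" for c a u
      by (simp add: L B_pure)
  next
    fix \<Psi> :: "('c, 'a^'r^'r, 'k) tensor \<Rightarrow> _"
    assume \<Psi>: "\<Psi> \<in> linear_maps fscale (tensor_space sC ?sM) fscale (tensor_space ?sM sC) \<and>
        (\<forall>c a u. \<Psi> (tensor sC ?sM c (mat_pure sA a u)) =
           tensor_lift sA sC fscale (\<lambda>x d. tensor ?sM sC (mat_pure sA x u) d) (\<psi> (tensor sC sA c a)))"
    then have \<Psi>_lin: "linear_on fscale (tensor_space sC ?sM) fscale (tensor_space ?sM sC) \<Psi>"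
      by (simp add: linear_maps_def)
    have \<Psi>_eq: "\<Psi> (tensor sC ?sM c U) = ?L (tensor sC ?sM c U)" for c U
    proof (rule linear_eq_on_mat_pure[OF vsA])
      note t = bilinear_map_right[OF tensor_bilinear[OF vsC vsM]]
      show "Vector_Spaces.linear ?sM fscale (\<lambda>U. \<Psi> (tensor sC ?sM c U))"
        "Vector_Spaces.linear ?sM fscale (\<lambda>U. ?L (tensor sC ?sM c U))"
        by (rule linear_linear_on_comp[OF t tensor_in_space \<Psi>_lin vector_space_fscale]
            linear_linear_on_comp[OF t tensor_in_space L_lin vector_space_fscale])+
    qed (simp add: \<Psi> L B_pure)
    show "\<Psi> = ?L"
    proof
      fix t show "\<Psi> t = ?L t"
      proof (cases "t \<in> tensor_space sC ?sM")
        case True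
        show ?thesis
          by (rule linear_on_span_eq[OF vector_space_fscale vector_space_fscale
                \<Psi>_lin[unfolded tensor_space_def[of sC]] L_lin[unfolded tensor_space_def[of sC]]
                _ True[unfolded tensor_space_def]]) (use \<Psi>_eq in auto)
      next
        case False
        then show ?thesis
          using \<Psi> tensor_lift_linear_maps[OF vector_space_fscale B] by (simp add: linear_maps_def)
      qed
    qed
  qed
  then show ?thesis by (simp add: L B_def)
qed

lemma entwined_complex_mat:
  "entwined_complex (mat_scale sA) (mat_mult mA) (mat_one uA :: 'a^'r::finite^'r) sC (mat_ent ent) (mat_psi sA sC \<psi>)"
proof (intro entwined_complex.intro entwined_complex_axioms.intro)
  interpret H: entwined_complex sA mA uA sC ent \<psi> by (rule entwined_complex)
  show "entwined_algebra (mat_scale sA) (mat_mult mA) (mat_one uA :: 'a^'r^'r) sC (mat_ent ent)"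
    by (rule H.entwined_algebra_mat)
  fix c and U :: "'a^'r^'r" and F :: "'a^'r^'r \<Rightarrow> 'c \<Rightarrow> 'k"
  assume F: "bilinear_map (mat_scale sA) sC (*) F"
  note lin = tensor_lift_linear(1)[OF vector_space_times F]
  note sub = subspace_tensor_space[of "mat_scale sA" sC]
  show "tensor_lift (mat_scale sA) sC (*) F (mat_psi sA sC \<psi> (tensor sC (mat_scale sA) c U)) = mat_ent ent c U F"
    unfolding mat_psi_tensor mat_ent_def ent_def
    by (simp add: linear_on_sum[OF vector_space_fscale vector_space_times sub lin]
        linear_on_sweedler_sum[OF vector_space_fscale vector_space_times sub lin]
        fs.subspace_sum[OF sub] subspace_sweedler_sum[OF sub] tensor_in_space
        tensor_lift_linear(2)[OF vector_space_times F])
qed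

end


section \<open>The trace and the inclusion on cochains\<close>

abbreviation trace_sum :: "('a list \<Rightarrow> 'v::comm_monoid_add) \<Rightarrow> ('a^'r::finite^'r) list \<Rightarrow> 'v" where
  "trace_sum \<equiv> cyclic_sum (\<lambda>k l U. U $ k $ l)"

text \<open>
  For pure matrices \<open>a\<^sub>1 u\<^sub>1, \<dots>, a\<^sub>n u\<^sub>n\<close> the scalars \<open>(u\<^sub>1)\<^sub>k\<^sub>l \<cdots> (u\<^sub>n)\<^sub>m\<^sub>q\<close> come out of a multilinear map, and
  the sum over paths from \<open>k\<close> to \<open>q\<close> is the entry \<open>(k, q)\<close> of \<open>u\<^sub>1 \<cdots> u\<^sub>n\<close>.
\<close>

lemma path_sum_mat_pure:
  fixes us :: "('k::field^'r::finite^'r) list"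
  assumes A: "vector_space sA" and V: "vector_space sV"
  shows "length as = length us \<Longrightarrow> (\<And>q. slot_linear sA sV (length as) (\<lambda>ys. \<Phi> ys q)) \<Longrightarrow>
    path_sum (\<lambda>k l U. U $ k $ l) (map2 (mat_pure sA) as us) k \<Phi> =
      (\<Sum>q\<in>UNIV. sV (foldr (**) us (mat 1) $ k $ q) (\<Phi> as q))"
proof (induction as us arbitrary: k \<Phi> rule: list_induct2)
  case Nil
  interpret V: vector_space sV by fact
  have "(\<Sum>q\<in>UNIV. sV (mat 1 $ k $ q) (\<Phi> [] q)) = (\<Sum>q\<in>UNIV. if k = q then \<Phi> [] q else 0)"
    by (intro sum.cong) (auto simp: mat_def)
  then show ?case by simp
next
  case (Cons a as u us)
  interpret V: vector_space sV by fact
  let ?R = "foldr (**) us (mat 1)"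
  have IH: "path_sum (\<lambda>k l U. U $ k $ l) (map2 (mat_pure sA) as us) l (\<lambda>ys q. \<Phi> (x # ys) q) =
      (\<Sum>q\<in>UNIV. sV (?R $ l $ q) (\<Phi> (x # as) q))" for l x
    using Cons.prems by (intro Cons.IH slot_linear_Cons) simp
  have "path_sum (\<lambda>k l U. U $ k $ l) (map2 (mat_pure sA) (a # as) (u # us)) k \<Phi> =
      (\<Sum>l\<in>UNIV. \<Sum>q\<in>UNIV. sV (?R $ l $ q) (\<Phi> (sA (u $ k $ l) a # as) q))"
    by (simp add: IH) (simp add: mat_pure_def)
  also have "\<dots> = (\<Sum>l\<in>UNIV. \<Sum>q\<in>UNIV. sV (u $ k $ l * ?R $ l $ q) (\<Phi> (a # as) q))"
    using slot_linearD[OF Cons.prems, of "[]" as]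
    by (simp add: Vector_Spaces.linear_iff mult.commute)
  also have "\<dots> = (\<Sum>q\<in>UNIV. sV (foldr (**) (u # us) (mat 1) $ k $ q) (\<Phi> (a # as) q))"
    by (subst sum.swap) (simp add: matrix_matrix_mult_def V.scale_sum_left)
  finally show ?case .
qed

lemma trace_sum_mat_pure:
  fixes us :: "('k::field^'r::finite^'r) list"
  assumes A: "vector_space sA" and V: "vector_space sV" and len: "length as = length us" "as \<noteq> []"
    and \<Phi>: "slot_linear sA sV (length as) \<Phi>"
  shows "trace_sum \<Phi> (map2 (mat_pure sA) as us) = sV (trace (foldr (**) us (mat 1))) (\<Phi> as)"
proof -
  interpret V: vector_space sV by fact
  let ?R = "foldr (**) us (mat 1)"
  have "map2 (mat_pure sA) as us \<noteq> []" using len by (cases as; cases us) auto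
  have lin: "slot_linear sA sV (length as) (\<lambda>ys. if q = k then \<Phi> ys else 0)" for q k :: 'r
    using \<Phi> A V by (cases "q = k") (auto simp: slot_linear_def Vector_Spaces.linear_iff)
  have "trace_sum \<Phi> (map2 (mat_pure sA) as us) =
      (\<Sum>k\<in>UNIV. \<Sum>q\<in>UNIV. sV (?R $ k $ q) (if q = k then \<Phi> as else 0))"
    unfolding cyclic_sum_closed_paths[OF \<open>map2 (mat_pure sA) as us \<noteq> []\<close>]
    by (intro sum.cong refl path_sum_mat_pure[OF A V len(1)] lin)
  also have "\<dots> = (\<Sum>k\<in>UNIV. \<Sum>q\<in>UNIV. if q = k then sV (?R $ k $ k) (\<Phi> as) else 0)"
    by (intro sum.cong) auto
  finally show ?thesis by (simp add: trace_def V.scale_sum_left)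
qed

lemma slot_linear_eq_on_mat_pure:
  fixes sA :: "'k::field \<Rightarrow> 'a::ab_group_add \<Rightarrow> 'a" and Us :: "('a^'r::finite^'r) list"
  assumes A: "vector_space sA"
  shows "slot_linear (mat_scale sA) sV m F \<Longrightarrow> slot_linear (mat_scale sA) sV m G \<Longrightarrow>
    (\<And>as us. length as = m \<Longrightarrow> length us = m \<Longrightarrow>
        F (map2 (mat_pure sA) as us) = G (map2 (mat_pure sA) as us)) \<Longrightarrow>
    length Us = m \<Longrightarrow> F Us = G Us"
proof (induction m arbitrary: Us F G)
  case 0
  then show ?case using 0(3)[of "[]" "[]"] by simp
next
  case (Suc m)
  obtain U Us' where Us: "Us = U # Us'" "length Us' = m" using Suc.prems(4) by (cases Us) auto
  show ?case unfolding Us(1)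
  proof (rule linear_eq_on_mat_pure[OF A])
    show "Vector_Spaces.linear (mat_scale sA) sV (\<lambda>U. F (U # Us'))"
      "Vector_Spaces.linear (mat_scale sA) sV (\<lambda>U. G (U # Us'))"
      using slot_linearD[OF Suc.prems(1), of "[]" Us'] slot_linearD[OF Suc.prems(2), of "[]" Us'] Us(2) by simp_all
    fix a u
    show "F (mat_pure sA a u # Us') = G (mat_pure sA a u # Us')"
    proof (rule Suc.IH[OF slot_linear_Cons slot_linear_Cons _ Us(2)])
      fix as :: "'a list" and us :: "('k^'r^'r) list" assume "length as = m" "length us = m"
      then show "F (mat_pure sA a u # map2 (mat_pure sA) as us) = G (mat_pure sA a u # map2 (mat_pure sA) as us)"
        using Suc.prems(3)[of "a # as" "u # us"] by simp
    qed (fact Suc.prems)+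
  qed
qed

lemma linear_on_trace_sum:
  assumes "vector_space sV" "vector_space sW" "module.subspace sV S" "linear_on sV S sW T h"
    and "Us \<noteq> []" "\<And>as. length as = length Us \<Longrightarrow> \<Phi> as \<in> S"
  shows "trace_sum \<Phi> Us \<in> S" "h (trace_sum \<Phi> Us) = trace_sum (\<lambda>as. h (\<Phi> as)) Us"
proof -
  interpret V: vector_space sV by fact
  show "trace_sum \<Phi> Us \<in> S" "h (trace_sum \<Phi> Us) = trace_sum (\<lambda>as. h (\<Phi> as)) Us"
    by (rule cyclic_sum_additive_on[of S h]; fact linear_on_zero[OF assms(1-4)]
        V.subspace_0[OF assms(3)] V.subspace_add[OF assms(3)] linear_on_add[OF assms(4)] assms)+
qed

text \<open>
  The sum over closed paths satisfies the characterisation of the generalised trace on pure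
  matrices, and a multilinear map is determined by these.
\<close>

lemma gen_trace_eq_trace_sum:
  fixes sA :: "'k::field \<Rightarrow> 'a::ab_group_add \<Rightarrow> 'a" and sC :: "'k \<Rightarrow> 'c::ab_group_add \<Rightarrow> 'c"
    and n :: nat
  assumes A: "vector_space sA" and C: "vector_space sC"
  defines "tr \<equiv> (gen_trace sA sC (Suc n) :: ('c, ('a^'r::finite^'r) list, 'k) tensor \<Rightarrow> _)"
  shows "tr \<in> linear_maps fscale (mtensor_space sC (mat_scale sA) (Suc n)) fscale (mtensor_space sC sA (Suc n))"
    and "length Us = Suc n \<Longrightarrow>
      tr (mtensor sC (mat_scale sA) (Suc n) c Us) = trace_sum (mtensor sC sA (Suc n) c) Us"
proof -
  let ?sM = "mat_scale sA :: 'k \<Rightarrow> 'a^'r^'r \<Rightarrow> _"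
  let ?m = "Suc n"
  let ?SM = "mtensor_space sC ?sM ?m" and ?SA = "mtensor_space sC sA ?m"
  have M: "vector_space ?sM" by (rule vector_space_mat_scale[OF A])
  have ml: "multilinear_map sC ?sM ?m fscale (\<lambda>c. trace_sum (mtensor sC sA ?m c))"
    by (rule multilinear_cyclic_sum[OF C M vector_space_fscale linear_mat_entry[OF A] mtensor_multilinear[OF C A]])
  \<comment> \<open>The candidate for the trace; \<open>L_pure\<close> is its characteristic property.\<close>
  define L where "L = mtensor_lift sC ?sM ?m fscale (\<lambda>c. trace_sum (mtensor sC sA ?m c))"
  have L: "L \<in> linear_maps fscale ?SM fscale UNIV"
    using mtensor_lift_linear_maps(1)[OF vector_space_fscale ml] by (simp add: L_def)
  have L_val: "L (mtensor sC ?sM ?m c Us) = trace_sum (mtensor sC sA ?m c) Us" if "length Us = ?m" for c Us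
    using mtensor_lift_linear_maps(2)[OF vector_space_fscale ml that] by (simp add: L_def)
  have id: "linear_on fscale ?SA fscale UNIV (\<lambda>x. x)" by (simp add: linear_on_def)
  have in_SA: "trace_sum (mtensor sC sA ?m c) Us \<in> ?SA" if "length Us = ?m" for c and Us :: "('a^'r^'r) list"
    using that by (intro linear_on_trace_sum(1)[OF vector_space_fscale vector_space_fscale subspace_mtensor_space id]
        mtensor_in_space) auto
  have "linear_on fscale ?SM fscale ?SA L"
    unfolding mtensor_space_def[of sC ?sM]
    by (rule linear_on_span_into[OF vector_space_fscale vector_space_fscale subspace_mtensor_space
          linear_mapsD[OF L, unfolded mtensor_space_def[of sC ?sM]]]) (auto simp: L_val in_SA)
  with L have L': "L \<in> linear_maps fscale ?SM fscale ?SA" by (simp add: linear_maps_def)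
  have L_pure: "L (mtensor sC ?sM ?m c (map2 (mat_pure sA) as us)) =
      fscale (trace (foldr (**) us (mat 1))) (mtensor sC sA ?m c as)"
    if "length as = ?m" "length us = ?m" for c as and us :: "('k^'r^'r) list"
  proof -
    have "as \<noteq> []" using that by auto
    then show ?thesis
      using trace_sum_mat_pure[OF A vector_space_fscale _ _
          multilinear_map_slot_linear[OF mtensor_multilinear[OF C A]], of as us c] that
      by (simp add: L_val)
  qed
  have "tr = L"
    unfolding tr_def gen_trace_def
  proof (rule the_equality)
    show "L \<in> linear_maps fscale ?SM fscale ?SA \<and>
        (\<forall>c as us. length as = ?m \<and> length us = ?m \<longrightarrow>
           L (mtensor sC ?sM ?m c (map2 (mat_pure sA) as us)) =
           fscale (trace (foldr (**) us (mat 1))) (mtensor sC sA ?m c as))"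
      using L' L_pure by simp
  next
    fix F assume F: "F \<in> linear_maps fscale ?SM fscale ?SA \<and>
        (\<forall>c as us. length as = ?m \<and> length us = ?m \<longrightarrow>
           F (mtensor sC ?sM ?m c (map2 (mat_pure sA) as us)) =
           fscale (trace (foldr (**) us (mat 1))) (mtensor sC sA ?m c as))"
    show "F = L"
    proof (rule mtensor_linear_maps_eqI[OF vector_space_fscale])
      fix c and Us :: "('a^'r^'r) list" assume Us: "length Us = ?m"
      have slot: "slot_linear ?sM fscale ?m (\<lambda>Us. G (mtensor sC ?sM ?m c Us))"
        if "G \<in> linear_maps fscale ?SM fscale ?SA" for G
        using multilinear_map_slot_linear[OF multilinear_map_mtensor[OF C M vector_space_fscale linear_mapsD[OF that]]] .
      show "F (mtensor sC ?sM ?m c Us) = L (mtensor sC ?sM ?m c Us)"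
        by (rule slot_linear_eq_on_mat_pure[OF A slot slot _ Us]) (use F L' L_pure in auto)
    qed (use F L' in auto)
  qed
  then show "tr \<in> linear_maps fscale ?SM fscale ?SA"
    "length Us = ?m \<Longrightarrow> tr (mtensor sC ?sM ?m c Us) = trace_sum (mtensor sC sA ?m c) Us"
    using L' L_val by simp_all
qed

lemma inclusion_lift:
  fixes sA :: "'k::field \<Rightarrow> 'a::ab_group_add \<Rightarrow> 'a" and sC :: "'k \<Rightarrow> 'c::ab_group_add \<Rightarrow> 'c"
    and p :: "'r::finite" and m :: nat
  assumes A: "vector_space sA" and C: "vector_space sC"
  defines "inc \<equiv> mtensor_lift sC sA m fscale (\<lambda>c as. mtensor sC (mat_scale sA) m c (map (mat_elem p p) as))"
  shows "inc \<in> linear_maps fscale (mtensor_space sC sA m) fscale (mtensor_space sC (mat_scale sA) m)"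
    and "length as = m \<Longrightarrow>
      inc (mtensor sC sA m c as) = mtensor sC (mat_scale sA) m c (map (mat_elem p p) as)"
proof -
  let ?sM = "mat_scale sA :: 'k \<Rightarrow> 'a^'r^'r \<Rightarrow> _"
  have M: "vector_space ?sM" by (rule vector_space_mat_scale[OF A])
  have mt: "multilinear_map sC ?sM m fscale (mtensor sC ?sM m)"
    by (rule mtensor_multilinear[OF C M])
  have ml: "multilinear_map sC sA m fscale (\<lambda>c as. mtensor sC ?sM m c (map (mat_elem p p) as))"
    unfolding multilinear_map_iff_slot_linear slot_linear_def
    using multilinear_map_linear_left[OF mt]
      linear_comp[OF linear_mat_elem[OF A] multilinear_map_slot[OF mt]]
    by simp
  note inc = mtensor_lift_linear_maps[OF vector_space_fscale ml, folded inc_def]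
  show "inc (mtensor sC sA m c as) = mtensor sC ?sM m c (map (mat_elem p p) as)" if "length as = m"
    using inc(2)[OF that] .
  have "inc (mtensor sC sA m c as) \<in> mtensor_space sC ?sM m" if "length as = m" for c as
    using that by (simp add: inc(2) mtensor_in_space)
  then have "linear_on fscale (mtensor_space sC sA m) fscale (mtensor_space sC ?sM m) inc"
    unfolding mtensor_space_def[of sC sA]
    by (intro linear_on_span_into[OF vector_space_fscale vector_space_fscale subspace_mtensor_space
          linear_mapsD[OF inc(1), unfolded mtensor_space_def[of sC sA]]]) blast
  then show "inc \<in> linear_maps fscale (mtensor_space sC sA m) fscale (mtensor_space sC ?sM m)"
    using inc(1) by (simp add: linear_maps_def)
qed

lemma linear_maps_comp:
  assumes "vector_space sV" "vector_space sW" "module.subspace sV T"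
    and g: "g \<in> linear_maps sV T sW U" and f: "f \<in> linear_maps sS S sV T"
  shows "g \<circ> f \<in> linear_maps sS S sW U"
  using linear_on_zero[OF assms(1-3) linear_mapsD[OF g]] f g
  by (auto simp: linear_maps_def linear_on_def)

lemma tr_cochain_form:
  fixes sA :: "'k::field \<Rightarrow> 'a::ab_group_add \<Rightarrow> 'a" and sC :: "'k \<Rightarrow> 'c::ab_group_add \<Rightarrow> 'c"
    and Us :: "('a^'r::finite^'r) list"
  assumes A: "vector_space sA" and C: "vector_space sC" and g: "g \<in> hochschild_cochains sA sC n"
  shows "tr_cochain sA sC n g \<in> hochschild_cochains (mat_scale sA :: _ \<Rightarrow> 'a^'r^'r \<Rightarrow> _) sC n"
    and "length Us = Suc n \<Longrightarrow>
      cochain_form (mat_scale sA) sC n (tr_cochain sA sC n g) c Us = trace_sum (cochain_form sA sC n g c) Us"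
proof -
  have g': "g \<in> linear_maps fscale (mtensor_space sC sA (Suc n)) (*) UNIV"
    using g by (simp add: hochschild_cochains_def)
  show "tr_cochain sA sC n g \<in> hochschild_cochains (mat_scale sA :: _ \<Rightarrow> 'a^'r^'r \<Rightarrow> _) sC n"
    using linear_maps_comp[OF vector_space_fscale vector_space_times subspace_mtensor_space g' gen_trace_eq_trace_sum(1)[OF A C]]
    by (simp add: hochschild_cochains_def tr_cochain_def)
  assume Us: "length Us = Suc n"
  then have "Us \<noteq> []" by auto
  have "g (trace_sum (mtensor sC sA (Suc n) c) Us) = trace_sum (cochain_form sA sC n g c) Us"
    using Us \<open>Us \<noteq> []\<close>
    by (intro linear_on_trace_sum(2)[OF vector_space_fscale vector_space_times subspace_mtensor_space linear_mapsD[OF g']]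
        mtensor_in_space) auto
  then show "cochain_form (mat_scale sA) sC n (tr_cochain sA sC n g) c Us = trace_sum (cochain_form sA sC n g c) Us"
    by (simp add: tr_cochain_def gen_trace_eq_trace_sum(2)[OF A C Us])
qed

lemma inc_cochain_form:
  fixes sA :: "'k::field \<Rightarrow> 'a::ab_group_add \<Rightarrow> 'a" and sC :: "'k \<Rightarrow> 'c::ab_group_add \<Rightarrow> 'c"
    and g :: "('c, ('a^('r::{finite,linorder})^('r::{finite,linorder})) list, 'k) tensor \<Rightarrow> 'k"
  assumes A: "vector_space sA" and C: "vector_space sC" and g: "g \<in> hochschild_cochains (mat_scale sA) sC n"
  shows "inc_cochain sA sC n g \<in> hochschild_cochains sA sC n"
    and "length as = Suc n \<Longrightarrow>
      cochain_form sA sC n (inc_cochain sA sC n g) c as =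
      cochain_form (mat_scale sA) sC n g c (map (mat_elem (Min UNIV) (Min UNIV)) as)"
proof -
  have g': "g \<in> linear_maps fscale (mtensor_space sC (mat_scale sA) (Suc n)) (*) UNIV"
    using g by (simp add: hochschild_cochains_def)
  have inc: "inc_one = (mat_elem (Min UNIV) (Min UNIV) :: 'a \<Rightarrow> (('a, 'r) vec, 'r) vec)"
    by (simp add: fun_eq_iff inc_one_def)
  show "inc_cochain sA sC n g \<in> hochschild_cochains sA sC n"
    using linear_maps_comp[OF vector_space_fscale vector_space_times subspace_mtensor_space g' inclusion_lift(1)[OF A C]]
    by (simp add: hochschild_cochains_def inc_cochain_def inc)
  show "cochain_form sA sC n (inc_cochain sA sC n g) c as =
      cochain_form (mat_scale sA) sC n g c (map (mat_elem (Min UNIV) (Min UNIV)) as)" if "length as = Suc n"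
    using inclusion_lift(2)[OF A C that, where c = c and p = "Min UNIV :: 'r"]
    by (simp add: inc_cochain_def inc)
qed

context entwining_structure
begin

lemma homotopy_inverses_trace_inclusion:
  "homotopy_inverses fscale (hochschild_cochains sA sC) (hochschild_diff sA mA sC \<psi>)
     fscale (hochschild_cochains (mat_scale sA :: _ \<Rightarrow> 'a^('r::{finite,linorder})^('r::{finite,linorder}) \<Rightarrow> _) sC)
     (hochschild_diff (mat_scale sA) (mat_mult mA) sC (mat_psi sA sC \<psi>))
     (tr_cochain sA sC) (inc_cochain sA sC)"
proof -
  interpret H: entwined_complex sA mA uA sC ent \<psi> by (rule entwined_complex)
  interpret M: entwined_complex "mat_scale sA" "mat_mult mA" "mat_one uA :: (('a, 'r) vec, 'r) vec" sC "mat_ent ent" "mat_psi sA sC \<psi>"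
    by (rule entwined_complex_mat)
  let ?E = "mat_elem (Min UNIV) (Min UNIV) :: 'a \<Rightarrow> (('a, 'r) vec, 'r) vec"
  let ?tr = "tr_cochain sA sC :: nat \<Rightarrow> _ \<Rightarrow> ('c, ((('a, 'r) vec, 'r) vec) list, 'k) tensor \<Rightarrow> 'k"
  let ?inc = "inc_cochain sA sC :: nat \<Rightarrow> (('c, ((('a, 'r) vec, 'r) vec) list, 'k) tensor \<Rightarrow> 'k) \<Rightarrow> _"
  note tr = tr_cochain_form[OF vsA vsC] and inc = inc_cochain_form[OF vsA vsC]
  have tr_map: "cochain_map fscale H.X H.\<delta> fscale M.X M.\<delta> ?tr"
    unfolding cochain_map_def
  proof (intro conjI allI ballI H.hochschild_complex M.hochschild_complex)
    fix n
    show "linear_on fscale (H.X n) fscale (M.X n) (?tr n)"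
    proof (rule M.linear_on_cochainsI)
      show "?tr n g \<in> M.X n" if "g \<in> H.X n" for g by (rule tr(1)[OF that])
    qed (simp_all add: cochains_subspace tr_cochain_def fscale_def)
    fix g assume g: "g \<in> H.X n"
    show "?tr (Suc n) (H.\<delta> n g) = M.\<delta> n (?tr n g)"
    proof (rule cochain_eqI[OF tr(1)[OF H.hochschild_diff_cochain(1)[OF g]]
          M.hochschild_diff_cochain(1)[OF tr(1)[OF g]]])
      fix c and Us :: "((('a, 'r) vec, 'r) vec) list" assume Us: "length Us = Suc (Suc n)"
      then have "Us \<noteq> []" by auto
      have "M.form_of (Suc n) (?tr (Suc n) (H.\<delta> n g)) c Us =
          trace_sum (H.form_of (Suc n) (H.\<delta> n g) c) Us"
        by (rule tr(2)[OF H.hochschild_diff_cochain(1)[OF g] Us])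
      also have "\<dots> = trace_sum (H.differential n (H.form_of n g) c) Us"
        using \<open>Us \<noteq> []\<close> by (rule cyclic_sum_cong) (simp add: H.hochschild_diff_cochain(2)[OF g] Us)
      also have "\<dots> = M.differential n (\<lambda>c. trace_sum (H.form_of n g c)) c Us"
        using H.trace_face[OF H.form_of_form[OF g] Us]
        by (simp add: H.differential_def[abs_def] M.differential_def cyclic_sum_linear_combination del: sum.atMost_Suc)
      also have "\<dots> = M.differential n (M.form_of n (?tr n g)) c Us"
        using Us by (intro M.differential_cong) (simp_all add: tr(2)[OF g])
      also have "\<dots> = M.form_of (Suc n) (M.\<delta> n (?tr n g)) c Us"
        using M.hochschild_diff_cochain(2)[OF tr(1)[OF g] Us] by simp
      finally show "M.form_of (Suc n) (?tr (Suc n) (H.\<delta> n g)) c Us = M.form_of (Suc n) (M.\<delta> n (?tr n g)) c Us" .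
    qed
  qed
  have inc_map: "cochain_map fscale M.X M.\<delta> fscale H.X H.\<delta> ?inc"
    unfolding cochain_map_def
  proof (intro conjI allI ballI H.hochschild_complex M.hochschild_complex)
    fix n
    show "linear_on fscale (M.X n) fscale (H.X n) (?inc n)"
    proof (rule H.linear_on_cochainsI)
      show "?inc n g \<in> H.X n" if "g \<in> M.X n" for g by (rule inc(1)[OF that])
    qed (simp_all add: cochains_subspace inc_cochain_def fscale_def)
    fix g :: "('c, ((('a, 'r) vec, 'r) vec) list, 'k) tensor \<Rightarrow> 'k" assume g: "g \<in> M.X n"
    show "?inc (Suc n) (M.\<delta> n g) = H.\<delta> n (?inc n g)"
    proof (rule cochain_eqI[OF inc(1)[OF M.hochschild_diff_cochain(1)[OF g]]
          H.hochschild_diff_cochain(1)[OF inc(1)[OF g]]])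
      fix c and as :: "'a list" assume as: "length as = Suc (Suc n)"
      have "H.form_of (Suc n) (?inc (Suc n) (M.\<delta> n g)) c as = M.differential n (M.form_of n g) c (map ?E as)"
        using inc(2)[OF M.hochschild_diff_cochain(1)[OF g] as] M.hochschild_diff_cochain(2)[OF g, of "map ?E as"] as
        by simp
      also have "\<dots> = H.differential n (\<lambda>c as. M.form_of n g c (map ?E as)) c as"
        using H.inclusion_face[OF M.form_of_form[OF g] as]
        by (simp add: H.differential_def M.differential_def del: sum.atMost_Suc)
      also have "\<dots> = H.differential n (H.form_of n (?inc n g)) c as"
        using as by (intro H.differential_cong) (simp_all add: inc(2)[OF g])
      also have "\<dots> = H.form_of (Suc n) (H.\<delta> n (?inc n g)) c as"
        using H.hochschild_diff_cochain(2)[OF inc(1)[OF g] as] by simp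
      finally show "H.form_of (Suc n) (?inc (Suc n) (M.\<delta> n g)) c as = H.form_of (Suc n) (H.\<delta> n (?inc n g)) c as" .
    qed
  qed
  have inc_tr: "?inc n (?tr n g) = g" if g: "g \<in> H.X n" for n g
  proof (rule cochain_eqI[OF inc(1)[OF tr(1)[OF g]] g])
    fix c and as :: "'a list" assume as: "length as = Suc n"
    then have "as \<noteq> []" by auto
    have "H.form_of n (?inc n (?tr n g)) c as = M.form_of n (?tr n g) c (map ?E as)"
      by (rule inc(2)[OF tr(1)[OF g] as])
    also have "\<dots> = trace_sum (H.form_of n g c) (map ?E as)"
      by (rule tr(2)[OF g]) (simp add: as)
    also have "\<dots> = H.form_of n g c as"
      using multilinear_map_slot_linear[OF H.form_of_form[OF g]] as \<open>as \<noteq> []\<close> by (intro H.trace_inclusion) simp_all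
    finally show "H.form_of n (?inc n (?tr n g)) c as = H.form_of n g c as" .
  qed
  have "cochain_homotopic fscale H.X H.\<delta> fscale H.X H.\<delta> (\<lambda>n. ?inc n \<circ> ?tr n) (\<lambda>n. id)"
    unfolding cochain_homotopic_def
  proof (intro exI conjI allI ballI)
    fix n
    show "linear_on fscale (H.X (Suc n)) fscale (H.X n) (\<lambda>g. 0)"
      by (simp add: linear_on_def fs.subspace_0[OF cochains_subspace] fs.scale_zero_right)
    have "H.\<delta> n 0 = 0"
      using H.hochschild_complex unfolding cochain_complex_def
      by (blast intro: linear_on_zero[OF vector_space_fscale vector_space_fscale cochains_subspace])
    then show "(?inc (Suc n) \<circ> ?tr (Suc n)) g - id g = H.\<delta> n 0 + 0" if "g \<in> H.X (Suc n)" for g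
      using inc_tr[OF that] by simp
  qed (simp add: inc_tr)
  moreover have "cochain_homotopic fscale M.X M.\<delta> fscale M.X M.\<delta> (\<lambda>n. ?tr n \<circ> ?inc n) (\<lambda>n. id)"
  proof -
    define h where "h = M.homotopy (\<lambda>k. mat_elem (Min UNIV) k uA) (\<lambda>k. mat_elem k (Min UNIV) uA)"
    note h = H.matrix_homotopy[where p = "Min UNIV :: 'r", folded h_def]
    \<comment> \<open>\<open>matrix_homotopy\<close> expresses the identity minus \<open>tr \<circ> inc\<close>, whence the sign.\<close>
    define K where "K n g = cochain_of_form (mat_scale sA) sC n (\<lambda>c as. (- 1) * h (Suc n) (M.form_of (Suc n) g) c as)" for n g
    have K_form: "M.form (Suc n) (\<lambda>c as. (- 1) * h (Suc n) (M.form_of (Suc n) g) c as)" if "g \<in> M.X (Suc n)" for n g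
      by (rule multilinear_map_compose[OF h(1)[OF M.form_of_form[OF that]] linear_times_const])
    have K: "K n g \<in> M.X n" if "g \<in> M.X (Suc n)" for n g
      unfolding K_def by (rule cochain_of_form(1)[OF K_form[OF that]])
    have K_val: "M.form_of n (K n g) c as = (- 1) * h (Suc n) (M.form_of (Suc n) g) c as"
      if "g \<in> M.X (Suc n)" "length as = Suc n" for n g c as
      unfolding K_def by (rule cochain_of_form(2)[OF K_form[OF that(1)] that(2)])
    have K_lin: "linear_on fscale (M.X (Suc n)) fscale (M.X n) (K n)" for n
    proof (rule M.linear_on_cochainsI[OF K cochains_subspace])
      fix g g' c k and as :: "(('a, 'r) vec, 'r) vec list" assume g: "g \<in> M.X (Suc n)" and as: "length as = Suc n"
      show "M.form_of n (K n (fscale k g)) c as = k * M.form_of n (K n g) c as"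
        using K_val[OF g as] K_val[OF fs.subspace_scale[OF cochains_subspace g] as]
        by (simp add: h_def fscale_def M.homotopy_scale)
      assume g': "g' \<in> M.X (Suc n)"
      show "M.form_of n (K n (g + g')) c as = M.form_of n (K n g) c as + M.form_of n (K n g') c as"
        using K_val[OF g as] K_val[OF g' as] K_val[OF fs.subspace_add[OF cochains_subspace g g'] as]
        by (simp add: h_def M.homotopy_add)
    qed
    have tr_inc: "M.form_of n (?tr n (?inc n g)) c Us = trace_sum (\<lambda>xs. M.form_of n g c (map ?E xs)) Us"
      if g: "g \<in> M.X n" and Us: "length Us = Suc n" for n g c Us
    proof -
      have "Us \<noteq> []" using Us by auto
      then show ?thesis
        unfolding tr(2)[OF inc(1)[OF g] Us] by (rule cyclic_sum_cong) (simp add: inc(2)[OF g] Us)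
    qed
    have K_diff: "M.form_of n (K n (M.\<delta> n g)) c Us = (- 1) * h (Suc n) (M.differential n (M.form_of n g)) c Us"
      if g: "g \<in> M.X n" and Us: "length Us = Suc n" for n g c Us
      unfolding K_val[OF M.hochschild_diff_cochain(1)[OF g] Us] h_def
      by (rule arg_cong[OF M.homotopy_cong[OF M.hochschild_diff_cochain(2)[OF g] Us]])
    show ?thesis
      unfolding cochain_homotopic_def
    proof (intro exI[of _ K] conjI allI ballI K_lin)
      fix g assume g: "g \<in> M.X 0"
      show "(?tr 0 \<circ> ?inc 0) g - id g = K 0 (M.\<delta> 0 g)"
      proof (rule cochain_eqI)
        fix c and Us :: "((('a, 'r) vec, 'r) vec) list" assume Us: "length Us = Suc 0"
        show "M.form_of 0 ((?tr 0 \<circ> ?inc 0) g - id g) c Us = M.form_of 0 (K 0 (M.\<delta> 0 g)) c Us"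
          unfolding K_diff[OF g Us] using tr_inc[OF g Us, of c] h(2)[OF M.form_of_form[OF g] Us, of c] by simp
      qed (simp_all add: fs.subspace_diff[OF cochains_subspace] tr inc g K M.hochschild_diff_cochain)
    next
      fix n g assume g: "g \<in> M.X (Suc n)"
      show "(?tr (Suc n) \<circ> ?inc (Suc n)) g - id g = M.\<delta> n (K n g) + K (Suc n) (M.\<delta> (Suc n) g)"
      proof (rule cochain_eqI)
        fix c and Us :: "((('a, 'r) vec, 'r) vec) list" assume Us: "length Us = Suc (Suc n)"
        have "M.form_of (Suc n) (M.\<delta> n (K n g)) c Us = M.differential n (M.form_of n (K n g)) c Us"
          by (rule M.hochschild_diff_cochain(2)[OF K[OF g] Us])
        also have "\<dots> = M.differential n (\<lambda>c as. (- 1) * h (Suc n) (M.form_of (Suc n) g) c as) c Us"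
          by (rule M.differential_cong[OF K_val[OF g] Us])
        also have "\<dots> = (- 1) * M.differential n (h (Suc n) (M.form_of (Suc n) g)) c Us"
          by (rule M.differential_linear)
        finally show "M.form_of (Suc n) ((?tr (Suc n) \<circ> ?inc (Suc n)) g - id g) c Us =
            M.form_of (Suc n) (M.\<delta> n (K n g) + K (Suc n) (M.\<delta> (Suc n) g)) c Us"
          using K_diff[OF g Us, of c] tr_inc[OF g Us, of c] h(2)[OF M.form_of_form[OF g] Us, of c] by (simp add: algebra_simps)
      qed (simp_all add: fs.subspace_diff[OF cochains_subspace] fs.subspace_add[OF cochains_subspace]
          tr inc g K M.hochschild_diff_cochain)
    qed
  qed
  ultimately show ?thesis
    using tr_map inc_map by (simp add: homotopy_inverses_def)
qed

end


section \<open>Homotopy inverses on cohomology\<close>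

lemma coboundaries_subspace:
  assumes X: "cochain_complex s X d"
  shows "module.subspace s (coboundaries X d n)" and "coboundaries X d n \<subseteq> cocycles X d n"
proof -
  interpret vector_space s using X by (simp add: cochain_complex_def)
  have sub: "subspace (X m)" and lin: "linear_on s (X m) s (X (Suc m)) (d m)" for m
    using X by (auto simp: cochain_complex_def)
  have d0: "d m 0 = 0" for m
    using lin[of m] subspace_0[OF sub, of m] unfolding linear_on_def by (metis scale_zero_left)
  show "subspace (coboundaries X d n)"
  proof (cases n)
    case (Suc m)
    have "d m x + d m y \<in> d m ` X m" "s k (d m x) \<in> d m ` X m" if "x \<in> X m" "y \<in> X m" for x y k
      using lin[of m] that subspace_add[OF sub that] subspace_scale[OF sub that(1), of k]
      by (auto simp: linear_on_def image_iff intro: bexI[of _ "x + y"] bexI[of _ "s k x"])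
    then show ?thesis
      using d0[of m] subspace_0[OF sub, of m] by (auto simp: Suc coboundaries_def subspace_def image_iff)
  qed (simp add: coboundaries_def subspace_def)
  show "coboundaries X d n \<subseteq> cocycles X d n"
    using X d0 subspace_0[OF sub]
    by (cases n) (auto simp: coboundaries_def cocycles_def cochain_complex_def linear_on_def)
qed

lemma coh_class_eqI:
  assumes X: "cochain_complex s X d" and "x - y \<in> coboundaries X d n"
  shows "coh_class X d n x = coh_class X d n y"
proof -
  interpret vector_space s using X by (simp add: cochain_complex_def)
  note sub = coboundaries_subspace(1)[OF X, of n]
  have "x + b = y + ((x - y) + b)" "y + b = x + (b - (x - y))" for b by (simp_all add: algebra_simps)
  then show ?thesis
    unfolding coh_class_def using subspace_add[OF sub assms(2)] subspace_diff[OF sub _ assms(2)] by blast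
qed

text \<open>
  Maps on cohomology are defined as unions over all representatives. If coboundaries are
  respected, all representatives contribute the same class.
\<close>

lemma coh_class_Union:
  assumes X: "cochain_complex s X d" and Y: "cochain_complex s' Y d'"
    and f: "linear_on s (X n) s' (Y m) f" and B: "f ` coboundaries X d n \<subseteq> coboundaries Y d' m"
    and x: "x \<in> X n"
  shows "(\<Union>z\<in>coh_class X d n x. coh_class Y d' m (f z)) = coh_class Y d' m (f x)"
proof -
  interpret vector_space s using X by (simp add: cochain_complex_def)
  have "coh_class Y d' m (f (x + b)) = coh_class Y d' m (f x)" if b: "b \<in> coboundaries X d n" for b
  proof (rule coh_class_eqI[OF Y])
    have "b \<in> X n" using b coboundaries_subspace(2)[OF X] by (auto simp: cocycles_def)
    then have "f (x + b) = f x + f b" using f x by (simp add: linear_on_def)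
    then show "f (x + b) - f x \<in> coboundaries Y d' m" using B b by auto
  qed
  then show ?thesis
    using subspace_0[OF coboundaries_subspace(1)[OF X, of n]]
    by (auto simp: coh_class_def[of X])
qed

lemma coh_scale_class:
  assumes X: "cochain_complex s X d" and x: "x \<in> X n"
  shows "coh_scale s X d n k (coh_class X d n x) = coh_class X d n (s k x)"
proof -
  interpret vector_space s using X by (simp add: cochain_complex_def)
  have "linear_on s (X n) s (X n) (s k)"
    using X by (auto simp: linear_on_def cochain_complex_def scale_right_distrib mult.commute subspace_scale)
  then show ?thesis
    unfolding coh_scale_def
    by (rule coh_class_Union[OF X X _ _ x]) (auto intro: subspace_scale[OF coboundaries_subspace(1)[OF X]])
qed

lemma coh_add_class:
  assumes X: "cochain_complex s X d"
  shows "coh_add (coh_class X d n x) (coh_class X d n y) = coh_class X d n (x + y)"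
proof -
  interpret vector_space s using X by (simp add: cochain_complex_def)
  note sub = coboundaries_subspace(1)[OF X, of n]
  have "(x + b) + (y + c) = (x + y) + (b + c)" "(x + y) + b = (x + b) + (y + 0)" for b c
    by (simp_all add: algebra_simps)
  then show ?thesis
    unfolding coh_add_def coh_class_def using subspace_add[OF sub] subspace_0[OF sub] by blast
qed

lemma cochain_map_coh:
  assumes f: "cochain_map s X d s' Y d' f"
  shows "x \<in> X n \<Longrightarrow> coh_map Y d' f n (coh_class X d n x) = coh_class Y d' n (f n x)"
    and "x \<in> cocycles X d n \<Longrightarrow> f n x \<in> cocycles Y d' n"
proof -
  have X: "cochain_complex s X d" and Y: "cochain_complex s' Y d'"
    and lin: "linear_on s (X m) s' (Y m) (f m)"
    and comm: "x \<in> X m \<Longrightarrow> f (Suc m) (d m x) = d' m (f m x)" for m x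
    using f by (auto simp: cochain_map_def)
  interpret X: vector_space s using X by (simp add: cochain_complex_def)
  interpret Y: vector_space s' using Y by (simp add: cochain_complex_def)
  have f0: "f m 0 = 0" for m
  proof -
    have "0 \<in> X m" using X X.subspace_0 by (auto simp: cochain_complex_def)
    then have "f m (s 0 0) = s' 0 (f m 0)" using lin[of m] unfolding linear_on_def by blast
    then show ?thesis by simp
  qed
  have "f n ` coboundaries X d n \<subseteq> coboundaries Y d' n"
    using lin by (cases n) (auto simp: coboundaries_def f0 comm linear_on_def)
  then show "coh_map Y d' f n (coh_class X d n x) = coh_class Y d' n (f n x)" if "x \<in> X n"
    unfolding coh_map_def by (rule coh_class_Union[OF X Y lin _ that])
  show "f n x \<in> cocycles Y d' n" if "x \<in> cocycles X d n"
    using that lin[of n] comm[of x n] by (simp add: cocycles_def linear_on_def f0)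
qed

lemma cochain_map_coh_linear:
  assumes f: "cochain_map s X d s' Y d' f"
  shows "coh_linear s X d s' Y d' n (coh_map Y d' f n)"
proof -
  have X: "cochain_complex s X d" and Y: "cochain_complex s' Y d'" and lin: "linear_on s (X n) s' (Y n) (f n)"
    using f by (auto simp: cochain_map_def)
  interpret X: vector_space s using X by (simp add: cochain_complex_def)
  have sub: "X.subspace (X n)" using X by (simp add: cochain_complex_def)
  have Z: "x \<in> X n" if "x \<in> cocycles X d n" for x using that by (simp add: cocycles_def)
  note cls = cochain_map_coh(1)[OF f, of _ n]
  have in_Y: "f n x \<in> Y n" if "x \<in> X n" for x using lin that by (simp add: linear_on_def)
  show ?thesis
    unfolding coh_linear_def cohomology_def
    using lin cochain_map_coh(2)[OF f]
    by (auto simp: cls Z coh_add_class[OF X] coh_add_class[OF Y] coh_scale_class[OF X] coh_scale_class[OF Y]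
        in_Y X.subspace_add[OF sub] X.subspace_scale[OF sub] linear_on_def)
qed

text \<open>
  On a cocycle the homotopy formula reads \<open>g x - x = d (h x)\<close>, or \<open>g x - x = h 0\<close> in degree \<open>0\<close>.
\<close>

lemma homotopic_to_id_coh:
  assumes X: "cochain_complex s X d" and h: "cochain_homotopic s X d s X d g (\<lambda>n. id)"
    and x: "x \<in> cocycles X d n"
  shows "coh_class X d n (g n x) = coh_class X d n x"
proof (rule coh_class_eqI[OF X])
  obtain h where h: "\<forall>m. linear_on s (X (Suc m)) s (X m) (h m)"
      "\<forall>y\<in>X 0. g 0 y - id y = h 0 (d 0 y)"
      "\<forall>m. \<forall>y\<in>X (Suc m). g (Suc m) y - id y = d m (h m y) + h (Suc m) (d (Suc m) y)"
    using h unfolding cochain_homotopic_def by blast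
  then have h_lin: "linear_on s (X (Suc m)) s (X m) (h m)"
    and h0: "y \<in> X 0 \<Longrightarrow> g 0 y - y = h 0 (d 0 y)"
    and hS: "y \<in> X (Suc m) \<Longrightarrow> g (Suc m) y - y = d m (h m y) + h (Suc m) (d (Suc m) y)" for m y
    by simp_all
  interpret X: vector_space s using X by (simp add: cochain_complex_def)
  have zero: "h m 0 = 0" for m
  proof -
    have "0 \<in> X (Suc m)" using X X.subspace_0 by (auto simp: cochain_complex_def)
    then have "h m (s 0 0) = s 0 (h m 0)" using h_lin[of m] unfolding linear_on_def by blast
    then show ?thesis by simp
  qed
  show "g n x - x \<in> coboundaries X d n"
    using x h_lin by (cases n) (auto simp: cocycles_def coboundaries_def h0 hS zero linear_on_def)
qed

theorem homotopy_inverses_coh_isomorphisms: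
  assumes "homotopy_inverses s X d s' Y d' f g"
  shows "inverse_coh_isomorphisms s X d s' Y d' n (coh_map Y d' f n) (coh_map X d g n)"
proof -
  have f: "cochain_map s X d s' Y d' f" and g: "cochain_map s' Y d' s X d g"
    and gf: "cochain_homotopic s X d s X d (\<lambda>n. g n \<circ> f n) (\<lambda>n. id)"
    and fg: "cochain_homotopic s' Y d' s' Y d' (\<lambda>n. f n \<circ> g n) (\<lambda>n. id)"
    using assms by (auto simp: homotopy_inverses_def)
  have X: "cochain_complex s X d" and Y: "cochain_complex s' Y d'" using f by (auto simp: cochain_map_def)
  have Z: "x \<in> X n \<and> f n x \<in> Y n" if "x \<in> cocycles X d n" for x
    using that cochain_map_coh(2)[OF f that] by (simp add: cocycles_def)
  have Z': "y \<in> Y n \<and> g n y \<in> X n" if "y \<in> cocycles Y d' n" for y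
    using that cochain_map_coh(2)[OF g that] by (simp add: cocycles_def)
  show ?thesis
    unfolding inverse_coh_isomorphisms_def
    using homotopic_to_id_coh[OF X gf] homotopic_to_id_coh[OF Y fg] Z Z'
    by (auto simp: cohomology_def cochain_map_coh_linear[OF f] cochain_map_coh_linear[OF g]
        cochain_map_coh(1)[OF f] cochain_map_coh(1)[OF g])
qed


section \<open>Morita invariance\<close>

theorem proposition5p5:
  fixes sA :: "'k::field \<Rightarrow> 'a::ab_group_add \<Rightarrow> 'a"
    and mA :: "'a \<Rightarrow> 'a \<Rightarrow> 'a" and uA :: 'a
    and sC :: "'k \<Rightarrow> 'c::ab_group_add \<Rightarrow> 'c"
    and \<Delta> :: "'c \<Rightarrow> ('c, 'c, 'k) tensor" and \<epsilon> :: "'c \<Rightarrow> 'k"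
    and \<psi> :: "('c, 'a, 'k) tensor \<Rightarrow> ('a, 'c, 'k) tensor"
  assumes "entwining_structure sA mA uA sC \<Delta> \<epsilon> \<psi>"
  shows
    "let X = hochschild_cochains sA sC;
         d = hochschild_diff sA mA sC \<psi>;
         Y = hochschild_cochains (mat_scale sA) sC;
         d' = hochschild_diff (mat_scale sA) (mat_mult mA) sC (mat_psi sA sC \<psi>);
         tr = tr_cochain sA sC
           :: nat \<Rightarrow> (('c, 'a list, 'k) tensor \<Rightarrow> 'k) \<Rightarrow>
                (('c, ('a^('r::{finite,linorder})^('r::{finite,linorder})) list, 'k) tensor \<Rightarrow> 'k);
         inc = inc_cochain sA sC
     in homotopy_inverses fscale X d fscale Y d' tr inc \<and>
        (\<forall>n. inverse_coh_isomorphisms fscale X d fscale Y d' n (coh_map Y d' tr n) (coh_map X d inc n))"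
  using entwining_structure.homotopy_inverses_trace_inclusion[OF assms]
    homotopy_inverses_coh_isomorphisms[OF entwining_structure.homotopy_inverses_trace_inclusion[OF assms]]
  unfolding Let_def by blast

end
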